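(* Let $d\ge1$, let $\alpha\in(0,1)$ be such that $1/\alpha\in\mathbb{N}$, and let $\Omega\subset\mathbb{R}^d$ be an open set of finite Lebesgue measure and finite perimeter. Let $(p_t)_{t\ge0}$ be the $\alpha$-stable semigroup on $\mathbb{R}^d$. Then $$\lim_{t\to0^+}\left(t^{1/\alpha}\log(1/t)\right)^{-1}\left(H(t)-\sum_{n=1}^{1/\alpha-1}\frac{(-1)^{n-1}}{n!}t^n\,\mathrm{Per}_{\nu^{(n\alpha)}}(\Omega)\right)=\frac{(-1)^{1/\alpha-1}}{(1/\alpha-1)!\,\pi}\,\mathrm{Per}(\Omega).$$
   Context: The $\alpha$-stable semigroup $(p_t)_{t\ge0}$ on $\mathbb{R}^d$ is the convolution semigroup of probability measures with $\int_{\mathbb{R}^d}e^{i\langle\xi,x\rangle}p_t(dx)=e^{-t|\xi|^\alpha}$. $H(t)=\int_\Omega\int_{\Omega^c-x}p_t(dy)\,dx$ (so the heat content $H_\Omega(t)=\int_\Omega\int_{\Omega-x}p_t(dy)\,dx$ equals $|\Omega|-H(t)$). For $s\in(0,1)$, $\nu^{(s)}(dz)=\mathcal{A}_{d,-s}|z|^{-d-s}\,dz$ with $\mathcal{A}_{d,-s}=\frac{2^s\,\Gamma((d+s)/2)}{\pi^{d/2}\,|\Gamma(-s/2)|}$, and $\mathrm{Per}_{\nu^{(s)}}(\Omega)=\int_\Omega\int_{\Omega^c-x}\nu^{(s)}(dy)\,dx=\mathcal{A}_{d,-s}\int_\Omega\int_{\Omega^c}\frac{dy\,dx}{|x-y|^{d+s}}$.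 $\mathrm{Per}(\Omega)=\sup\{\int_\Omega\mathrm{div}\,\phi(x)\,dx:\phi\in C_c^1(\mathbb{R}^d,\mathbb{R}^d),\ \|\phi\|_\infty\le1\}$ is the classical perimeter. *)

theory Defs
  imports "HOL-Probability.Probability"
begin

text \<open>
  The characteristic function alone determines the family; the convolution identity is kept
  because it is part of the notion of a convolution semigroup. Nothing is required for negative
  times. At \<open>\<xi> = 0\<close> the right-hand side is \<open>1\<close>, since \<open>0 powr \<alpha> = 0\<close>.
\<close>

definition stable_semigroup :: "real \<Rightarrow> (real \<Rightarrow> (real ^ 'n) measure) \<Rightarrow> bool" where
  "stable_semigroup \<alpha> p \<longleftrightarrow>
     (\<forall>t\<ge>0. prob_space (p t) \<and> sets (p t) = sets borel) \<and>
     (\<forall>s\<ge>0. \<forall>t\<ge>0. p (s + t) = convolution (p s) (p t)) \<and>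
     (\<forall>t\<ge>0. \<forall>\<xi>. (CLINT x|p t. iexp (\<xi> \<bullet> x)) = complex_of_real (exp (- t * norm \<xi> powr \<alpha>)))"

text \<open>
  The set \<open>(\<lambda>z. z - x) ` (- \<Omega>)\<close> is the translated complement \<open>\<Omega>\<^sup>c - x\<close>. Both the function \<open>H\<close>
  and the nonlocal perimeter are \<open>\<integral>\<^sub>\<Omega> \<nu>(\<Omega>\<^sup>c - x) dx\<close>, so they are values in \<open>[0, \<infinity>]\<close> of one functional.
\<close>

definition nonlocal_perimeter :: "(real ^ 'n) measure \<Rightarrow> (real ^ 'n) set \<Rightarrow> ennreal" where
  "nonlocal_perimeter \<nu> \<Omega> = (\<integral>\<^sup>+x\<in>\<Omega>. emeasure \<nu> ((\<lambda>z. z - x) ` (- \<Omega>)) \<partial>lborel)"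

definition heat_loss :: "(real \<Rightarrow> (real ^ 'n) measure) \<Rightarrow> (real ^ 'n) set \<Rightarrow> real \<Rightarrow> ennreal" where
  "heat_loss p \<Omega> t = nonlocal_perimeter (p t) \<Omega>"

text \<open>The constant \<open>\<A>\<^bsub>d,-s\<^esub>\<close>.\<close>

definition stable_const :: "nat \<Rightarrow> real \<Rightarrow> real" where
  "stable_const d s =
     2 powr s * Gamma ((real d + s) / 2) / (pi powr (real d / 2) * \<bar>Gamma (- s / 2)\<bar>)"

definition stable_levy_measure :: "real \<Rightarrow> (real ^ 'n) measure" where
  "stable_levy_measure s =
     density lborel (\<lambda>z. ennreal (stable_const CARD('n) s * norm z powr (- real CARD('n) - s)))"

definition C1_compact_support :: "(real ^ 'n \<Rightarrow> real ^ 'n) \<Rightarrow> bool" where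
  "C1_compact_support \<phi> \<longleftrightarrow>
     (\<exists>\<phi>'. (\<forall>x. (\<phi> has_derivative blinfun_apply (\<phi>' x)) (at x)) \<and> continuous_on UNIV \<phi>') \<and>
     compact (closure {x. \<phi> x \<noteq> 0})"

definition divergence :: "(real ^ 'n \<Rightarrow> real ^ 'n) \<Rightarrow> real ^ 'n \<Rightarrow> real" where
  "divergence \<phi> x = (\<Sum>i\<in>UNIV. frechet_derivative \<phi> (at x) (axis i 1) $ i)"

definition perimeter :: "(real ^ 'n) set \<Rightarrow> ereal" where
  "perimeter \<Omega> =
     (SUP \<phi> \<in> {\<phi>. C1_compact_support \<phi> \<and> (\<forall>x. norm (\<phi> x) \<le> 1)}.
        ereal (LINT x:\<Omega>|lborel. divergence \<phi> x))"

end

theory Submission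
  imports Defs
begin

text \<open>
  Let \<open>f\<close> be the indicator function of \<open>\<Omega>\<close> and \<open>g(y) = |\<Omega> \<inter> (\<Omega> - y)|\<close> its covariogram. Both the heat
  loss \<open>H(t)\<close> and the nonlocal perimeters are integrals of \<open>|\<Omega>| - g\<close>, against \<open>p\<^sub>t\<close> and against the Levy
  measure. The function \<open>g\<close> is continuous, since \<open>\<Omega>\<close> is open and of finite volume, and it is the cosine
  transform of a finite measure \<open>\<mu>\<close>, namely \<open>|F(\<xi>)|\<^sup>2 d\<xi> / (2 \<pi>)\<^sup>d\<close> for the Fourier transform \<open>F\<close> of \<open>f\<close>
  (\<open>covariogram_spectral\<close>). By Tonelli's theorem
  \<open>H(t) = \<integral> (1 - exp (- t |\<xi>|\<^sup>\<alpha>)) \<mu>(d\<xi>)\<close> and the perimeter of order \<open>s\<close> is \<open>\<integral> |\<xi>|\<^sup>s \<mu>(d\<xi>)\<close>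
  (\<open>heat_loss_spectral\<close>, \<open>levy_perimeter_spectral\<close>). With \<open>N = 1 / \<alpha>\<close>, the difference in the theorem is
  therefore \<open>(- 1)\<^sup>N\<^sup>-\<^sup>1 \<integral> R\<^sub>N(t |\<xi>|\<^sup>\<alpha>) \<mu>(d\<xi>)\<close>, where \<open>R\<^sub>N\<close> is a Taylor remainder of the exponential function,
  with \<open>R\<^sub>N(v)\<close> close to \<open>v\<^sup>N / N!\<close> for small \<open>v\<close> and of order \<open>v\<^sup>N\<^sup>-\<^sup>1\<close> for large \<open>v\<close>. Because
  \<open>(t |\<xi>|\<^sup>\<alpha>)\<^sup>N = t\<^sup>N |\<xi>|\<close>, the integral behaves like \<open>t\<^sup>N / N!\<close> times the first moment of \<open>\<mu>\<close> truncated at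
  \<open>|\<xi>| = t powr (- 1 / \<alpha>)\<close>, and the logarithm is the rate at which this first moment diverges.

  The rate comes from the Gaussian heat loss
  \<open>G(r) = \<integral> (1 - exp (- r |\<xi>|\<^sup>2)) \<mu>(d\<xi>)\<close>, for which \<open>G(r) / sqrt r\<close> tends to \<open>Per(\<Omega>) / sqrt \<pi>\<close>
  (\<open>gauss_loss_asymptotics\<close>, De Giorgi's description of the perimeter by the heat flow). Let \<open>P\<^sub>s\<close> be the
  heat semigroup. For the upper bound, \<open>G'(s) = - \<integral>\<^sub>\<Omega> div (\<nabla>P\<^sub>s f)\<close>, and the field \<open>\<nabla>P\<^sub>s f\<close> is bounded by
  \<open>1 / (2 sqrt (\<pi> s))\<close> because \<open>0 \<le> f \<le> 1\<close>; so \<open>G'(s) \<le> Per(\<Omega>) / (2 sqrt (\<pi> s))\<close>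
  (\<open>gauss_loss_le_perimeter\<close>). For the lower bound, \<open>2 (|\<Omega>| - g(y))\<close> is the \<open>L\<^sup>1\<close> distance between \<open>f\<close> and
  its translate, hence at least that distance for \<open>u = P\<^sub>s f\<close>. Averaging over a Gaussian of small variance and
  using Fatou's lemma gives at least a multiple of \<open>\<integral> |\<nabla>u|\<close>, and these total variations exhaust the perimeter
  as \<open>s\<close> tends to \<open>0\<close>.

  The two parts are joined by the identity \<open>2 sqrt \<pi> |\<xi>| = \<integral>\<^sub>0\<^sup>\<infinity> r powr (- 3 / 2) (1 - exp (- r |\<xi>|\<^sup>2)) dr\<close>.
  Cutting the mixture off to \<open>T \<le> r \<le> 1\<close> with \<open>T = t\<^sup>2\<^sup>N\<close> performs the truncation of the first moment up to an
  error of order \<open>t\<^sup>N\<close> (\<open>exp_remainder_integral_approx\<close>), and \<open>\<integral>\<^sub>T\<^sup>1 r powr (- 3 / 2) G(r) dr\<close> is a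
  logarithmic average of \<open>G(r) / sqrt r\<close>, hence asymptotic to \<open>(Per(\<Omega>) / sqrt \<pi>) ln (1 / T)\<close>
  (\<open>log_average_tendsto\<close>).
\<close>

section \<open>The Gaussian heat kernel\<close>

text \<open>
  Normalised so that \<open>heat_kernel s\<close> solves the heat equation \<open>\<partial>\<^sub>s u = \<Delta> u\<close>: its Fourier transform
  is \<open>exp (- s |\<xi>|\<^sup>2)\<close>, and each coordinate is normal with variance \<open>2 s\<close>.
\<close>

definition heat_kernel :: "real \<Rightarrow> 'a::euclidean_space \<Rightarrow> real" where
  "heat_kernel s y = (4 * pi * s) powr (- real DIM('a) / 2) * exp (- (norm y)\<^sup>2 / (4 * s))"

definition heat_measure :: "real \<Rightarrow> 'a::euclidean_space measure" where
  "heat_measure s = density lborel (\<lambda>y. ennreal (heat_kernel s y))"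

lemma heat_kernel_nonneg [simp]: "0 \<le> heat_kernel s y"
  by (simp add: heat_kernel_def)

lemma heat_kernel_minus [simp]: "heat_kernel s (- y) = heat_kernel s y"
  by (simp add: heat_kernel_def)

lemma heat_kernel_measurable [measurable]: "heat_kernel s \<in> borel_measurable borel"
  unfolding heat_kernel_def[abs_def] by measurable

lemma sets_heat_measure [measurable_cong, simp]: "sets (heat_measure s) = sets borel"
  by (simp add: heat_measure_def)

lemma space_heat_measure [simp]: "space (heat_measure s) = UNIV"
  by (simp add: heat_measure_def)

lemma heat_kernel_eq_prod:
  fixes y :: "'a::euclidean_space"
  assumes "0 < s"
  shows "heat_kernel s y = (\<Prod>b\<in>Basis. normal_density 0 (sqrt (2 * s)) (y \<bullet> b))"
proof -
  have "(\<Prod>b\<in>(Basis::'a set). normal_density 0 (sqrt (2 * s)) (y \<bullet> b))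
      = (\<Prod>b\<in>(Basis::'a set). (4 * pi * s) powr (- 1 / 2) * exp (- (y \<bullet> b)\<^sup>2 / (4 * s)))"
    using assms by (intro prod.cong) (auto simp: normal_density_def powr_half_sqrt powr_minus_divide)
  also have "\<dots> = ((4 * pi * s) powr (- 1 / 2)) ^ DIM('a) * exp (\<Sum>b\<in>(Basis::'a set). - (y \<bullet> b)\<^sup>2 / (4 * s))"
    by (simp add: prod.distrib exp_sum)
  also have "(\<Sum>b\<in>(Basis::'a set). - (y \<bullet> b)\<^sup>2 / (4 * s)) = - (norm y)\<^sup>2 / (4 * s)"
    by (simp add: sum_divide_distrib[symmetric] sum_negf power2_norm_eq_inner)
      (simp add: euclidean_inner[of y y] power2_eq_square)
  also have "((4 * pi * s) powr (- 1 / 2)) ^ DIM('a) = (4 * pi * s) powr (- real DIM('a) / 2)"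
    using assms by (subst powr_realpow[symmetric]) (auto simp: powr_powr)
  finally show ?thesis by (simp add: heat_kernel_def)
qed

lemma nn_integral_lborel_shift:
  fixes a :: "'a::euclidean_space"
  assumes [measurable]: "f \<in> borel_measurable borel"
  shows "(\<integral>\<^sup>+x. f (x + a) \<partial>lborel) = (\<integral>\<^sup>+x. f x \<partial>lborel)"
proof -
  have "(\<integral>\<^sup>+x. f x \<partial>lborel) = (\<integral>\<^sup>+x. f x \<partial>distr lborel borel ((+) a))"
    by (simp add: lborel_distr_plus)
  also have "\<dots> = (\<integral>\<^sup>+x. f (x + a) \<partial>lborel)"
    by (subst nn_integral_distr) (auto simp: add.commute)
  finally show ?thesis ..
qed

lemma nn_integral_lborel_uminus:
  fixes f :: "'a::euclidean_space \<Rightarrow> ennreal"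
  assumes [measurable]: "f \<in> borel_measurable borel"
  shows "(\<integral>\<^sup>+x. f (- x) \<partial>lborel) = (\<integral>\<^sup>+x. f x \<partial>lborel)"
proof -
  have "(\<integral>\<^sup>+x. f x \<partial>lborel) = (\<integral>\<^sup>+x. f x \<partial>density (distr lborel borel (\<lambda>x::'a. 0 + (-1) *\<^sub>R x)) (\<lambda>_. ennreal (\<bar>-1\<bar>^DIM('a))))"
    by (subst lborel_affine[of "-1" 0]) auto
  also have "\<dots> = (\<integral>\<^sup>+x. f (- x) \<partial>lborel)"
    by (simp add: density_1 nn_integral_distr)
  finally show ?thesis ..
qed

lemma integral_lborel_shift:
  fixes a :: "'a::euclidean_space" and f :: "'a \<Rightarrow> 'b::{banach, second_countable_topology}"
  assumes [measurable]: "f \<in> borel_measurable borel"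
  shows "(LINT x|lborel. f (x + a)) = (LINT x|lborel. f x)"
proof -
  have "(LINT x|lborel. f x) = (LINT x|distr lborel borel ((+) a). f x)"
    by (simp add: lborel_distr_plus)
  also have "\<dots> = (LINT x|lborel. f (x + a))"
    by (subst integral_distr) (auto simp: add.commute)
  finally show ?thesis ..
qed

lemma prob_space_heat_measure:
  assumes "0 < s"
  shows "prob_space (heat_measure s :: 'a::euclidean_space measure)"
proof
  interpret N: prob_space "density lborel (normal_density 0 (sqrt (2 * s)))"
    using assms by (intro prob_space_normal_density) simp
  have one: "(\<integral>\<^sup>+x. ennreal (normal_density 0 (sqrt (2 * s)) x) \<partial>lborel) = 1"
    using N.emeasure_space_1 by (simp add: emeasure_density)
  have "emeasure (heat_measure s) (space (heat_measure s :: 'a measure))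
      = (\<integral>\<^sup>+y. (\<Prod>b\<in>Basis. ennreal (normal_density 0 (sqrt (2 * s)) (y \<bullet> b))) \<partial>(lborel::'a measure))"
    using assms by (auto simp: heat_measure_def emeasure_density heat_kernel_eq_prod prod_ennreal intro!: nn_integral_cong)
  also have "\<dots> = 1"
    by (subst nn_integral_lborel_prod) (simp_all add: one)
  finally show "emeasure (heat_measure s) (space (heat_measure s :: 'a measure)) = 1" .
qed

lemma nn_integral_heat_measure:
  assumes [measurable]: "f \<in> borel_measurable borel"
  shows "(\<integral>\<^sup>+y. f y \<partial>heat_measure s) = (\<integral>\<^sup>+y. ennreal (heat_kernel s y) * f y \<partial>lborel)"
  by (simp add: heat_measure_def nn_integral_density)

lemma integral_heat_measure:
  fixes f :: "'a::euclidean_space \<Rightarrow> 'b::{banach, second_countable_topology}"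
  assumes [measurable]: "f \<in> borel_measurable borel"
  shows "(LINT y|heat_measure s. f y) = (LINT y|lborel. heat_kernel s y *\<^sub>R f y)"
  by (simp add: heat_measure_def integral_density)

lemma char_normal_density:
  assumes "0 < \<sigma>"
  shows "(CLINT x|density lborel (normal_density 0 \<sigma>). iexp (t * x)) = complex_of_real (exp (- (\<sigma> * t)\<^sup>2 / 2))"
proof -
  have "(CLINT x|density lborel (normal_density 0 \<sigma>). iexp (t * x))
      = (CLINT x|lborel. normal_density 0 \<sigma> x *\<^sub>R iexp (t * x))"
    by (subst integral_density) auto
  also have "\<dots> = \<bar>\<sigma>\<bar> *\<^sub>R (CLINT x|lborel. normal_density 0 \<sigma> (0 + \<sigma> * x) *\<^sub>R iexp (t * (0 + \<sigma> * x)))"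
    using assms by (intro lborel_integral_real_affine) auto
  also have "\<dots> = (CLINT x|lborel. (\<sigma> * normal_density 0 \<sigma> (\<sigma> * x)) *\<^sub>R iexp (\<sigma> * t * x))"
    unfolding scaleR_scaleR[symmetric] using assms by (subst integral_scaleR_right) (simp add: algebra_simps)
  also have "(\<lambda>x. \<sigma> * normal_density 0 \<sigma> (\<sigma> * x)) = std_normal_density"
    using assms by (auto simp: fun_eq_iff normal_density_def real_sqrt_mult field_simps power_mult_distrib)
  also have "(CLINT x|lborel. std_normal_density x *\<^sub>R iexp (\<sigma> * t * x)) = char std_normal_distribution (\<sigma> * t)"
    unfolding char_def by (subst integral_density) (auto simp: algebra_simps)
  finally show ?thesis by (simp add: char_std_normal_distribution)
qed

text \<open>
  In coordinates the integrand is a product of one-dimensional ones, and Lebesgue measure is the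
  image of a product measure.
\<close>

lemma char_heat_measure:
  fixes \<xi> :: "'a::euclidean_space"
  assumes "0 < s"
  shows "(CLINT y|heat_measure s. iexp (\<xi> \<bullet> y)) = complex_of_real (exp (- s * (norm \<xi>)\<^sup>2))"
proof -
  let ?n = "normal_density 0 (sqrt (2 * s))"
  have s: "0 < sqrt (2 * s)" using assms by simp
  have N: "(CLINT x|lborel. ?n x *\<^sub>R iexp (t * x)) = complex_of_real (exp (- s * t\<^sup>2))" for t
    using char_normal_density[OF s, of t] assms
    by (subst (asm) integral_density) (auto simp: power_mult_distrib)
  interpret product_sigma_finite "\<lambda>_::'a. lborel :: real measure" ..
  have "(CLINT y|heat_measure s. iexp (\<xi> \<bullet> y)) = (CLINT y|lborel. heat_kernel s y *\<^sub>R iexp (\<xi> \<bullet> y))"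
    by (subst integral_heat_measure) auto
  also have "\<dots> = (CLINT y|(lborel::'a measure). \<Prod>b\<in>Basis. ?n (y \<bullet> b) *\<^sub>R iexp ((\<xi> \<bullet> b) * (y \<bullet> b)))"
  proof (intro Bochner_Integration.integral_cong refl)
    fix y :: 'a
    have "iexp (\<xi> \<bullet> y) = (\<Prod>b\<in>(Basis::'a set). iexp ((\<xi> \<bullet> b) * (y \<bullet> b)))"
      by (subst euclidean_inner) (simp add: exp_sum[symmetric] sum_distrib_left)
    then show "heat_kernel s y *\<^sub>R iexp (\<xi> \<bullet> y) = (\<Prod>b\<in>Basis. ?n (y \<bullet> b) *\<^sub>R iexp ((\<xi> \<bullet> b) * (y \<bullet> b)))"
      using assms by (simp add: heat_kernel_eq_prod scaleR_conv_of_real prod.distrib)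
  qed
  also have "\<dots> = (CLINT f|(\<Pi>\<^sub>M b\<in>(Basis::'a set). lborel). \<Prod>b\<in>(Basis::'a set). ?n (f b) *\<^sub>R iexp ((\<xi> \<bullet> b) * f b))"
    by (subst lborel_eq, subst integral_distr) (auto intro!: Bochner_Integration.integral_cong prod.cong)
  also have "\<dots> = (\<Prod>b\<in>(Basis::'a set). CLINT x|lborel. ?n x *\<^sub>R iexp ((\<xi> \<bullet> b) * x))"
  proof (rule product_integral_prod)
    show "integrable lborel (\<lambda>x. ?n x *\<^sub>R iexp ((\<xi> \<bullet> b) * x))" for b :: 'a
      by (rule Bochner_Integration.integrable_bound[OF integrable_normal_density[OF s, of 0]]) auto
  qed simp
  also have "\<dots> = (\<Prod>b\<in>(Basis::'a set). complex_of_real (exp (- s * (\<xi> \<bullet> b)\<^sup>2)))"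
    by (intro prod.cong refl N)
  also have "\<dots> = complex_of_real (exp (\<Sum>b\<in>(Basis::'a set). - s * (\<xi> \<bullet> b)\<^sup>2))"
    by (simp only: of_real_prod[symmetric] exp_sum[OF finite_Basis])
  also have "(\<Sum>b\<in>(Basis::'a set). - s * (\<xi> \<bullet> b)\<^sup>2) = - s * (norm \<xi>)\<^sup>2"
    unfolding power2_norm_eq_inner
    by (subst sum_distrib_left[symmetric], subst euclidean_inner) (simp add: power2_eq_square)
  finally show ?thesis .
qed

lemma integral_cos_heat_measure:
  fixes \<xi> :: "'a::euclidean_space"
  assumes "0 < s"
  shows "(LINT y|heat_measure s. cos (\<xi> \<bullet> y)) = exp (- s * (norm \<xi>)\<^sup>2)"
proof -
  interpret prob_space "heat_measure s :: 'a measure" by (rule prob_space_heat_measure[OF assms])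
  have int: "integrable (heat_measure s) (\<lambda>y. iexp (\<xi> \<bullet> y))"
    by (intro integrable_const_bound[of _ 1]) auto
  have "(LINT y|heat_measure s. cos (\<xi> \<bullet> y)) = (LINT y|heat_measure s. Re (iexp (\<xi> \<bullet> y)))"
    by (simp add: Re_exp)
  also have "\<dots> = exp (- s * (norm \<xi>)\<^sup>2)"
    by (subst integral_Re[OF int]) (simp add: char_heat_measure[OF assms])
  finally show ?thesis .
qed

text \<open>
  A linear functional of a Gaussian vector is Gaussian. Its characteristic function is an instance
  of \<open>char_heat_measure\<close>, so Levy's uniqueness theorem identifies its law without any rotation of
  coordinates, and the first absolute moment is that of a one-dimensional normal variable.
\<close>

lemma abs_inner_heat_measure:
  fixes v :: "'a::euclidean_space"
  assumes "0 < s"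
  shows "has_bochner_integral (heat_measure s) (\<lambda>y. \<bar>v \<bullet> y\<bar>) (2 * sqrt (s / pi) * norm v)"
proof (cases "v = 0")
  case True
  then show ?thesis by (simp add: has_bochner_integral_zero)
next
  case False
  interpret prob_space "heat_measure s :: 'a measure" by (rule prob_space_heat_measure[OF assms])
  define \<sigma> where "\<sigma> = sqrt (2 * s) * norm v"
  have \<sigma>: "0 < \<sigma>" using assms False by (simp add: \<sigma>_def)
  let ?D = "distr (heat_measure s) borel (\<lambda>y. v \<bullet> y)"
  let ?N = "density lborel (normal_density 0 \<sigma>)"
  have D: "real_distribution ?D"
    by (intro real_distribution.intro prob_space_distr real_distribution_axioms.intro) auto
  have N: "real_distribution ?N"
    using \<sigma> by (intro real_distribution.intro prob_space_normal_density real_distribution_axioms.intro) auto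
  have "?D = ?N"
  proof (rule Levy_uniqueness[OF D N], rule ext)
    fix t
    have "char ?D t = (CLINT y|heat_measure s. iexp ((t *\<^sub>R v) \<bullet> y))"
      unfolding char_def by (subst integral_distr) auto
    also have "\<dots> = complex_of_real (exp (- s * (norm (t *\<^sub>R v))\<^sup>2))"
      by (rule char_heat_measure[OF assms])
    also have "- s * (norm (t *\<^sub>R v))\<^sup>2 = - (\<sigma> * t)\<^sup>2 / 2"
      using assms by (simp add: \<sigma>_def power_mult_distrib)
    also have "complex_of_real (exp (- (\<sigma> * t)\<^sup>2 / 2)) = char ?N t"
      unfolding char_def by (rule char_normal_density[OF \<sigma>, symmetric])
    finally show "char ?D t = char ?N t" .
  qed
  moreover have "has_bochner_integral ?N (\<lambda>x. \<bar>x\<bar>) (\<sigma> * sqrt (2 / pi))"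
    using normal_moment_abs_odd[OF \<sigma>, of 0 0]
    by (subst has_bochner_integral_density) auto
  ultimately have "has_bochner_integral ?D (\<lambda>x. \<bar>x\<bar>) (\<sigma> * sqrt (2 / pi))" by simp
  then have "has_bochner_integral (heat_measure s) (\<lambda>y. \<bar>v \<bullet> y\<bar>) (\<sigma> * sqrt (2 / pi))"
    by (simp add: has_bochner_integral_iff integrable_distr_eq integral_distr)
  moreover have "\<sigma> * sqrt (2 / pi) = 2 * sqrt (s / pi) * norm v"
    using assms by (simp add: \<sigma>_def real_sqrt_mult real_sqrt_divide field_simps)
  ultimately show ?thesis by simp
qed

text \<open>
  Parabolic scaling: the Gaussian at time \<open>s\<close> is the image of the Gaussian at time \<open>1\<close> under
  dilation by \<open>sqrt s\<close>.
\<close>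

lemma nn_integral_heat_measure_scale:
  fixes f :: "'a::euclidean_space \<Rightarrow> ennreal"
  assumes "0 < s" and [measurable]: "f \<in> borel_measurable borel"
  shows "(\<integral>\<^sup>+y. f y \<partial>heat_measure s) = (\<integral>\<^sup>+z. f (sqrt s *\<^sub>R z) \<partial>heat_measure 1)"
proof -
  have k: "sqrt s ^ DIM('a) * heat_kernel s (sqrt s *\<^sub>R z) = heat_kernel 1 z" for z :: 'a
  proof -
    have "sqrt s ^ DIM('a) = s powr (real DIM('a) / 2)"
      using assms by (simp add: powr_half_sqrt[symmetric] powr_powr powr_realpow[symmetric])
    then show ?thesis
      using assms by (simp add: heat_kernel_def power_mult_distrib powr_mult powr_minus field_simps)
  qed
  have "(\<integral>\<^sup>+y. f y \<partial>heat_measure s) = (\<integral>\<^sup>+y. ennreal (heat_kernel s y) * f y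
      \<partial>density (distr lborel borel (\<lambda>x::'a. 0 + sqrt s *\<^sub>R x)) (\<lambda>_. ennreal (\<bar>sqrt s\<bar>^DIM('a))))"
    using assms by (subst nn_integral_heat_measure, simp, subst lborel_affine[of "sqrt s" 0]) auto
  also have "\<dots> = (\<integral>\<^sup>+z. ennreal (\<bar>sqrt s\<bar>^DIM('a)) * (ennreal (heat_kernel s (sqrt s *\<^sub>R z)) * f (sqrt s *\<^sub>R z)) \<partial>lborel)"
    by (simp add: nn_integral_density nn_integral_distr)
  also have "\<dots> = (\<integral>\<^sup>+z. ennreal (heat_kernel 1 z) * f (sqrt s *\<^sub>R z) \<partial>lborel)"
    using assms by (simp add: mult.assoc[symmetric] ennreal_mult[symmetric] k)
  finally show ?thesis by (simp add: nn_integral_heat_measure)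
qed

section \<open>Limits and interchange of integrals for finite measures\<close>

text \<open>
  Dominated convergence for a real or vector parameter tending to a point. It reduces to sequences,
  since the filter \<open>at a within S\<close> is first countable.
\<close>

lemma dominated_convergence_at_within:
  fixes f :: "'p::first_countable_topology \<Rightarrow> 'z \<Rightarrow> 'b::{banach, second_countable_topology}"
  assumes meas: "\<And>s. s \<in> S \<Longrightarrow> s \<noteq> a \<Longrightarrow> f s \<in> borel_measurable M" "g \<in> borel_measurable M"
    and w: "integrable M w"
    and lim: "AE x in M. ((\<lambda>s. f s x) \<longlongrightarrow> g x) (at a within S)"
    and bound: "\<And>s. s \<in> S \<Longrightarrow> s \<noteq> a \<Longrightarrow> AE x in M. norm (f s x) \<le> w x"
  shows "((\<lambda>s. LINT x|M. f s x) \<longlongrightarrow> (LINT x|M. g x)) (at a within S)"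
  unfolding tendsto_at_iff_sequentially o_def
proof (intro allI impI)
  fix X assume X: "\<forall>i::nat. X i \<in> S - {a}" "X \<longlonglongrightarrow> a"
  show "(\<lambda>i. LINT x|M. f (X i) x) \<longlonglongrightarrow> (LINT x|M. g x)"
  proof (rule integral_dominated_convergence[OF meas(2) _ w])
    show "f (X i) \<in> borel_measurable M" for i using X meas(1) by auto
    show "AE x in M. (\<lambda>i. f (X i) x) \<longlonglongrightarrow> g x"
      using lim
    proof eventually_elim
      case (elim x)
      then show ?case using X unfolding tendsto_at_iff_sequentially o_def by auto
    qed
    show "AE x in M. norm (f (X i) x) \<le> w x" for i using X bound by auto
  qed
qed

lemma bounded_convergence_at_within:
  fixes f :: "'p::first_countable_topology \<Rightarrow> 'z \<Rightarrow> 'b::{banach, second_countable_topology}"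
  assumes "finite_measure M"
    and meas: "\<And>s. s \<in> S \<Longrightarrow> s \<noteq> a \<Longrightarrow> f s \<in> borel_measurable M" "g \<in> borel_measurable M"
    and lim: "AE x in M. ((\<lambda>s. f s x) \<longlongrightarrow> g x) (at a within S)"
    and bound: "\<And>s x. s \<in> S \<Longrightarrow> s \<noteq> a \<Longrightarrow> norm (f s x) \<le> B"
  shows "((\<lambda>s. LINT x|M. f s x) \<longlongrightarrow> (LINT x|M. g x)) (at a within S)"
proof -
  interpret finite_measure M by fact
  show ?thesis
    by (rule dominated_convergence_at_within[where w = "\<lambda>_. B"]) (use assms in auto)
qed

text \<open>
  On finite measures boundedness alone gives the integrability on the product that Fubini asks for.
\<close>

lemma integral_swap_bounded:
  fixes f :: "'z \<Rightarrow> 'y \<Rightarrow> 'b::{banach, second_countable_topology}"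
  assumes "finite_measure M" "finite_measure N"
    and [measurable]: "case_prod f \<in> borel_measurable (M \<Otimes>\<^sub>M N)"
    and bound: "\<And>x y. norm (f x y) \<le> B"
  shows "(LINT x|M. LINT y|N. f x y) = (LINT y|N. LINT x|M. f x y)"
proof -
  interpret M: finite_measure M by fact
  interpret N: finite_measure N by fact
  interpret P: pair_sigma_finite M N ..
  interpret finite_measure "M \<Otimes>\<^sub>M N"
    by (rule finite_measure_pair_measure) fact+
  have "integrable (M \<Otimes>\<^sub>M N) (case_prod f)"
    by (rule integrable_const_bound[where B = B]) (auto intro!: bound)
  from P.Fubini_integral[OF this] show ?thesis ..
qed

section \<open>The covariogram of an open set of finite volume\<close>

text \<open>
  A measure on the whole space with all Borel sets measurable, so that measurability never has to
  be relativised to \<open>\<Omega>\<close>.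
\<close>

definition volume_on :: "'a::euclidean_space set \<Rightarrow> 'a measure" where
  "volume_on \<Omega> = density lborel (indicator \<Omega>)"

definition covariogram :: "'a::euclidean_space set \<Rightarrow> 'a \<Rightarrow> real" where
  "covariogram \<Omega> y = measure lborel {x \<in> \<Omega>. x + y \<in> \<Omega>}"

lemma sets_volume_on [measurable_cong, simp]: "sets (volume_on \<Omega>) = sets borel"
  by (simp add: volume_on_def)

lemma space_volume_on [simp]: "space (volume_on \<Omega>) = UNIV"
  by (simp add: volume_on_def)

locale finite_volume_open =
  fixes \<Omega> :: "'a::euclidean_space set"
  assumes open_set: "open \<Omega>" and finite_volume: "emeasure lborel \<Omega> < \<infinity>"
begin

lemma set_borel [measurable, simp]: "\<Omega> \<in> sets borel"
  using open_set by simp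

lemma emeasure_volume_on: "A \<in> sets borel \<Longrightarrow> emeasure (volume_on \<Omega>) A = emeasure lborel (\<Omega> \<inter> A)"
  by (simp add: volume_on_def emeasure_density indicator_inter_arith[symmetric])

lemma finite_measure_volume_on: "finite_measure (volume_on \<Omega>)"
  by standard (use finite_volume in \<open>simp add: emeasure_volume_on\<close>)

sublocale V: finite_measure "volume_on \<Omega>"
  by (rule finite_measure_volume_on)

lemma integral_volume_on:
  fixes f :: "'a \<Rightarrow> 'b::{banach, second_countable_topology}"
  assumes "f \<in> borel_measurable borel"
  shows "(LINT x|volume_on \<Omega>. f x) = (LINT x:\<Omega>|lborel. f x)"
proof -
  have "volume_on \<Omega> = density lborel (\<lambda>x. ennreal (indicator \<Omega> x))"
    by (simp add: volume_on_def ennreal_indicator)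
  then show ?thesis
    using assms by (simp add: set_lebesgue_integral_def integral_density)
qed

lemma AE_volume_on: "AE x in volume_on \<Omega>. x \<in> \<Omega>"
  unfolding volume_on_def by (subst AE_density) (auto simp: indicator_def)

lemma measure_volume_on: "A \<in> sets borel \<Longrightarrow> measure (volume_on \<Omega>) A = measure lborel (\<Omega> \<inter> A)"
  by (simp add: measure_def emeasure_volume_on)

lemma covariogram_eq: "covariogram \<Omega> y = measure (volume_on \<Omega>) {x. x + y \<in> \<Omega>}"
  by (simp add: covariogram_def measure_volume_on Int_def)

lemma covariogram_eq_integral: "covariogram \<Omega> y = (LINT x|volume_on \<Omega>. indicator \<Omega> (x + y))"
proof -
  have "(LINT x|volume_on \<Omega>. indicator \<Omega> (x + y)) = (LINT x|volume_on \<Omega>. indicat_real {x. x + y \<in> \<Omega>} x)"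
    by (intro Bochner_Integration.integral_cong) (auto simp: indicator_def)
  then show ?thesis
    by (simp add: covariogram_eq)
qed

lemma covariogram_nonneg [simp]: "0 \<le> covariogram \<Omega> y"
  by (simp add: covariogram_def)

lemma covariogram_le: "covariogram \<Omega> y \<le> measure lborel \<Omega>"
  unfolding covariogram_eq using V.bounded_measure[of "{x. x + y \<in> \<Omega>}"] by (simp add: measure_volume_on)

lemma covariogram_0 [simp]: "covariogram \<Omega> 0 = measure lborel \<Omega>"
  by (simp add: covariogram_def)

lemma covariogram_measurable [measurable]: "covariogram \<Omega> \<in> borel_measurable borel"
proof -
  have "(\<lambda>y. LINT x|volume_on \<Omega>. indicat_real \<Omega> (x + y)) \<in> borel_measurable borel"
    by (rule V.borel_measurable_lebesgue_integral) measurable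
  then show ?thesis
    by (simp add: covariogram_eq_integral[abs_def])
qed

lemma measure_escape:
  "measure lborel {x \<in> \<Omega>. x + y \<notin> \<Omega>} = measure lborel \<Omega> - covariogram \<Omega> y"
proof -
  have "measure lborel {x \<in> \<Omega>. x + y \<notin> \<Omega>} = measure (volume_on \<Omega>) (UNIV - {x. x + y \<in> \<Omega>})"
    by (subst measure_volume_on) (auto intro!: arg_cong[where f = "measure lborel"])
  also have "\<dots> = measure (volume_on \<Omega>) UNIV - covariogram \<Omega> y"
    unfolding covariogram_eq using V.finite_measure_compl[of "{x. x + y \<in> \<Omega>}"] by simp
  finally show ?thesis by (simp add: measure_volume_on)
qed

lemma emeasure_escape:
  "emeasure lborel {x \<in> \<Omega>. x + y \<notin> \<Omega>} = ennreal (measure lborel \<Omega> - covariogram \<Omega> y)"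
proof -
  have "emeasure lborel {x \<in> \<Omega>. x + y \<notin> \<Omega>} \<le> emeasure lborel \<Omega>"
    by (intro emeasure_mono) auto
  then have "emeasure lborel {x \<in> \<Omega>. x + y \<notin> \<Omega>} \<noteq> top"
    using finite_volume by (auto simp: top_unique)
  then show ?thesis
    by (simp add: emeasure_eq_ennreal_measure measure_escape)
qed

lemma emeasure_lborel_shift: "A \<in> sets borel \<Longrightarrow> emeasure lborel {x. x + a \<in> A} = emeasure lborel (A :: 'a set)"
proof -
  assume [measurable]: "A \<in> sets borel"
  have "emeasure lborel {x. x + a \<in> A} = (\<integral>\<^sup>+x. indicator {x. x + a \<in> A} x \<partial>lborel)"
    by simp
  also have "\<dots> = (\<integral>\<^sup>+x. indicator A (x + a) \<partial>lborel)"
    by (intro nn_integral_cong) (auto simp: indicator_def)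
  also have "\<dots> = emeasure lborel A"
    by (subst nn_integral_lborel_shift) auto
  finally show ?thesis .
qed

lemma measure_lborel_shift: "A \<in> sets borel \<Longrightarrow> measure lborel {x. x + a \<in> A} = measure lborel (A :: 'a set)"
  by (simp add: measure_def emeasure_lborel_shift)

lemma covariogram_minus: "covariogram \<Omega> (- y) = covariogram \<Omega> y"
proof -
  have "covariogram \<Omega> (- y) = measure lborel {x. x + (- y) \<in> {x \<in> \<Omega>. x + y \<in> \<Omega>}}"
    unfolding covariogram_def by (intro arg_cong[where f = "measure lborel"]) auto
  also have "\<dots> = covariogram \<Omega> y"
    unfolding covariogram_def by (rule measure_lborel_shift) measurable
  finally show ?thesis .
qed

text \<open>
  If \<open>x + a\<close> lies in \<open>\<Omega>\<close> but \<open>x + b\<close> does not, then \<open>x + a\<close> is a point of \<open>\<Omega>\<close> that is moved out of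
  \<open>\<Omega>\<close> by \<open>b - a\<close>. This reduces continuity of the covariogram to continuity at the origin.
\<close>

lemma covariogram_diff_le: "covariogram \<Omega> a - covariogram \<Omega> b \<le> measure lborel \<Omega> - covariogram \<Omega> (b - a)"
proof -
  have "covariogram \<Omega> a \<le> covariogram \<Omega> b + measure (volume_on \<Omega>) {x. x + a \<in> \<Omega> \<and> x + b \<notin> \<Omega>}"
    unfolding covariogram_eq
    by (rule order_trans[OF V.finite_measure_mono measure_Un_le]) auto
  also have "measure (volume_on \<Omega>) {x. x + a \<in> \<Omega> \<and> x + b \<notin> \<Omega>} \<le> measure lborel {x \<in> \<Omega>. x + (b - a) \<notin> \<Omega>}"
  proof -
    have "measure (volume_on \<Omega>) {x. x + a \<in> \<Omega> \<and> x + b \<notin> \<Omega>}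
        \<le> measure lborel {x. x + a \<in> {x \<in> \<Omega>. x + (b - a) \<notin> \<Omega>}}"
    proof (subst measure_volume_on, measurable, rule measure_mono_fmeasurable)
      show "\<Omega> \<inter> {x. x + a \<in> \<Omega> \<and> x + b \<notin> \<Omega>} \<subseteq> {x. x + a \<in> {x \<in> \<Omega>. x + (b - a) \<notin> \<Omega>}}"
        by (auto simp: algebra_simps)
      have "emeasure lborel {x. x + a \<in> {x \<in> \<Omega>. x + (b - a) \<notin> \<Omega>}}
          = emeasure lborel {x \<in> \<Omega>. x + (b - a) \<notin> \<Omega>}"
        by (rule emeasure_lborel_shift) measurable
      also have "\<dots> \<le> emeasure lborel \<Omega>"
        by (intro emeasure_mono) auto
      also have "\<dots> < \<infinity>"
        using finite_volume .
      finally show "{x. x + a \<in> {x \<in> \<Omega>. x + (b - a) \<notin> \<Omega>}} \<in> fmeasurable lborel"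
        by (intro fmeasurableI) auto
    qed auto
    also have "\<dots> = measure lborel {x \<in> \<Omega>. x + (b - a) \<notin> \<Omega>}"
      by (rule measure_lborel_shift) measurable
    finally show ?thesis .
  qed
  finally show ?thesis by (simp add: measure_escape)
qed

text \<open>
  A point of an open set stays in the set under small translations; dominated convergence does the
  rest.
\<close>

lemma covariogram_tendsto_0: "(covariogram \<Omega> \<longlongrightarrow> measure lborel \<Omega>) (at 0)"
proof -
  have "((\<lambda>y. LINT x|volume_on \<Omega>. indicat_real \<Omega> (x + y)) \<longlongrightarrow> (LINT x|volume_on \<Omega>. 1)) (at 0)"
  proof (rule bounded_convergence_at_within[where B = 1])
    show "AE x in volume_on \<Omega>. ((\<lambda>y. indicat_real \<Omega> (x + y)) \<longlongrightarrow> 1) (at 0)"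
      using AE_volume_on
    proof eventually_elim
      case (elim x)
      have "((\<lambda>y. x + y) \<longlongrightarrow> x + 0) (at 0)" by (intro tendsto_intros)
      then have "eventually (\<lambda>y. x + y \<in> \<Omega>) (at 0)"
        using open_set elim by (intro topological_tendstoD[of "\<lambda>y. x + y" x]) auto
      then show ?case
        by (intro tendsto_eventually) (auto elim: eventually_mono)
    qed
  qed (auto intro: finite_measure_volume_on)
  then show ?thesis
    by (simp add: covariogram_eq_integral[symmetric] measure_volume_on)
qed

lemma isCont_covariogram: "isCont (covariogram \<Omega>) b"
proof -
  have "((\<lambda>a. covariogram \<Omega> a - covariogram \<Omega> b) \<longlongrightarrow> 0) (at b)"
  proof (rule Lim_null_comparison)
    show "\<forall>\<^sub>F a in at b. norm (covariogram \<Omega> a - covariogram \<Omega> b) \<le> measure lborel \<Omega> - covariogram \<Omega> (a - b)"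
    proof (rule always_eventually, rule allI)
      fix a show "norm (covariogram \<Omega> a - covariogram \<Omega> b) \<le> measure lborel \<Omega> - covariogram \<Omega> (a - b)"
        using covariogram_diff_le[of a b] covariogram_diff_le[of b a] covariogram_minus[of "a - b"] by auto
    qed
    have "((\<lambda>a. covariogram \<Omega> (a - b)) \<longlongrightarrow> measure lborel \<Omega>) (at b)"
      using LIM_offset[OF covariogram_tendsto_0, of "- b"] by simp
    then have "((\<lambda>a. measure lborel \<Omega> - covariogram \<Omega> (a - b)) \<longlongrightarrow> measure lborel \<Omega> - measure lborel \<Omega>) (at b)"
      by (intro tendsto_intros)
    then show "((\<lambda>a. measure lborel \<Omega> - covariogram \<Omega> (a - b)) \<longlongrightarrow> 0) (at b)" by simp
  qed
  then show ?thesis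
    unfolding isCont_def by (simp add: LIM_zero_iff)
qed

end

section \<open>The spectral measure of a set\<close>

text \<open>
  The Gaussian is, up to constants, its own Fourier transform. This is the only instance of Fourier
  inversion that the spectral representation rests on.
\<close>

lemma heat_kernel_fourier:
  fixes z :: "'a::euclidean_space"
  assumes "0 < s"
  shows "heat_kernel s z = (4 * pi * s) powr (- real DIM('a) / 2)
    * (LINT \<xi>|heat_measure (1 / (4 * s)). cos (\<xi> \<bullet> z))"
  using integral_cos_heat_measure[of "1 / (4 * s)" z] assms
  by (simp add: inner_commute heat_kernel_def)

lemma gauss_eq_heat_kernel:
  fixes \<xi> :: "'a::euclidean_space"
  assumes "0 < s"
  shows "exp (- s * (norm \<xi>)\<^sup>2) / (2 * pi) ^ DIM('a)
    = (4 * pi * s) powr (- real DIM('a) / 2) * heat_kernel (1 / (4 * s)) \<xi>"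
proof -
  have "(4 * pi * s) powr (- real DIM('a) / 2) * (4 * pi * (1 / (4 * s))) powr (- real DIM('a) / 2)
      = ((2 * pi) powr 2) powr (- real DIM('a) / 2)"
    using assms by (subst powr_mult[symmetric]) (auto simp: power2_eq_square field_simps)
  also have "\<dots> = 1 / (2 * pi) ^ DIM('a)"
    unfolding powr_powr by (simp add: powr_minus powr_realpow field_simps)
  finally show ?thesis
    using assms by (simp add: heat_kernel_def field_simps)
qed

text \<open>
  This is \<open>|F(\<xi>)|\<^sup>2 / (2 \<pi>)\<^sup>d\<close> for the Fourier transform \<open>F\<close> of the indicator function of \<open>\<Omega>\<close>,
  written with real integrals.
\<close>

definition spectral_density :: "'a::euclidean_space set \<Rightarrow> 'a \<Rightarrow> real" where
  "spectral_density \<Omega> \<xi> = ((LINT x|volume_on \<Omega>. cos (\<xi> \<bullet> x))\<^sup>2 + (LINT x|volume_on \<Omega>. sin (\<xi> \<bullet> x))\<^sup>2)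
     / (2 * pi) ^ DIM('a)"

definition spectral_measure :: "'a::euclidean_space set \<Rightarrow> 'a measure" where
  "spectral_measure \<Omega> = density lborel (\<lambda>\<xi>. ennreal (spectral_density \<Omega> \<xi>))"

context finite_volume_open
begin

lemma spectral_density_nonneg [simp]: "0 \<le> spectral_density \<Omega> \<xi>"
  by (simp add: spectral_density_def)

lemma spectral_density_measurable [measurable]: "spectral_density \<Omega> \<in> borel_measurable borel"
  unfolding spectral_density_def[abs_def] by measurable

text \<open>
  Expand the cosine of \<open>\<xi> \<bullet> (x - w) - \<xi> \<bullet> y\<close>. The term with \<open>sin (\<xi> \<bullet> (x - w))\<close> is antisymmetric in
  \<open>x\<close> and \<open>w\<close>, so its double integral vanishes.
\<close>

lemma spectral_density_cos:
  "spectral_density \<Omega> \<xi> * cos (\<xi> \<bullet> y) = (LINT x|volume_on \<Omega>. LINT w|volume_on \<Omega>. cos (\<xi> \<bullet> (x - w - y))) / (2 * pi) ^ DIM('a)"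
proof -
  define C S where "C = (LINT x|volume_on \<Omega>. cos (\<xi> \<bullet> x))" and "S = (LINT x|volume_on \<Omega>. sin (\<xi> \<bullet> x))"
  have i: "integrable (volume_on \<Omega>) (\<lambda>x. cos (\<xi> \<bullet> x))" "integrable (volume_on \<Omega>) (\<lambda>x. sin (\<xi> \<bullet> x))"
    by (rule V.integrable_const_bound[of _ 1]; auto)+
  define A where "A x = cos (\<xi> \<bullet> x) * cos (\<xi> \<bullet> y) + sin (\<xi> \<bullet> x) * sin (\<xi> \<bullet> y)" for x
  define B where "B x = sin (\<xi> \<bullet> x) * cos (\<xi> \<bullet> y) - cos (\<xi> \<bullet> x) * sin (\<xi> \<bullet> y)" for x
  have "cos (\<xi> \<bullet> (x - w - y)) = A x * cos (\<xi> \<bullet> w) + B x * sin (\<xi> \<bullet> w)" for x w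
    unfolding inner_diff_right cos_diff sin_diff A_def B_def by (simp add: algebra_simps)
  then have "(LINT w|volume_on \<Omega>. cos (\<xi> \<bullet> (x - w - y))) = A x * C + B x * S" for x
    using i by (simp add: C_def S_def)
  then have "(LINT w|volume_on \<Omega>. cos (\<xi> \<bullet> (x - w - y))) =
      (cos (\<xi> \<bullet> y) * C - sin (\<xi> \<bullet> y) * S) * cos (\<xi> \<bullet> x) + (sin (\<xi> \<bullet> y) * C + cos (\<xi> \<bullet> y) * S) * sin (\<xi> \<bullet> x)" for x
    by (simp add: A_def B_def algebra_simps)
  then have "(LINT x|volume_on \<Omega>. LINT w|volume_on \<Omega>. cos (\<xi> \<bullet> (x - w - y))) =
      (cos (\<xi> \<bullet> y) * C - sin (\<xi> \<bullet> y) * S) * C + (sin (\<xi> \<bullet> y) * C + cos (\<xi> \<bullet> y) * S) * S"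
    using i by (simp add: C_def S_def)
  then show ?thesis
    by (simp add: spectral_density_def C_def[symmetric] S_def[symmetric] power2_eq_square field_simps)
qed

lemma spectral_density_bounded: "spectral_density \<Omega> \<xi> \<le> 2 * (measure lborel \<Omega>)\<^sup>2 / (2 * pi) ^ DIM('a)"
proof -
  have b: "\<bar>LINT x|volume_on \<Omega>. f x\<bar> \<le> measure lborel \<Omega>"
    if [measurable]: "f \<in> borel_measurable borel" and f: "\<And>x. \<bar>f x\<bar> \<le> 1" for f :: "'a \<Rightarrow> real"
  proof -
    have "\<bar>LINT x|volume_on \<Omega>. f x\<bar> \<le> (LINT x|volume_on \<Omega>. 1)"
      by (rule integral_abs_bound[THEN order_trans], rule integral_mono)
        (auto intro!: V.integrable_const_bound[of _ 1] simp: f)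
    then show ?thesis by (simp add: measure_volume_on)
  qed
  have "(LINT x|volume_on \<Omega>. cos (\<xi> \<bullet> x))\<^sup>2 \<le> (measure lborel \<Omega>)\<^sup>2" "(LINT x|volume_on \<Omega>. sin (\<xi> \<bullet> x))\<^sup>2 \<le> (measure lborel \<Omega>)\<^sup>2"
    by (subst abs_le_square_iff[symmetric]; simp; rule b; auto)+
  then show ?thesis
    unfolding spectral_density_def by (intro divide_right_mono) auto
qed

lemma gauss_spectral_density_integrable:
  assumes "0 < s"
  shows "integrable lborel (\<lambda>\<xi>. exp (- s * (norm \<xi>)\<^sup>2) * (spectral_density \<Omega> \<xi> * cos (\<xi> \<bullet> y)))"
proof -
  interpret H: prob_space "heat_measure (1 / (4 * s)) :: 'a measure"
    using assms by (intro prob_space_heat_measure) simp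
  let ?B = "2 * (measure lborel \<Omega>)\<^sup>2 / (2 * pi) ^ DIM('a)"
  have "integrable (heat_measure (1 / (4 * s))) (\<lambda>\<xi>. spectral_density \<Omega> \<xi> * cos (\<xi> \<bullet> y))"
  proof (rule H.integrable_const_bound[of _ ?B])
    show "AE \<xi> in heat_measure (1 / (4 * s)). norm (spectral_density \<Omega> \<xi> * cos (\<xi> \<bullet> y)) \<le> ?B"
    proof (rule AE_I2)
      fix \<xi> :: 'a
      have "spectral_density \<Omega> \<xi> * \<bar>cos (\<xi> \<bullet> y)\<bar> \<le> ?B * 1"
        by (intro mult_mono spectral_density_bounded) auto
      then show "norm (spectral_density \<Omega> \<xi> * cos (\<xi> \<bullet> y)) \<le> ?B" by (simp add: abs_mult)
    qed
  qed simp
  then have "integrable lborel (\<lambda>\<xi>. heat_kernel (1 / (4 * s)) \<xi> *\<^sub>R (spectral_density \<Omega> \<xi> * cos (\<xi> \<bullet> y)))"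
    unfolding heat_measure_def by (subst (asm) integrable_density) auto
  then have "integrable lborel (\<lambda>\<xi>. ((2 * pi) ^ DIM('a) * (4 * pi * s) powr (- real DIM('a) / 2)) *
     (heat_kernel (1 / (4 * s)) \<xi> *\<^sub>R (spectral_density \<Omega> \<xi> * cos (\<xi> \<bullet> y))))"
    by (rule integrable_mult_right)
  also have "(\<lambda>\<xi>. ((2 * pi) ^ DIM('a) * (4 * pi * s) powr (- real DIM('a) / 2)) *
     (heat_kernel (1 / (4 * s)) \<xi> *\<^sub>R (spectral_density \<Omega> \<xi> * cos (\<xi> \<bullet> y))))
     = (\<lambda>\<xi>. exp (- s * (norm \<xi>)\<^sup>2) * (spectral_density \<Omega> \<xi> * cos (\<xi> \<bullet> y)))"
  proof
    fix \<xi> :: 'a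
    have "exp (- s * (norm \<xi>)\<^sup>2) = (2 * pi) ^ DIM('a) * ((4 * pi * s) powr (- real DIM('a) / 2) * heat_kernel (1 / (4 * s)) \<xi>)"
      using gauss_eq_heat_kernel[OF assms, of \<xi>] by (simp add: field_simps)
    then show "((2 * pi) ^ DIM('a) * (4 * pi * s) powr (- real DIM('a) / 2)) *
     (heat_kernel (1 / (4 * s)) \<xi> *\<^sub>R (spectral_density \<Omega> \<xi> * cos (\<xi> \<bullet> y)))
     = exp (- s * (norm \<xi>)\<^sup>2) * (spectral_density \<Omega> \<xi> * cos (\<xi> \<bullet> y))" by simp
  qed
  finally show ?thesis .
qed

text \<open>
  Gaussian damping makes the inverse Fourier integral absolutely convergent; the order of
  integration can then be exchanged and the inner integral is a heat kernel.
\<close>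

lemma gauss_spectral_density_integral:
  assumes "0 < s"
  shows "(LINT \<xi>|lborel. exp (- s * (norm \<xi>)\<^sup>2) * (spectral_density \<Omega> \<xi> * cos (\<xi> \<bullet> y)))
    = (LINT x|volume_on \<Omega>. LINT w|volume_on \<Omega>. heat_kernel s (x - w - y))"
proof -
  let ?c = "(4 * pi * s) powr (- real DIM('a) / 2)" and ?H = "heat_measure (1 / (4 * s)) :: 'a measure"
  interpret H: prob_space ?H
    using assms by (intro prob_space_heat_measure) simp
  let ?V = "volume_on \<Omega>"
  have "(LINT \<xi>|lborel. exp (- s * (norm \<xi>)\<^sup>2) * (spectral_density \<Omega> \<xi> * cos (\<xi> \<bullet> y)))
     = (LINT \<xi>|lborel. heat_kernel (1 / (4 * s)) \<xi> *\<^sub>R (?c * (LINT x|?V. LINT w|?V. cos (\<xi> \<bullet> (x - w - y)))))"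
  proof (intro Bochner_Integration.integral_cong refl)
    fix \<xi> :: 'a
    show "exp (- s * (norm \<xi>)\<^sup>2) * (spectral_density \<Omega> \<xi> * cos (\<xi> \<bullet> y))
      = heat_kernel (1 / (4 * s)) \<xi> *\<^sub>R (?c * (LINT x|?V. LINT w|?V. cos (\<xi> \<bullet> (x - w - y))))"
      unfolding spectral_density_cos using gauss_eq_heat_kernel[OF assms, of \<xi>] by (simp add: field_simps)
  qed
  also have "\<dots> = (LINT \<xi>|?H. ?c * (LINT x|?V. LINT w|?V. cos (\<xi> \<bullet> (x - w - y))))"
    by (subst integral_heat_measure) auto
  also have "\<dots> = ?c * (LINT \<xi>|?H. LINT x|?V. LINT w|?V. cos (\<xi> \<bullet> (x - w - y)))"
    by simp
  also have "(LINT \<xi>|?H. LINT x|?V. LINT w|?V. cos (\<xi> \<bullet> (x - w - y)))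
      = (LINT x|?V. LINT \<xi>|?H. LINT w|?V. cos (\<xi> \<bullet> (x - w - y)))"
  proof (rule integral_swap_bounded[of _ _ _ "measure lborel \<Omega>"])
    show "norm (LINT w|?V. cos (\<xi> \<bullet> (x - w - y))) \<le> measure lborel \<Omega>" for \<xi> x
    proof -
      have "\<bar>LINT w|?V. cos (\<xi> \<bullet> (x - w - y))\<bar> \<le> (LINT w|?V. 1)"
        by (rule integral_abs_bound[THEN order_trans], rule integral_mono)
          (auto intro!: V.integrable_const_bound[of _ 1])
      then show ?thesis by (simp add: measure_volume_on)
    qed
  qed (auto intro: finite_measure_volume_on H.finite_measure_axioms)
  also have "\<dots> = (LINT x|?V. LINT w|?V. LINT \<xi>|?H. cos (\<xi> \<bullet> (x - w - y)))"
    by (intro Bochner_Integration.integral_cong refl integral_swap_bounded[of _ _ _ 1])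
      (auto intro: finite_measure_volume_on H.finite_measure_axioms)
  finally show ?thesis
    by (simp add: heat_kernel_fourier[OF assms])
qed

lemma gauss_double_integral:
  assumes "0 < s"
  shows "(LINT x|volume_on \<Omega>. LINT w|volume_on \<Omega>. heat_kernel s (x - w - y))
    = (LINT z|heat_measure s. covariogram \<Omega> (z - y))"
proof -
  interpret H: prob_space "heat_measure s :: 'a measure"
    using assms by (intro prob_space_heat_measure) simp
  have "(LINT w|volume_on \<Omega>. heat_kernel s (x - w - y)) = (LINT z|heat_measure s. indicator \<Omega> (x + (z - y)))" for x
  proof -
    have "(LINT w|volume_on \<Omega>. heat_kernel s (x - w - y)) = (LINT w|lborel. indicator \<Omega> w *\<^sub>R heat_kernel s (x - w - y))"
      by (subst integral_volume_on) (auto simp: set_lebesgue_integral_def)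
    also have "\<dots> = (LINT w|lborel. indicator \<Omega> (w + (x - y)) *\<^sub>R heat_kernel s (x - (w + (x - y)) - y))"
      by (rule integral_lborel_shift[symmetric]) measurable
    also have "\<dots> = (LINT z|heat_measure s. indicator \<Omega> (x + (z - y)))"
      by (subst integral_heat_measure) (auto simp: algebra_simps)
    finally show ?thesis .
  qed
  then have "(LINT x|volume_on \<Omega>. LINT w|volume_on \<Omega>. heat_kernel s (x - w - y))
      = (LINT x|volume_on \<Omega>. LINT z|heat_measure s. indicator \<Omega> (x + (z - y)))" by simp
  also have "\<dots> = (LINT z|heat_measure s. LINT x|volume_on \<Omega>. indicator \<Omega> (x + (z - y)))"
    by (intro integral_swap_bounded[of _ _ _ 1]) (auto intro: finite_measure_volume_on H.finite_measure_axioms)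
  finally show ?thesis by (simp add: covariogram_eq_integral)
qed

end

text \<open>
  After parabolic scaling the measure is fixed and the integrand converges pointwise by continuity
  at the origin.
\<close>

lemma heat_measure_approximate_identity:
  fixes f :: "'a::euclidean_space \<Rightarrow> real"
  assumes [measurable]: "f \<in> borel_measurable borel" and cont: "isCont f 0" and bound: "\<And>x. \<bar>f x\<bar> \<le> B"
  shows "((\<lambda>s. LINT z|heat_measure s. f z) \<longlongrightarrow> f 0) (at_right 0)"
proof -
  interpret H: prob_space "heat_measure 1 :: 'a measure"
    by (intro prob_space_heat_measure) simp
  have scale: "(LINT z|heat_measure s. f z) = (LINT z|heat_measure 1. f (sqrt s *\<^sub>R z))" if "0 < s" for s
  proof -
    have eq: "heat_measure s = distr (heat_measure 1) borel (\<lambda>z::'a. sqrt s *\<^sub>R z)"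
    proof (rule measure_eqI)
      fix A assume "A \<in> sets (heat_measure s :: 'a measure)"
      then have [measurable]: "A \<in> sets borel" by simp
      have "emeasure (heat_measure s) A = (\<integral>\<^sup>+z. indicator A z \<partial>heat_measure s)" by simp
      also have "\<dots> = (\<integral>\<^sup>+z. indicator A z \<partial>distr (heat_measure 1) borel (\<lambda>z::'a. sqrt s *\<^sub>R z))"
        using that by (subst nn_integral_heat_measure_scale) (simp_all add: nn_integral_distr del: nn_integral_indicator)
      finally show "emeasure (heat_measure s) A = emeasure (distr (heat_measure 1) borel (\<lambda>z::'a. sqrt s *\<^sub>R z)) A"
        by simp
    qed simp
    show ?thesis by (subst eq, subst integral_distr) auto
  qed
  have "((\<lambda>s. LINT z|heat_measure 1. f (sqrt s *\<^sub>R z)) \<longlongrightarrow> (LINT z|(heat_measure 1 :: 'a measure). f 0)) (at_right 0)"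
  proof (rule bounded_convergence_at_within[where B = B])
    show "AE z in heat_measure 1. ((\<lambda>s. f (sqrt s *\<^sub>R z)) \<longlongrightarrow> f 0) (at_right 0)"
    proof (rule AE_I2)
      fix z :: 'a
      have "((\<lambda>s. sqrt s *\<^sub>R z) \<longlongrightarrow> sqrt 0 *\<^sub>R z) (at_right 0)" by (intro tendsto_intros)
      then show "((\<lambda>s. f (sqrt s *\<^sub>R z)) \<longlongrightarrow> f 0) (at_right 0)"
        using isCont_tendsto_compose[OF cont] by simp
    qed
  qed (auto simp: bound intro: H.finite_measure_axioms)
  then show ?thesis
    using H.prob_space
    by (auto elim!: Lim_transform_eventually simp: scale intro: eventually_mono[OF eventually_at_right_less[of 0]])
qed

context finite_volume_open
begin

lemma gauss_spectral_tendsto: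
  "((\<lambda>s. LINT \<xi>|lborel. exp (- s * (norm \<xi>)\<^sup>2) * (spectral_density \<Omega> \<xi> * cos (\<xi> \<bullet> y))) \<longlongrightarrow> covariogram \<Omega> y) (at_right 0)"
proof -
  have "((\<lambda>s. LINT z|heat_measure s. covariogram \<Omega> (z - y)) \<longlongrightarrow> covariogram \<Omega> (0 - y)) (at_right 0)"
  proof (rule heat_measure_approximate_identity)
    show "isCont (\<lambda>z. covariogram \<Omega> (z - y)) 0"
      by (intro isCont_o2[OF _ isCont_covariogram]) simp
    show "\<bar>covariogram \<Omega> (z - y)\<bar> \<le> measure lborel \<Omega>" for z
      by (simp add: covariogram_le)
  qed measurable
  then have "((\<lambda>s. LINT z|heat_measure s. covariogram \<Omega> (z - y)) \<longlongrightarrow> covariogram \<Omega> y) (at_right 0)"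
    by (simp add: covariogram_minus)
  then show ?thesis
    by (rule Lim_transform_eventually, intro eventually_mono[OF eventually_at_right_less[of 0]])
      (simp only: gauss_spectral_density_integral gauss_double_integral)
qed

text \<open>
  At \<open>y = 0\<close> the damped integrals are Gaussian averages of the covariogram, hence at most the
  volume of \<open>\<Omega>\<close>. Removing the damping by Fatou's lemma shows that the spectral density has finite
  mass; this is one half of Plancherel's theorem.
\<close>

lemma integrable_spectral_density: "integrable lborel (spectral_density \<Omega>)"
proof (rule integrableI_bounded)
  let ?s = "\<lambda>n::nat. 1 / real (Suc n)"
  have lim: "(\<lambda>n. exp (- ?s n * (norm \<xi>)\<^sup>2) * spectral_density \<Omega> \<xi>) \<longlonglongrightarrow> spectral_density \<Omega> \<xi>" for \<xi> :: 'a
  proof -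
    have "(\<lambda>n. exp (- ?s n * (norm \<xi>)\<^sup>2) * spectral_density \<Omega> \<xi>) \<longlonglongrightarrow> exp (- 0 * (norm \<xi>)\<^sup>2) * spectral_density \<Omega> \<xi>"
      using LIMSEQ_inverse_real_of_nat by (intro tendsto_intros) (simp add: inverse_eq_divide)
    then show ?thesis by simp
  qed
  have "(\<integral>\<^sup>+\<xi>. ennreal (spectral_density \<Omega> \<xi>) \<partial>lborel)
      = (\<integral>\<^sup>+\<xi>. liminf (\<lambda>n. ennreal (exp (- ?s n * (norm \<xi>)\<^sup>2) * spectral_density \<Omega> \<xi>)) \<partial>lborel)"
    by (intro nn_integral_cong lim_imp_Liminf[symmetric] tendsto_ennrealI lim) simp
  also have "\<dots> \<le> liminf (\<lambda>n. \<integral>\<^sup>+\<xi>. ennreal (exp (- ?s n * (norm \<xi>)\<^sup>2) * spectral_density \<Omega> \<xi>) \<partial>lborel)"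
    by (rule nn_integral_liminf) measurable
  also have "\<dots> \<le> ennreal (measure lborel \<Omega>)"
  proof -
    have "(\<integral>\<^sup>+\<xi>. ennreal (exp (- ?s n * (norm \<xi>)\<^sup>2) * spectral_density \<Omega> \<xi>) \<partial>lborel) \<le> ennreal (measure lborel \<Omega>)" for n
    proof -
      have s: "0 < ?s n" by simp
      interpret H: prob_space "heat_measure (?s n) :: 'a measure"
        by (intro prob_space_heat_measure s)
      have "(\<integral>\<^sup>+\<xi>. ennreal (exp (- ?s n * (norm \<xi>)\<^sup>2) * spectral_density \<Omega> \<xi>) \<partial>lborel)
         = ennreal (LINT \<xi>|lborel. exp (- ?s n * (norm \<xi>)\<^sup>2) * spectral_density \<Omega> \<xi>)"
        using gauss_spectral_density_integrable[OF s, of 0] by (intro nn_integral_eq_integral) auto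
      also have "(LINT \<xi>|lborel. exp (- ?s n * (norm \<xi>)\<^sup>2) * spectral_density \<Omega> \<xi>) = (LINT z|heat_measure (?s n). covariogram \<Omega> z)"
        using gauss_spectral_density_integral[OF s, of 0] gauss_double_integral[OF s, of 0] by simp
      also have "\<dots> \<le> (LINT z|(heat_measure (?s n) :: 'a measure). measure lborel \<Omega>)"
        by (intro integral_mono H.integrable_const_bound[of _ "measure lborel \<Omega>"]) (auto simp: covariogram_le)
      finally show ?thesis using H.prob_space by (simp add: ennreal_leI)
    qed
    then have "liminf (\<lambda>n. \<integral>\<^sup>+\<xi>. ennreal (exp (- ?s n * (norm \<xi>)\<^sup>2) * spectral_density \<Omega> \<xi>) \<partial>lborel)
        \<le> liminf (\<lambda>n::nat. ennreal (measure lborel \<Omega>))"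
      by (intro Liminf_mono always_eventually allI)
    then show ?thesis by (simp add: Liminf_const)
  qed
  also have "\<dots> < \<infinity>" by simp
  finally show "(\<integral>\<^sup>+\<xi>. ennreal (norm (spectral_density \<Omega> \<xi>)) \<partial>lborel) < \<infinity>" by simp
qed measurable

lemma sets_spectral_measure [measurable_cong, simp]: "sets (spectral_measure \<Omega>) = sets borel"
  by (simp add: spectral_measure_def)

lemma space_spectral_measure [simp]: "space (spectral_measure \<Omega>) = UNIV"
  by (simp add: spectral_measure_def)

lemma finite_measure_spectral_measure: "finite_measure (spectral_measure \<Omega>)"
proof
  have "emeasure (spectral_measure \<Omega>) UNIV = (\<integral>\<^sup>+\<xi>. ennreal (norm (spectral_density \<Omega> \<xi>)) \<partial>lborel)"
    by (simp add: spectral_measure_def emeasure_density)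
  also have "\<dots> < \<infinity>"
    using integrable_spectral_density by (simp add: integrable_iff_bounded)
  finally show "emeasure (spectral_measure \<Omega>) (space (spectral_measure \<Omega>)) \<noteq> \<infinity>" by simp
qed

sublocale S: finite_measure "spectral_measure \<Omega>"
  by (rule finite_measure_spectral_measure)

text \<open>
  Bochner's representation for the covariogram. The damped inverse Fourier integrals converge to
  the undamped one by dominated convergence and to the covariogram by continuity.
\<close>

theorem covariogram_spectral: "covariogram \<Omega> y = (LINT \<xi>|spectral_measure \<Omega>. cos (\<xi> \<bullet> y))"
proof -
  have "((\<lambda>s. LINT \<xi>|lborel. exp (- s * (norm \<xi>)\<^sup>2) * (spectral_density \<Omega> \<xi> * cos (\<xi> \<bullet> y)))
      \<longlongrightarrow> (LINT \<xi>|lborel. spectral_density \<Omega> \<xi> * cos (\<xi> \<bullet> y))) (at_right 0)"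
  proof (rule dominated_convergence_at_within[OF _ _ integrable_spectral_density])
    show "AE \<xi> in lborel. ((\<lambda>s. exp (- s * (norm \<xi>)\<^sup>2) * (spectral_density \<Omega> \<xi> * cos (\<xi> \<bullet> y)))
        \<longlongrightarrow> spectral_density \<Omega> \<xi> * cos (\<xi> \<bullet> y)) (at_right 0)"
    proof (rule AE_I2)
      fix \<xi> :: 'a
      have "((\<lambda>s. exp (- s * (norm \<xi>)\<^sup>2) * (spectral_density \<Omega> \<xi> * cos (\<xi> \<bullet> y)))
        \<longlongrightarrow> exp (- 0 * (norm \<xi>)\<^sup>2) * (spectral_density \<Omega> \<xi> * cos (\<xi> \<bullet> y))) (at_right 0)"
        by (intro tendsto_intros)
      then show "((\<lambda>s. exp (- s * (norm \<xi>)\<^sup>2) * (spectral_density \<Omega> \<xi> * cos (\<xi> \<bullet> y)))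
        \<longlongrightarrow> spectral_density \<Omega> \<xi> * cos (\<xi> \<bullet> y)) (at_right 0)" by simp
    qed
    fix s :: real assume s: "s \<in> {0<..}"
    show "AE \<xi> in lborel. norm (exp (- s * (norm \<xi>)\<^sup>2) * (spectral_density \<Omega> \<xi> * cos (\<xi> \<bullet> y))) \<le> spectral_density \<Omega> \<xi>"
    proof (rule AE_I2)
      fix \<xi> :: 'a
      have "exp (- s * (norm \<xi>)\<^sup>2) * (spectral_density \<Omega> \<xi> * \<bar>cos (\<xi> \<bullet> y)\<bar>) \<le> 1 * (spectral_density \<Omega> \<xi> * 1)"
        using s by (intro mult_mono) auto
      then show "norm (exp (- s * (norm \<xi>)\<^sup>2) * (spectral_density \<Omega> \<xi> * cos (\<xi> \<bullet> y))) \<le> spectral_density \<Omega> \<xi>"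
        by (simp add: abs_mult)
    qed
  qed measurable
  from tendsto_unique[OF _ gauss_spectral_tendsto this]
  show ?thesis
    by (simp add: spectral_measure_def integral_density trivial_limit_at_right_real)
qed

end

section \<open>Test fields for the perimeter\<close>

text \<open>
  Differentiation under the integral sign over a finite measure: a uniform bound on the derivatives
  bounds the difference quotients by the mean value inequality, and bounded convergence applies.
\<close>

lemma has_derivative_integral_bounded:
  fixes f :: "'p::real_normed_vector \<Rightarrow> 'z \<Rightarrow> 'b::{banach, second_countable_topology}"
  assumes fin: "finite_measure M" and d: "0 < d" and B: "0 \<le> B"
    and deriv: "\<And>x z. x \<in> ball x0 d \<Longrightarrow> ((\<lambda>x. f x z) has_derivative f' x z) (at x)"
    and bound: "\<And>x z v. x \<in> ball x0 d \<Longrightarrow> norm (f' x z v) \<le> B * norm v"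
    and int: "\<And>x. x \<in> ball x0 d \<Longrightarrow> integrable M (f x)"
    and meas': "\<And>v. (\<lambda>z. f' x0 z v) \<in> borel_measurable M"
  shows "((\<lambda>x. LINT z|M. f x z) has_derivative (\<lambda>v. LINT z|M. f' x0 z v)) (at x0)"
proof -
  interpret finite_measure M by fact
  have x0: "x0 \<in> ball x0 d" using d by simp
  have lin: "linear (f' x0 z)" for z
    using has_derivative_linear[OF deriv[OF x0]] .
  have int': "integrable M (\<lambda>z. f' x0 z v)" for v
    by (rule integrable_const_bound[of _ "B * norm v"]) (auto simp: bound[OF x0] meas')
  have bl: "bounded_linear (\<lambda>v. LINT z|M. f' x0 z v)"
  proof (rule bounded_linear_intro[where K = "measure M (space M) * B"])
    fix v w r
    show "(LINT z|M. f' x0 z (v + w)) = (LINT z|M. f' x0 z v) + (LINT z|M. f' x0 z w)"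
      using int' by (simp add: linear_add[OF lin])
    show "(LINT z|M. f' x0 z (r *\<^sub>R v)) = r *\<^sub>R (LINT z|M. f' x0 z v)"
      by (simp add: linear_scale[OF lin])
    have "norm (LINT z|M. f' x0 z v) \<le> (LINT z|M. B * norm v)"
      by (rule order_trans[OF integral_norm_bound integral_mono])
        (auto intro!: integrable_norm int' bound x0)
    then show "norm (LINT z|M. f' x0 z v) \<le> norm v * (measure M (space M) * B)"
      by (simp add: algebra_simps)
  qed
  \<comment> \<open>The difference between the difference quotient and the derivative, in direction \<open>h\<close>.\<close>
  define q where "q h z = (1 / norm h) *\<^sub>R (f (x0 + h) z - f x0 z - f' x0 z h)" for h z
  have qb: "norm (q h z) \<le> 2 * B" if h: "h \<in> ball 0 d" "h \<noteq> 0" for h z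
  proof -
    have "norm (f (x0 + h) z - f x0 z) \<le> B * norm (x0 + h - x0)"
    proof (rule differentiable_bound[of "ball x0 d"])
      show "((\<lambda>x. f x z) has_derivative f' x z) (at x within ball x0 d)" if "x \<in> ball x0 d" for x
        using deriv[OF that] by (rule has_derivative_at_withinI)
      show "onorm (f' x z) \<le> B" if "x \<in> ball x0 d" for x
        using B bound[OF that] by (rule onorm_bound)
    qed (use h d in \<open>auto simp: dist_norm\<close>)
    then have "norm (f (x0 + h) z - f x0 z - f' x0 z h) \<le> 2 * B * norm h"
      using bound[OF x0, of z h] norm_triangle_ineq4[of "f (x0 + h) z - f x0 z" "f' x0 z h"] by simp
    then show ?thesis
      using h by (simp add: q_def divide_simps)
  qed
  have "((\<lambda>h. LINT z|M. q h z) \<longlongrightarrow> (LINT z|M. 0)) (at 0 within ball 0 d)"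
  proof (rule bounded_convergence_at_within[OF fin, where B = "2 * B"])
    show "q h \<in> borel_measurable M" if "h \<in> ball 0 d" for h
      unfolding q_def using that int[of "x0 + h"] int[OF x0] meas'
      by (intro borel_measurable_scaleR borel_measurable_diff borel_measurable_const) (auto simp: dist_norm)
    show "AE z in M. ((\<lambda>h. q h z) \<longlongrightarrow> 0) (at 0 within ball 0 d)"
    proof (rule AE_I2)
      fix z
      have "((\<lambda>h. norm (f (x0 + h) z - f x0 z - f' x0 z h) / norm h) \<longlongrightarrow> 0) (at 0)"
        using deriv[OF x0, of z] by (simp add: has_derivative_at)
      then have "((\<lambda>h. norm (q h z)) \<longlongrightarrow> 0) (at 0)" by (simp add: q_def)
      then show "((\<lambda>h. q h z) \<longlongrightarrow> 0) (at 0 within ball 0 d)"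
        by (rule tendsto_within_subset[OF tendsto_norm_zero_cancel]) simp
    qed
  qed (auto simp: qb)
  then have "((\<lambda>h. norm (LINT z|M. q h z)) \<longlongrightarrow> 0) (at 0)"
    using d by (simp add: at_within_open[of 0 "ball 0 d"] tendsto_norm_zero)
  then have "((\<lambda>h. norm ((LINT z|M. f (x0 + h) z) - (LINT z|M. f x0 z) - (LINT z|M. f' x0 z h)) / norm h) \<longlongrightarrow> 0) (at 0)"
  proof (rule Lim_transform_eventually)
    have "eventually (\<lambda>h. h \<in> ball 0 d) (at (0::'p))"
      using d by (intro eventually_at_in_open') auto
    then show "\<forall>\<^sub>F h in at 0. norm (LINT z|M. q h z)
        = norm ((LINT z|M. f (x0 + h) z) - (LINT z|M. f x0 z) - (LINT z|M. f' x0 z h)) / norm h"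
    proof eventually_elim
      case (elim h)
      then have "x0 + h \<in> ball x0 d" by (simp add: dist_norm)
      then show ?case
        using int[of "x0 + h"] int[OF x0] int'[of h] by (simp add: q_def)
    qed
  qed
  then show ?thesis
    using bl by (simp add: has_derivative_at)
qed

text \<open>
  It suffices to have continuous directional derivatives, because a map into the bounded linear
  maps between Euclidean spaces is continuous as soon as it is so on a basis.
\<close>

lemma C1_compact_supportI:
  assumes "\<And>x. (\<phi> has_derivative D x) (at x)" "\<And>v. continuous_on UNIV (\<lambda>x. D x v)" "bounded {x. \<phi> x \<noteq> 0}"
  shows "C1_compact_support \<phi>"
proof -
  have ap: "blinfun_apply (Blinfun (D x)) = D x" for x
    by (rule bounded_linear_Blinfun_apply) (rule has_derivative_bounded_linear[OF assms(1)])
  have "continuous_on UNIV (\<lambda>x. Blinfun (D x))"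
    using assms(2) by (intro continuous_on_blinfun_componentwise) (simp add: ap)
  then show ?thesis
    unfolding C1_compact_support_def using assms ap by (intro conjI exI[of _ "\<lambda>x. Blinfun (D x)"]) auto
qed

lemma divergence_eq:
  "(\<phi> has_derivative D) (at x) \<Longrightarrow> divergence \<phi> x = (\<Sum>i\<in>UNIV. D (axis i 1) $ i)"
  unfolding divergence_def by (simp add: frechet_derivative_at[symmetric])

text \<open>
  The squared positive part is the simplest \<open>C\<^sup>1\<close> profile that vanishes on a half-line; it provides
  the cutoff functions below.
\<close>

lemma has_real_derivative_pos_part_power2:
  "((\<lambda>a::real. (max 0 a)\<^sup>2) has_real_derivative 2 * max 0 a) (at a)"
proof (cases "a = 0")
  case True
  have "((\<lambda>h::real. (max 0 h)\<^sup>2 / h) \<longlongrightarrow> 0) (at 0)"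
  proof (rule Lim_null_comparison)
    show "\<forall>\<^sub>F h in at (0::real). norm ((max 0 h)\<^sup>2 / h) \<le> \<bar>h\<bar>"
      by (rule always_eventually) (auto simp: max_def power2_eq_square)
    show "((\<lambda>h::real. \<bar>h\<bar>) \<longlongrightarrow> 0) (at 0)"
      by (intro tendsto_eq_intros) auto
  qed
  then show ?thesis using True by (simp add: has_field_derivative_iff)
next
  case False
  show ?thesis
  proof (cases "a < 0")
    case True
    have "((\<lambda>_::real. 0::real) has_real_derivative 0) (at a)" by simp
    then have "((\<lambda>a::real. (max 0 a)\<^sup>2) has_real_derivative 0) (at a)"
      by (rule has_field_derivative_transform_within_open[of _ _ _ "{..<0}"]) (use True in auto)
    then show ?thesis using True by simp
  next
    case F: False
    have "((\<lambda>a::real. a\<^sup>2) has_real_derivative 2 * a) (at a)"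
      by (auto intro!: derivative_eq_intros)
    then have "((\<lambda>a::real. (max 0 a)\<^sup>2) has_real_derivative 2 * a) (at a)"
      by (rule has_field_derivative_transform_within_open[of _ _ _ "{0<..}"]) (use F False in auto)
    then show ?thesis using F by simp
  qed
qed

lemma sum_axis_inner: "(\<Sum>i\<in>UNIV. (x \<bullet> axis i 1) * (y $ i)) = x \<bullet> (y :: real ^ 'n)"
  by (simp add: inner_axis) (simp add: inner_vec_def)

lemma perimeter_test_ge:
  assumes "C1_compact_support \<phi>" "\<And>x. norm (\<phi> x) \<le> 1"
  shows "ereal (LINT x:\<Omega>|lborel. divergence \<phi> x) \<le> perimeter \<Omega>"
  unfolding perimeter_def using assms by (intro SUP_upper) auto

text \<open>
  A bounded \<open>C\<^sup>1\<close> field with bounded divergence is a legitimate test field even when its support is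
  not compact. Multiply it by the cutoff \<open>(max 0 (1 - |x|\<^sup>2 / R\<^sup>2))\<^sup>2\<close> and let \<open>R\<close> tend to
  infinity: the gradient of the cutoff is at most \<open>4 / R\<close>, and \<open>\<Omega>\<close> has finite volume, so the
  divergences converge boundedly.
\<close>

lemma perimeter_bounded_test_ge:
  fixes \<phi> :: "real ^ 'n \<Rightarrow> real ^ 'n" and D :: "real ^ 'n \<Rightarrow> real ^ 'n \<Rightarrow> real ^ 'n"
  assumes "finite_volume_open \<Omega>"
    and D: "\<And>x. (\<phi> has_derivative D x) (at x)"
    and cont: "\<And>v. continuous_on UNIV (\<lambda>x. D x v)"
    and norm1: "\<And>x. norm (\<phi> x) \<le> 1"
    and bound: "\<And>x. \<bar>\<Sum>i\<in>UNIV. D x (axis i 1) $ i\<bar> \<le> B"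
  shows "ereal (LINT x|volume_on \<Omega>. (\<Sum>i\<in>UNIV. D x (axis i 1) $ i)) \<le> perimeter \<Omega>"
proof -
  interpret finite_volume_open \<Omega> by fact
  define m where "m n x = max 0 (1 - (x \<bullet> x) / (real (Suc n))\<^sup>2)" for n and x :: "real ^ 'n"
  define E where "E n x = (m n x)\<^sup>2 * (\<Sum>i\<in>UNIV. D x (axis i 1) $ i)
      - 4 / (real (Suc n))\<^sup>2 * m n x * (x \<bullet> \<phi> x)" for n x
  have cont\<phi>: "continuous_on UNIV \<phi>"
    using D by (intro continuous_at_imp_continuous_on ballI has_derivative_continuous) auto
  have contm: "continuous_on UNIV (m n)" for n
    unfolding m_def by (intro continuous_intros) auto
  have m01: "0 \<le> m n x" "m n x \<le> 1" for n x
    by (auto simp: m_def)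
  have m_out: "norm x < real (Suc n)" if "m n x \<noteq> 0" for n x
  proof -
    have "(x \<bullet> x) / (real (Suc n))\<^sup>2 < 1"
      using that unfolding m_def by linarith
    then have "x \<bullet> x < (real (Suc n))\<^sup>2"
      by (subst (asm) divide_less_eq_1_pos) simp_all
    then have "(norm x)\<^sup>2 < (real (Suc n))\<^sup>2"
      unfolding power2_norm_eq_inner .
    then show ?thesis by (rule power2_less_imp_less) simp
  qed
  \<comment> \<open>\<open>E n\<close> is the divergence of the field multiplied by the cutoff of radius \<open>Suc n\<close>, whose square root is \<open>m n\<close>.\<close>
  have E_le: "ereal (LINT x|volume_on \<Omega>. E n x) \<le> perimeter \<Omega>" for n
  proof -
    define \<psi> where "\<psi> x = (m n x)\<^sup>2 *\<^sub>R \<phi> x" for x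
    define D\<psi> where "D\<psi> x v = (m n x)\<^sup>2 *\<^sub>R D x v + (- 4 / (real (Suc n))\<^sup>2 * m n x * (x \<bullet> v)) *\<^sub>R \<phi> x" for x v
    have d\<psi>: "(\<psi> has_derivative D\<psi> x) (at x)" for x
    proof -
      have "((\<lambda>x. 1 - (x \<bullet> x) / (real (Suc n))\<^sup>2) has_derivative (\<lambda>v. - 2 * (x \<bullet> v) / (real (Suc n))\<^sup>2)) (at x)"
        unfolding divide_inverse by (auto intro!: derivative_eq_intros simp: inner_commute algebra_simps)
      from has_derivative_compose[OF this, of "\<lambda>a. (max 0 a)\<^sup>2", OF has_real_derivative_pos_part_power2[unfolded has_field_derivative_def]]
      have "((\<lambda>x. (m n x)\<^sup>2) has_derivative (\<lambda>v. - 4 / (real (Suc n))\<^sup>2 * m n x * (x \<bullet> v))) (at x)"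
        by (simp add: m_def[abs_def] algebra_simps)
      from has_derivative_scaleR[OF this D]
      show ?thesis unfolding \<psi>_def[abs_def] D\<psi>_def[abs_def] by simp
    qed
    have "C1_compact_support \<psi>"
    proof (rule C1_compact_supportI[OF d\<psi>])
      show "continuous_on UNIV (\<lambda>x. D\<psi> x v)" for v
        unfolding D\<psi>_def by (intro continuous_intros contm cont cont\<phi>)
      show "bounded {x. \<psi> x \<noteq> 0}"
        using m_out by (intro boundedI[of _ "real (Suc n)"]) (auto simp: \<psi>_def intro: less_imp_le)
    qed
    moreover have "norm (\<psi> x) \<le> 1" for x
      using m01 norm1 by (auto simp: \<psi>_def intro!: mult_le_one power_le_one)
    ultimately have le: "ereal (LINT x:\<Omega>|lborel. divergence \<psi> x) \<le> perimeter \<Omega>"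
      by (rule perimeter_test_ge)
    have div: "divergence \<psi> x = E n x" for x
    proof -
      have "divergence \<psi> x = (\<Sum>i\<in>UNIV. (m n x)\<^sup>2 * D x (axis i 1) $ i
          + (- 4 / (real (Suc n))\<^sup>2 * m n x) * ((x \<bullet> axis i 1) * \<phi> x $ i))"
        by (subst divergence_eq[OF d\<psi>]) (simp add: D\<psi>_def algebra_simps)
      also have "\<dots> = E n x"
        unfolding sum.distrib sum_distrib_left[symmetric] sum_axis_inner E_def by simp
      finally show ?thesis .
    qed
    have [measurable]: "E n \<in> borel_measurable borel"
      unfolding E_def by (intro borel_measurable_continuous_onI continuous_intros contm cont cont\<phi>)
    show ?thesis
      using le unfolding div by (simp add: integral_volume_on)
  qed
  have "(\<lambda>n. LINT x|volume_on \<Omega>. E n x) \<longlonglongrightarrow> (LINT x|volume_on \<Omega>. (\<Sum>i\<in>UNIV. D x (axis i 1) $ i))"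
  proof (rule integral_dominated_convergence)
    show "(\<lambda>x. \<Sum>i\<in>UNIV. D x (axis i 1) $ i) \<in> borel_measurable (volume_on \<Omega>)"
      unfolding measurable_cong_sets[OF sets_volume_on refl]
      by (intro borel_measurable_continuous_onI continuous_intros cont)
    show "E n \<in> borel_measurable (volume_on \<Omega>)" for n
      unfolding measurable_cong_sets[OF sets_volume_on refl] E_def
      by (intro borel_measurable_continuous_onI continuous_intros contm cont cont\<phi>)
    show "integrable (volume_on \<Omega>) (\<lambda>x. B + 4)" by simp
    show "AE x in volume_on \<Omega>. (\<lambda>n. E n x) \<longlonglongrightarrow> (\<Sum>i\<in>UNIV. D x (axis i 1) $ i)"
    proof (rule AE_I2)
      fix x :: "real ^ 'n"
      have inv: "(\<lambda>n. c / (real (Suc n))\<^sup>2) \<longlonglongrightarrow> 0" for c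
        using tendsto_mult[OF tendsto_const[of c] tendsto_power[OF LIMSEQ_inverse_real_of_nat, of 2]]
        by (simp add: field_simps)
      have "(\<lambda>n. m n x) \<longlonglongrightarrow> max 0 (1 - 0)"
        unfolding m_def by (intro tendsto_intros inv)
      then have "(\<lambda>n. E n x) \<longlonglongrightarrow> (max 0 (1 - 0))\<^sup>2 * (\<Sum>i\<in>UNIV. D x (axis i 1) $ i) - 0 * max 0 (1 - 0) * (x \<bullet> \<phi> x)"
        unfolding E_def by (intro tendsto_intros inv)
      then show "(\<lambda>n. E n x) \<longlonglongrightarrow> (\<Sum>i\<in>UNIV. D x (axis i 1) $ i)" by simp
    qed
    show "AE x in volume_on \<Omega>. norm (E n x) \<le> B + 4" for n
    proof (rule AE_I2)
      fix x :: "real ^ 'n"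
      have 1: "\<bar>(m n x)\<^sup>2 * (\<Sum>i\<in>UNIV. D x (axis i 1) $ i)\<bar> \<le> 1 * B"
        unfolding abs_mult using m01[of n x] by (intro mult_mono bound) (auto simp: power_le_one)
      have 2: "\<bar>4 / (real (Suc n))\<^sup>2 * m n x * (x \<bullet> \<phi> x)\<bar> \<le> 4"
      proof (cases "m n x = 0")
        case False
        have "\<bar>x \<bullet> \<phi> x\<bar> \<le> norm x * norm (\<phi> x)" by (rule Cauchy_Schwarz_ineq2)
        also have "\<dots> \<le> real (Suc n) * 1"
          using m_out[OF False] norm1 by (intro mult_mono) auto
        also have "\<dots> \<le> (real (Suc n))\<^sup>2" by (simp add: power2_eq_square)
        finally have "\<bar>x \<bullet> \<phi> x\<bar> \<le> (real (Suc n))\<^sup>2" .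
        then have "m n x * \<bar>x \<bullet> \<phi> x\<bar> \<le> 1 * (real (Suc n))\<^sup>2"
          using m01[of n x] by (intro mult_mono) auto
        then show ?thesis using m01[of n x] by (simp add: abs_mult divide_simps)
      qed simp
      show "norm (E n x) \<le> B + 4"
        unfolding E_def real_norm_def using 1 2 by (intro order_trans[OF abs_triangle_ineq4]) linarith
    qed
  qed
  then have "(\<lambda>n. ereal (LINT x|volume_on \<Omega>. E n x)) \<longlonglongrightarrow> ereal (LINT x|volume_on \<Omega>. (\<Sum>i\<in>UNIV. D x (axis i 1) $ i))"
    by simp
  then show ?thesis
    by (rule LIMSEQ_le_const2) (use E_le in auto)
qed

section \<open>Derivatives of the heat kernel\<close>

definition heat_grad :: "real \<Rightarrow> 'a::euclidean_space \<Rightarrow> 'a \<Rightarrow> real" where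
  "heat_grad s y v = - (y \<bullet> v) / (2 * s) * heat_kernel s y"

text \<open>
  Minus the gradient of the heat kernel.
\<close>

definition heat_field :: "real \<Rightarrow> 'a::euclidean_space \<Rightarrow> 'a" where
  "heat_field s y = (heat_kernel s y / (2 * s)) *\<^sub>R y"

definition heat_field_deriv :: "real \<Rightarrow> 'a::euclidean_space \<Rightarrow> 'a \<Rightarrow> 'a" where
  "heat_field_deriv s y v = (heat_kernel s y / (2 * s)) *\<^sub>R v + (heat_grad s y v / (2 * s)) *\<^sub>R y"

definition heat_time_deriv :: "real \<Rightarrow> 'a::euclidean_space \<Rightarrow> real" where
  "heat_time_deriv s y = ((norm y)\<^sup>2 / (4 * s\<^sup>2) - DIM('a) / (2 * s)) * heat_kernel s y"

lemma has_derivative_heat_kernel: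
  fixes y :: "'a::euclidean_space"
  shows "(heat_kernel s has_derivative heat_grad s y) (at y)"
proof -
  have "((\<lambda>y. - (y \<bullet> y) * inverse (4 * s)) has_derivative (\<lambda>v. - (y \<bullet> v + v \<bullet> y) * inverse (4 * s))) (at y)"
    by (intro has_derivative_mult_left has_derivative_minus has_derivative_inner has_derivative_ident)
  from has_derivative_mult_right[OF has_derivative_exp[OF this], of "(4 * pi * s) powr (- real DIM('a) / 2)"]
  have "((\<lambda>y. (4 * pi * s) powr (- real DIM('a) / 2) * exp (- (y \<bullet> y) * inverse (4 * s))) has_derivative
      (\<lambda>v. (4 * pi * s) powr (- real DIM('a) / 2) *
      (- (y \<bullet> v + v \<bullet> y) * inverse (4 * s) * exp (- (y \<bullet> y) * inverse (4 * s))))) (at y)" .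
  also have "(\<lambda>v. (4 * pi * s) powr (- real DIM('a) / 2) *
      (- (y \<bullet> v + v \<bullet> y) * inverse (4 * s) * exp (- (y \<bullet> y) * inverse (4 * s)))) = heat_grad s y"
    by (rule ext) (simp add: heat_grad_def heat_kernel_def power2_norm_eq_inner inner_commute inverse_eq_divide)
  also have "(\<lambda>y::'a. (4 * pi * s) powr (- real DIM('a) / 2) * exp (- (y \<bullet> y) * inverse (4 * s))) = heat_kernel s"
    by (rule ext) (simp only: heat_kernel_def power2_norm_eq_inner divide_inverse)
  finally show ?thesis .
qed

lemma has_derivative_heat_field: "(heat_field s has_derivative heat_field_deriv s y) (at y)"
proof -
  have "((\<lambda>y. (heat_kernel s y * inverse (2 * s)) *\<^sub>R y) has_derivative
      (\<lambda>v. (heat_kernel s y * inverse (2 * s)) *\<^sub>R v + (heat_grad s y v * inverse (2 * s)) *\<^sub>R y)) (at y)"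
    by (intro has_derivative_scaleR has_derivative_mult_left has_derivative_heat_kernel has_derivative_ident)
  then show ?thesis
    unfolding heat_field_def[abs_def] heat_field_deriv_def[abs_def] divide_inverse .
qed

text \<open>
  The heat equation: the divergence of minus the gradient is minus the time derivative.
\<close>

lemma trace_heat_field_deriv:
  fixes y :: "real ^ 'n"
  shows "0 < s \<Longrightarrow> (\<Sum>i\<in>UNIV. heat_field_deriv s y (axis i 1) $ i) = - heat_time_deriv s y"
proof -
  assume s: "0 < s"
  have "(\<Sum>i\<in>UNIV. heat_field_deriv s y (axis i 1) $ i)
      = (\<Sum>i\<in>UNIV. - heat_kernel s y / (4 * s\<^sup>2) * ((y \<bullet> axis i 1) * y $ i) + heat_kernel s y / (2 * s))"
    using s by (intro sum.cong) (auto simp: heat_field_deriv_def heat_grad_def power2_eq_square field_simps)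
  also have "\<dots> = - heat_kernel s y / (4 * s\<^sup>2) * (y \<bullet> y) + CARD('n) * (heat_kernel s y / (2 * s))"
    unfolding sum.distrib sum_distrib_left[symmetric] sum_axis_inner by simp
  also have "\<dots> = - heat_time_deriv s y"
    by (simp add: heat_time_deriv_def power2_norm_eq_inner algebra_simps)
  finally show ?thesis .
qed

lemma has_derivative_heat_kernel_time:
  fixes y :: "'a::euclidean_space"
  assumes "0 < s"
  shows "((\<lambda>s. heat_kernel s y) has_real_derivative heat_time_deriv s y) (at s)"
proof -
  define c where "c = - real DIM('a) / 2"
  have 1: "((\<lambda>s. (4 * pi * s) powr c) has_real_derivative c / s * (4 * pi * s) powr c) (at s)"
    using assms by (auto intro!: derivative_eq_intros simp: powr_diff field_simps)
  have 2: "((\<lambda>s. exp (- (norm y)\<^sup>2 / (4 * s))) has_real_derivative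
      (norm y)\<^sup>2 / (4 * s\<^sup>2) * exp (- (norm y)\<^sup>2 / (4 * s))) (at s)"
    using assms by (auto intro!: derivative_eq_intros simp: power2_eq_square field_simps)
  have "((\<lambda>s. (4 * pi * s) powr c * exp (- (norm y)\<^sup>2 / (4 * s))) has_real_derivative
      ((norm y)\<^sup>2 / (4 * s\<^sup>2) + c / s) * ((4 * pi * s) powr c * exp (- (norm y)\<^sup>2 / (4 * s)))) (at s)"
    using DERIV_mult[OF 1 2] by (simp add: algebra_simps)
  then show ?thesis
    by (simp add: heat_kernel_def heat_time_deriv_def c_def)
qed

lemma heat_kernel_le: "0 < s \<Longrightarrow> heat_kernel s (y::'a::euclidean_space) \<le> (4 * pi * s) powr (- real DIM('a) / 2)"
  by (simp add: heat_kernel_def mult_left_le)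

text \<open>
  From \<open>x \<le> exp x\<close> at \<open>x = |y|\<^sup>2 / (4 s)\<close>.
\<close>

lemma norm_power2_heat_kernel_le:
  "0 < s \<Longrightarrow> (norm (y::'a::euclidean_space))\<^sup>2 * heat_kernel s y \<le> 4 * s * (4 * pi * s) powr (- real DIM('a) / 2)"
proof -
  assume s: "0 < s"
  have "(norm y)\<^sup>2 / (4 * s) \<le> exp ((norm y)\<^sup>2 / (4 * s))"
    using exp_ge_add_one_self[of "(norm y)\<^sup>2 / (4 * s)"] by linarith
  then have "(norm y)\<^sup>2 * exp (- (norm y)\<^sup>2 / (4 * s)) \<le> 4 * s"
    using s by (simp add: exp_minus field_simps)
  then have "(4 * pi * s) powr (- real DIM('a) / 2) * ((norm y)\<^sup>2 * exp (- (norm y)\<^sup>2 / (4 * s)))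
      \<le> (4 * pi * s) powr (- real DIM('a) / 2) * (4 * s)"
    by (intro mult_left_mono) auto
  then show ?thesis
    unfolding heat_kernel_def by (simp only: mult_ac)
qed

lemma heat_field_bound:
  assumes "0 < s"
  shows "norm (heat_field s (y::'a::euclidean_space)) \<le> (1 + 4 * s) * (4 * pi * s) powr (- real DIM('a) / 2) / (2 * s)"
proof -
  let ?c = "(4 * pi * s) powr (- real DIM('a) / 2)"
  have "norm y \<le> 1 + (norm y)\<^sup>2"
    using sum_squares_ge_zero[of "norm y - 1/2" 0] by (simp add: power2_eq_square algebra_simps)
  then have "norm y * heat_kernel s y \<le> (1 + (norm y)\<^sup>2) * heat_kernel s y"
    by (intro mult_right_mono) auto
  also have "\<dots> \<le> ?c + 4 * s * ?c"
    using heat_kernel_le[OF assms, of y] norm_power2_heat_kernel_le[OF assms, of y] by (simp add: algebra_simps)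
  finally have "norm y * heat_kernel s y \<le> (1 + 4 * s) * ?c" by (simp add: algebra_simps)
  then have "norm y * heat_kernel s y / (2 * s) \<le> (1 + 4 * s) * ?c / (2 * s)"
    using assms by (intro divide_right_mono) auto
  then show ?thesis
    using assms by (simp add: heat_field_def mult.commute)
qed

lemma heat_grad_eq: "heat_grad s y v = - (heat_field s y \<bullet> v)"
  by (simp add: heat_grad_def heat_field_def)

lemma heat_grad_bound:
  assumes "0 < s"
  shows "\<bar>heat_grad s y v\<bar> \<le> (1 + 4 * s) * (4 * pi * s) powr (- real DIM('a) / 2) / (2 * s) * norm (v::'a::euclidean_space)"
  unfolding heat_grad_eq abs_minus_cancel
  by (rule order_trans[OF Cauchy_Schwarz_ineq2]) (intro mult_right_mono heat_field_bound assms norm_ge_zero)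

lemma heat_field_deriv_bound:
  assumes "0 < s"
  shows "norm (heat_field_deriv s y v) \<le> (3 * (4 * pi * s) powr (- real DIM('a) / 2) / (2 * s)) * norm (v::'a::euclidean_space)"
proof -
  let ?c = "(4 * pi * s) powr (- real DIM('a) / 2)"
  have "norm (heat_field_deriv s y v) \<le> \<bar>heat_kernel s y / (2 * s)\<bar> * norm v + \<bar>heat_grad s y v / (2 * s)\<bar> * norm y"
    unfolding heat_field_deriv_def by (rule order_trans[OF norm_triangle_ineq]) simp
  then have "norm (heat_field_deriv s y v) \<le> \<bar>heat_grad s y v / (2 * s)\<bar> * norm y + \<bar>heat_kernel s y / (2 * s)\<bar> * norm v"
    by linarith
  also have "\<bar>heat_grad s y v / (2 * s)\<bar> * norm y \<le> (norm y)\<^sup>2 * heat_kernel s y * norm v / (2 * s)\<^sup>2"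
  proof -
    have "\<bar>y \<bullet> v\<bar> * (heat_kernel s y * norm y / (2 * s)\<^sup>2) \<le> (norm y * norm v) * (heat_kernel s y * norm y / (2 * s)\<^sup>2)"
      by (intro mult_right_mono Cauchy_Schwarz_ineq2) auto
    then show ?thesis
      using assms by (simp add: heat_grad_def abs_mult power2_eq_square field_simps)
  qed
  also have "\<dots> \<le> (4 * s * ?c) * norm v / (2 * s)\<^sup>2"
    using assms by (intro divide_right_mono mult_right_mono norm_power2_heat_kernel_le) auto
  also have "\<bar>heat_kernel s y / (2 * s)\<bar> * norm v \<le> (?c / (2 * s)) * norm v"
    using assms heat_kernel_le[OF assms, of y] by (auto intro!: mult_right_mono divide_right_mono)
  also have "(4 * s * ?c) * norm v / (2 * s)\<^sup>2 + (?c / (2 * s)) * norm v = (3 * ?c / (2 * s)) * norm v"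
    using assms by (simp add: power2_eq_square field_simps)
  finally show ?thesis by simp
qed

lemma heat_time_deriv_bound:
  fixes y :: "'a::euclidean_space"
  assumes "0 < s0" "s0 \<le> s"
  shows "\<bar>heat_time_deriv s y\<bar> \<le> (1 + real DIM('a)) * (4 * pi * s0) powr (- real DIM('a) / 2) / s0"
proof -
  let ?c = "(4 * pi * s) powr (- real DIM('a) / 2)"
  have s: "0 < s" using assms by simp
  have "\<bar>heat_time_deriv s y\<bar> = \<bar>((norm y)\<^sup>2 * heat_kernel s y) / (4 * s\<^sup>2) - DIM('a) / (2 * s) * heat_kernel s y\<bar>"
    by (simp add: heat_time_deriv_def algebra_simps)
  also have "\<dots> \<le> (norm y)\<^sup>2 * heat_kernel s y / (4 * s\<^sup>2) + DIM('a) / (2 * s) * heat_kernel s y"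
    by (rule order_trans[OF abs_triangle_ineq4]) (use s in simp)
  also have "\<dots> \<le> (4 * s * ?c) / (4 * s\<^sup>2) + DIM('a) / (2 * s) * ?c"
    using s by (intro add_mono divide_right_mono mult_left_mono norm_power2_heat_kernel_le heat_kernel_le) auto
  also have "\<dots> = ?c * (1 + DIM('a) / 2) / s"
    using s by (simp add: power2_eq_square field_simps)
  also have "\<dots> \<le> (4 * pi * s0) powr (- real DIM('a) / 2) * (1 + real DIM('a)) / s0"
    using assms s by (intro frac_le mult_mono powr_mono2') auto
  finally show ?thesis by (simp add: algebra_simps)
qed

lemma continuous_heat_kernel [continuous_intros]: "continuous_on A f \<Longrightarrow> continuous_on A (\<lambda>x. heat_kernel s (f x :: 'a::euclidean_space))"
  unfolding heat_kernel_def divide_inverse by (intro continuous_intros) 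

lemma continuous_heat_grad [continuous_intros]: "continuous_on A f \<Longrightarrow> continuous_on A (\<lambda>x. heat_grad s (f x :: 'a::euclidean_space) v)"
  unfolding heat_grad_def divide_inverse by (intro continuous_intros) 

lemma continuous_heat_field_deriv [continuous_intros]:
  "continuous_on A f \<Longrightarrow> continuous_on A (\<lambda>x. heat_field_deriv s (f x :: 'a::euclidean_space) v)"
  unfolding heat_field_deriv_def divide_inverse by (intro continuous_intros) 

lemma heat_time_deriv_measurable [measurable]: "heat_time_deriv s \<in> borel_measurable borel"
  unfolding heat_time_deriv_def[abs_def] by measurable

lemma heat_field_measurable [measurable]: "heat_field s \<in> borel_measurable borel"
  unfolding heat_field_def[abs_def] by measurable

lemma heat_grad_measurable [measurable]: "(\<lambda>y. heat_grad s y v) \<in> borel_measurable borel"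
  unfolding heat_grad_def[abs_def] by measurable

lemma heat_field_deriv_measurable [measurable]: "(\<lambda>y. heat_field_deriv s y v) \<in> borel_measurable borel"
  unfolding heat_field_deriv_def[abs_def] by measurable

text \<open>
  By symmetry of the Gaussian the positive part carries half of the first absolute moment. This
  half is what makes the gradient bound for indicator functions below sharp.
\<close>

lemma nn_integral_heat_measure_pos_part:
  fixes v :: "'a::euclidean_space"
  assumes "0 < s"
  shows "(\<integral>\<^sup>+y. ennreal (max 0 (v \<bullet> y)) \<partial>heat_measure s) = ennreal (sqrt (s / pi) * norm v)"
proof -
  let ?I = "\<lambda>f. \<integral>\<^sup>+y. ennreal (f y) \<partial>(heat_measure s :: 'a measure)"
  have "?I (\<lambda>y. max 0 (- (v \<bullet> y))) = (\<integral>\<^sup>+y. ennreal (heat_kernel s (- y)) * ennreal (max 0 (v \<bullet> - y)) \<partial>lborel)"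
    by (subst nn_integral_heat_measure) auto
  also have "\<dots> = (\<integral>\<^sup>+y. ennreal (heat_kernel s y) * ennreal (max 0 (v \<bullet> y)) \<partial>lborel)"
    by (rule nn_integral_lborel_uminus) measurable
  also have "\<dots> = ?I (\<lambda>y. max 0 (v \<bullet> y))"
    by (subst nn_integral_heat_measure) auto
  finally have sym: "?I (\<lambda>y. max 0 (- (v \<bullet> y))) = ?I (\<lambda>y. max 0 (v \<bullet> y))" .
  have "2 * ?I (\<lambda>y. max 0 (v \<bullet> y)) = ?I (\<lambda>y. max 0 (v \<bullet> y)) + ?I (\<lambda>y. max 0 (- (v \<bullet> y)))"
    by (simp only: sym mult_2)
  also have "\<dots> = (\<integral>\<^sup>+y. ennreal (max 0 (v \<bullet> y)) + ennreal (max 0 (- (v \<bullet> y))) \<partial>(heat_measure s :: 'a measure))"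
    by (rule nn_integral_add[symmetric]) measurable
  also have "\<dots> = ?I (\<lambda>y. \<bar>v \<bullet> y\<bar>)"
    by (intro nn_integral_cong) (auto simp: ennreal_plus[symmetric] max_def simp del: ennreal_plus)
  also have "\<dots> = ennreal (2 * (sqrt (s / pi) * norm v))"
    by (subst nn_integral_eq_integral)
      (use abs_inner_heat_measure[OF assms, of v] in \<open>auto simp: has_bochner_integral_iff mult.assoc\<close>)
  finally have "2 * ?I (\<lambda>y. max 0 (v \<bullet> y)) = 2 * ennreal (sqrt (s / pi) * norm v)"
    using assms by (simp add: ennreal_mult)
  then show ?thesis
    by (simp add: ennreal_mult_cancel_left)
qed

section \<open>Gaussian heat loss: upper bound by the perimeter\<close>

lemma integral_le_nn_integral:
  fixes f :: "'z \<Rightarrow> real"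
  assumes "integrable M f"
  shows "ennreal (LINT x|M. f x) \<le> (\<integral>\<^sup>+x. ennreal (f x) \<partial>M)"
proof -
  have int: "integrable M (\<lambda>x. max 0 (f x))" using assms by auto
  have "(LINT x|M. f x) \<le> (LINT x|M. max 0 (f x))"
    using assms int by (intro integral_mono) auto
  then have "ennreal (LINT x|M. f x) \<le> ennreal (LINT x|M. max 0 (f x))"
    by (rule ennreal_leI)
  also have "\<dots> = (\<integral>\<^sup>+x. ennreal (max 0 (f x)) \<partial>M)"
    using int by (intro nn_integral_eq_integral[symmetric]) auto
  finally show ?thesis by simp
qed

text \<open>
  By \<open>gauss_loss_eq_covariogram\<close> this is the heat loss of \<open>\<Omega>\<close> for the Gaussian semigroup.
\<close>

definition gauss_loss :: "'a::euclidean_space set \<Rightarrow> real \<Rightarrow> real" where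
  "gauss_loss \<Omega> r = (LINT \<xi>|spectral_measure \<Omega>. 1 - exp (- r * (norm \<xi>)\<^sup>2))"

context finite_volume_open
begin

lemma measure_spectral_measure: "measure (spectral_measure \<Omega>) UNIV = measure lborel \<Omega>"
  using covariogram_spectral[of 0] by simp

lemma integral_spectral_measure:
  fixes f :: "'a \<Rightarrow> real"
  assumes [measurable]: "f \<in> borel_measurable borel"
  shows "(LINT \<xi>|spectral_measure \<Omega>. f \<xi>) = (LINT \<xi>|lborel. spectral_density \<Omega> \<xi> * f \<xi>)"
  by (simp add: spectral_measure_def integral_density)

lemma gauss_loss_eq:
  assumes "0 < r"
  shows "gauss_loss \<Omega> r = measure lborel \<Omega> - (LINT x|volume_on \<Omega>. LINT w|volume_on \<Omega>. heat_kernel r (x - w))"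
proof -
  have "integrable (spectral_measure \<Omega>) (\<lambda>\<xi>. exp (- r * (norm \<xi>)\<^sup>2))"
    using assms by (intro S.integrable_const_bound[of _ 1]) auto
  then have "gauss_loss \<Omega> r = measure lborel \<Omega> - (LINT \<xi>|spectral_measure \<Omega>. exp (- r * (norm \<xi>)\<^sup>2))"
    by (simp add: gauss_loss_def measure_spectral_measure)
  also have "(LINT \<xi>|spectral_measure \<Omega>. exp (- r * (norm \<xi>)\<^sup>2)) = (LINT x|volume_on \<Omega>. LINT w|volume_on \<Omega>. heat_kernel r (x - w))"
    using gauss_spectral_density_integral[OF assms, of 0]
    by (subst integral_spectral_measure) (simp_all add: mult.commute)
  finally show ?thesis .
qed

lemma gauss_loss_eq_covariogram:
  assumes "0 < r"
  shows "gauss_loss \<Omega> r = (LINT z|heat_measure r. measure lborel \<Omega> - covariogram \<Omega> z)"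
proof -
  interpret H: prob_space "heat_measure r :: 'a measure"
    using assms by (rule prob_space_heat_measure)
  have "integrable (heat_measure r) (covariogram \<Omega>)"
    by (intro H.integrable_const_bound[of _ "measure lborel \<Omega>"]) (auto simp: covariogram_le)
  then show ?thesis
    using gauss_double_integral[OF assms, of 0] H.prob_space by (simp add: gauss_loss_eq[OF assms])
qed

text \<open>
  The starting value for integrating the differential inequality below.
\<close>

lemma gauss_loss_tendsto_0: "(gauss_loss \<Omega> \<longlongrightarrow> 0) (at_right 0)"
proof -
  have "((\<lambda>r. LINT \<xi>|spectral_measure \<Omega>. 1 - exp (- r * (norm \<xi>)\<^sup>2)) \<longlongrightarrow> (LINT \<xi>|spectral_measure \<Omega>. 0)) (at_right 0)"
  proof (rule bounded_convergence_at_within[where B = 1])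
    show "AE \<xi> in spectral_measure \<Omega>. ((\<lambda>r. 1 - exp (- r * (norm \<xi>)\<^sup>2)) \<longlongrightarrow> 0) (at_right 0)"
    proof (rule AE_I2)
      fix \<xi> :: 'a
      have "((\<lambda>r. 1 - exp (- r * (norm \<xi>)\<^sup>2)) \<longlongrightarrow> 1 - exp (- 0 * (norm \<xi>)\<^sup>2)) (at_right 0)"
        by (intro tendsto_intros)
      then show "((\<lambda>r. 1 - exp (- r * (norm \<xi>)\<^sup>2)) \<longlongrightarrow> 0) (at_right 0)" by simp
    qed
  qed (auto intro: finite_measure_spectral_measure)
  then show ?thesis by (simp add: gauss_loss_def[abs_def])
qed

lemma gauss_double_integral_deriv:
  assumes "0 < s0"
  shows "((\<lambda>s. LINT x|volume_on \<Omega>. LINT w|volume_on \<Omega>. heat_kernel s (x - w)) has_real_derivative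
     (LINT x|volume_on \<Omega>. LINT w|volume_on \<Omega>. heat_time_deriv s0 (x - w))) (at s0)"
proof -
  let ?V = "volume_on \<Omega>"
  define B where "B = (1 + real DIM('a)) * (4 * pi * (s0 / 4)) powr (- real DIM('a) / 2) / (s0 / 4)"
  have B: "\<bar>heat_time_deriv s (y::'a)\<bar> \<le> B" if "s0 / 4 \<le> s" for s y
    unfolding B_def using assms that by (intro heat_time_deriv_bound) auto
  have B0: "0 \<le> B" using assms by (simp add: B_def)
  have int: "integrable ?V (\<lambda>w. heat_kernel s (x - w))" if "0 < s" for s x
    using heat_kernel_le[OF that, where 'a = 'a]
    by (intro V.integrable_const_bound[of _ "(4 * pi * s) powr (- real DIM('a) / 2)"]) auto
  have inner: "((\<lambda>s. LINT w|?V. heat_kernel s (x - w)) has_derivative (\<lambda>v. (LINT w|?V. heat_time_deriv s (x - w)) * v)) (at s)"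
    if s: "s \<in> ball s0 (s0 / 2)" for s x
  proof -
    have s': "s0 / 2 < s" using s by (auto simp: dist_real_def abs_if split: if_splits)
    have "((\<lambda>s. LINT w|?V. heat_kernel s (x - w)) has_derivative (\<lambda>v. LINT w|?V. heat_time_deriv s (x - w) * v)) (at s)"
    proof (rule has_derivative_integral_bounded[OF finite_measure_volume_on _ B0])
      show "0 < s0 / 4" using assms by simp
      fix u :: real assume u: "u \<in> ball s (s0 / 4)"
      then have u': "s0 / 4 \<le> u" "0 < u" using s' assms by (auto simp: dist_real_def abs_if split: if_splits)
      show "((\<lambda>u. heat_kernel u (x - w)) has_derivative (*) (heat_time_deriv u (x - w))) (at u)" for w
        using has_derivative_heat_kernel_time[OF u'(2)] by (simp add: has_field_derivative_def)
      show "norm (heat_time_deriv u (x - w) * v) \<le> B * norm v" for w v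
        using B[OF u'(1)] by (simp add: abs_mult mult_right_mono)
      show "integrable ?V (\<lambda>w. heat_kernel u (x - w))"
        by (rule int[OF u'(2)])
    qed simp
    then show ?thesis by simp
  qed
  have m: "\<bar>LINT w|?V. heat_time_deriv s (x - w)\<bar> \<le> measure lborel \<Omega> * B" if "s0 / 4 \<le> s" for s x
  proof -
    have "\<bar>LINT w|?V. heat_time_deriv s (x - w)\<bar> \<le> (LINT w|?V. B)"
      by (rule integral_abs_bound[THEN order_trans], rule integral_mono)
        (auto intro!: V.integrable_const_bound[of _ B] simp: B[OF that])
    then show ?thesis by (simp add: measure_volume_on)
  qed
  have "((\<lambda>s. LINT x|?V. LINT w|?V. heat_kernel s (x - w)) has_derivative
      (\<lambda>v. LINT x|?V. (LINT w|?V. heat_time_deriv s0 (x - w)) * v)) (at s0)"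
  proof (rule has_derivative_integral_bounded[OF finite_measure_volume_on _ _ inner])
    show "0 < s0 / 2" using assms by simp
    show "0 \<le> measure lborel \<Omega> * B" using B0 by simp
    fix s :: real assume s: "s \<in> ball s0 (s0 / 2)"
    then have s': "s0 / 4 \<le> s" "0 < s" using assms by (auto simp: dist_real_def abs_if split: if_splits)
    show "norm ((LINT w|?V. heat_time_deriv s (x - w)) * v) \<le> measure lborel \<Omega> * B * norm v" for x v
      using m[OF s'(1)] by (simp add: abs_mult mult_right_mono)
    let ?c = "(4 * pi * s) powr (- real DIM('a) / 2)"
    show "integrable ?V (\<lambda>x. LINT w|?V. heat_kernel s (x - w))"
    proof (rule V.integrable_const_bound[of _ "measure lborel \<Omega> * ?c"])
      show "AE x in ?V. norm (LINT w|?V. heat_kernel s (x - w)) \<le> measure lborel \<Omega> * ?c"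
      proof (rule AE_I2)
        fix x
        have "(LINT w|?V. heat_kernel s (x - w)) \<le> (LINT w|?V. ?c)"
          using heat_kernel_le[OF s'(2), where 'a = 'a] int[OF s'(2)] by (intro integral_mono) auto
        then show "norm (LINT w|?V. heat_kernel s (x - w)) \<le> measure lborel \<Omega> * ?c"
          by (simp add: measure_volume_on integral_nonneg_AE)
      qed
    qed simp
  qed simp_all
  then show ?thesis
    by (simp add: has_field_derivative_def)
qed

end

text \<open>
  Let \<open>P\<^sub>s\<close> be the heat semigroup and \<open>f\<close> the indicator function of \<open>\<Omega>\<close>. As \<open>f\<close> takes values in
  \<open>[0, 1]\<close>, each derivative in a unit direction of \<open>P\<^sub>s f\<close> is at most the integral of the positive
  part of the corresponding derivative of the kernel, which is \<open>1 / (2 sqrt (\<pi> s))\<close>. Hence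
  \<open>- 2 sqrt (\<pi> s) \<nabla>P\<^sub>s f\<close> is an admissible test field, and its divergence is
  \<open>- 2 sqrt (\<pi> s) \<partial>\<^sub>s P\<^sub>s f\<close>.
\<close>

lemma gauss_deriv_le_perimeter:
  fixes \<Omega> :: "(real ^ 'n) set"
  assumes "finite_volume_open \<Omega>" and s: "0 < s"
  shows "ereal (2 * sqrt (pi * s) * - (LINT x|volume_on \<Omega>. LINT w|volume_on \<Omega>. heat_time_deriv s (x - w))) \<le> perimeter \<Omega>"
proof -
  interpret finite_volume_open \<Omega> by fact
  let ?V = "volume_on \<Omega>"
  \<comment> \<open>The reciprocal of the sharp bound for the gradient.\<close>
  define c where "c = 2 * sqrt (pi * s)"
  have c: "0 < c" using s by (simp add: c_def)
  define B where "B = 3 * (4 * pi * s) powr (- real DIM(real^'n) / 2) / (2 * s)"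
  have B: "norm (heat_field_deriv s y v) \<le> B * norm v" for y v :: "real ^ 'n"
    unfolding B_def by (rule heat_field_deriv_bound[OF s])
  have B0: "0 \<le> B" using s by (simp add: B_def)
  have int_field: "integrable ?V (\<lambda>w. heat_field s (x - w))" for x
    using heat_field_bound[OF s, where 'a = "real ^ 'n"]
    by (intro V.integrable_const_bound[of _ "(1 + 4 * s) * (4 * pi * s) powr (- real DIM(real^'n) / 2) / (2 * s)"]) auto
  have int_deriv: "integrable ?V (\<lambda>w. heat_field_deriv s (x - w) v)" for x v
    by (rule V.integrable_const_bound[of _ "B * norm v"]) (auto simp: B)
  define C where "C = (1 + real DIM(real^'n)) * (4 * pi * s) powr (- real DIM(real^'n) / 2) / s"
  have C: "\<bar>heat_time_deriv s y\<bar> \<le> C" for y :: "real ^ 'n"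
    unfolding C_def by (rule heat_time_deriv_bound[OF s order_refl])
  define \<phi> where "\<phi> x = c *\<^sub>R (LINT w|?V. heat_field s (x - w))" for x
  define D where "D x v = c *\<^sub>R (LINT w|?V. heat_field_deriv s (x - w) v)" for x v
  have tr: "(\<Sum>i\<in>UNIV. D x (axis i 1) $ i) = c * - (LINT w|?V. heat_time_deriv s (x - w))" for x
  proof -
    have "(LINT w|?V. heat_field_deriv s (x - w) (axis i 1)) $ i = (LINT w|?V. heat_field_deriv s (x - w) (axis i 1) $ i)" for i
    proof -
      have "(LINT w|?V. heat_field_deriv s (x - w) (axis i 1)) \<bullet> axis i 1 = (LINT w|?V. heat_field_deriv s (x - w) (axis i 1) \<bullet> axis i 1)"
        by (rule integral_inner_left[symmetric]) (rule int_deriv)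
      then show ?thesis by (simp add: inner_axis)
    qed
    then have "(\<Sum>i\<in>UNIV. D x (axis i 1) $ i) = c * (\<Sum>i\<in>UNIV. LINT w|?V. heat_field_deriv s (x - w) (axis i 1) $ i)"
      by (simp add: D_def sum_distrib_left)
    also have "(\<Sum>i\<in>UNIV. LINT w|?V. heat_field_deriv s (x - w) (axis i 1) $ i)
        = (LINT w|?V. (\<Sum>i\<in>UNIV. heat_field_deriv s (x - w) (axis i 1) $ i))"
    proof (rule Bochner_Integration.integral_sum[symmetric])
      show "integrable ?V (\<lambda>w. heat_field_deriv s (x - w) (axis i 1) $ i)" for i
      proof -
        have "integrable ?V (\<lambda>w. heat_field_deriv s (x - w) (axis i 1) \<bullet> axis i 1)"
          by (rule integrable_inner_left) (rule int_deriv)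
        then show ?thesis by (simp add: inner_axis)
      qed
    qed
    finally show ?thesis by (simp add: trace_heat_field_deriv[OF s])
  qed
  have "ereal (LINT x|?V. (\<Sum>i\<in>UNIV. D x (axis i 1) $ i)) \<le> perimeter \<Omega>"
  proof (rule perimeter_bounded_test_ge[OF assms(1)])
    fix x :: "real ^ 'n"
    have "((\<lambda>x. LINT w|?V. heat_field s (x - w)) has_derivative (\<lambda>v. LINT w|?V. heat_field_deriv s (x - w) v)) (at x)"
    proof (rule has_derivative_integral_bounded[OF finite_measure_volume_on zero_less_one B0])
      show "((\<lambda>x. heat_field s (x - w)) has_derivative heat_field_deriv s (x - w)) (at x)" for x w :: "real ^ 'n"
      proof -
        have "((\<lambda>x. x - w) has_derivative (\<lambda>v. v)) (at x)"
          by (auto intro!: derivative_eq_intros)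
        from has_derivative_compose[OF this has_derivative_heat_field] show ?thesis by simp
      qed
    qed (auto simp: B int_field)
    then show "(\<phi> has_derivative D x) (at x)"
      unfolding \<phi>_def[abs_def] D_def[abs_def] by (rule has_derivative_scaleR_right)
    show "continuous_on UNIV (\<lambda>x. D x v)" for v
    proof -
      have "((\<lambda>x. LINT w|?V. heat_field_deriv s (x - w) v) \<longlongrightarrow> (LINT w|?V. heat_field_deriv s (a - w) v)) (at a)" for a
      proof (rule bounded_convergence_at_within[where B = "B * norm v"])
        show "AE w in ?V. ((\<lambda>x. heat_field_deriv s (x - w) v) \<longlongrightarrow> heat_field_deriv s (a - w) v) (at a)"
        proof (rule AE_I2)
          fix w
          have "continuous_on UNIV (\<lambda>x. heat_field_deriv s (x - w) v)" by (intro continuous_intros)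
          then show "((\<lambda>x. heat_field_deriv s (x - w) v) \<longlongrightarrow> heat_field_deriv s (a - w) v) (at a)"
            by (simp add: continuous_on_def)
        qed
      qed (auto simp: B intro: finite_measure_volume_on)
      then show ?thesis
        unfolding D_def by (intro continuous_intros) (auto simp: continuous_on_def)
    qed
    show "norm (\<phi> x) \<le> 1"
    proof (cases "\<phi> x = 0")
      case False
      \<comment> \<open>Bound the component of the field in its own direction.\<close>
      define e where "e = \<phi> x /\<^sub>R norm (\<phi> x)"
      have e: "norm e = 1" using False by (simp add: e_def)
      have "norm (\<phi> x) = e \<bullet> \<phi> x"
        using False by (simp add: e_def dot_square_norm power2_eq_square)
      also have "\<dots> = c * (LINT w|?V. e \<bullet> heat_field s (x - w))"
        unfolding \<phi>_def inner_scaleR_right by (subst integral_inner_right[symmetric]) (use int_field in auto)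
      finally have n: "norm (\<phi> x) = c * (LINT w|?V. e \<bullet> heat_field s (x - w))" .
      have "ennreal (LINT w|?V. e \<bullet> heat_field s (x - w)) \<le> (\<integral>\<^sup>+w. ennreal (e \<bullet> heat_field s (x - w)) \<partial>?V)"
        by (rule integral_le_nn_integral) (auto intro!: integrable_inner_right int_field)
      also have "\<dots> = (\<integral>\<^sup>+w. indicator \<Omega> w * ennreal (e \<bullet> heat_field s (x - w)) \<partial>lborel)"
        by (simp add: volume_on_def nn_integral_density)
      also have "\<dots> \<le> (\<integral>\<^sup>+w. ennreal (max 0 (e \<bullet> heat_field s (x - w))) \<partial>lborel)"
        by (intro nn_integral_mono) (auto simp: indicator_def)
      also have "\<dots> = (\<integral>\<^sup>+w. ennreal (max 0 (e \<bullet> heat_field s (- (w + - x)))) \<partial>lborel)"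
        by simp
      also have "\<dots> = (\<integral>\<^sup>+w. ennreal (max 0 (e \<bullet> heat_field s (- w))) \<partial>lborel)"
        by (rule nn_integral_lborel_shift) measurable
      also have "\<dots> = (\<integral>\<^sup>+y. ennreal (max 0 (e \<bullet> heat_field s y)) \<partial>lborel)"
        by (rule nn_integral_lborel_uminus) measurable
      also have "\<dots> = (\<integral>\<^sup>+y. ennreal (1 / (2 * s)) * (ennreal (heat_kernel s y) * ennreal (max 0 (e \<bullet> y))) \<partial>lborel)"
      proof (intro nn_integral_cong)
        fix y :: "real ^ 'n"
        have "max 0 (e \<bullet> heat_field s y) = 1 / (2 * s) * (heat_kernel s y * max 0 (e \<bullet> y))"
          using s heat_kernel_nonneg[of s y] by (auto simp: heat_field_def max_def zero_le_mult_iff mult_le_0_iff divide_simps intro: antisym)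
        moreover have "ennreal (a * (b * m)) = ennreal a * (ennreal b * ennreal m)" if "0 \<le> a" "0 \<le> b" "0 \<le> m" for a b m :: real
          using that by (simp add: ennreal_mult)
        ultimately show "ennreal (max 0 (e \<bullet> heat_field s y)) = ennreal (1 / (2 * s)) * (ennreal (heat_kernel s y) * ennreal (max 0 (e \<bullet> y)))"
          using s by (metis heat_kernel_nonneg max.cobounded1 zero_le_divide_1_iff zero_le_mult_iff less_imp_le zero_le_numeral)
      qed
      also have "\<dots> = ennreal (1 / (2 * s)) * (\<integral>\<^sup>+y. ennreal (max 0 (e \<bullet> y)) \<partial>heat_measure s)"
        by (subst nn_integral_cmult) (auto simp: nn_integral_heat_measure)
      also have "\<dots> = ennreal (1 / (2 * s) * sqrt (s / pi))"
        using s by (simp only: nn_integral_heat_measure_pos_part[OF s] e mult_1_right, subst ennreal_mult) auto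
      finally have "(LINT w|?V. e \<bullet> heat_field s (x - w)) \<le> 1 / (2 * s) * sqrt (s / pi)"
        using s by (subst (asm) ennreal_le_iff) auto
      then have "norm (\<phi> x) \<le> c * (1 / (2 * s) * sqrt (s / pi))"
        unfolding n using c by (intro mult_left_mono) auto
      also have "\<dots> = 1"
        using s by (simp add: c_def real_sqrt_mult real_sqrt_divide field_simps)
      finally show ?thesis .
    qed simp
    show "\<bar>\<Sum>i\<in>UNIV. D x (axis i 1) $ i\<bar> \<le> c * (measure lborel \<Omega> * C)"
    proof -
      have "\<bar>LINT w|?V. heat_time_deriv s (x - w)\<bar> \<le> (LINT w|?V. C)"
        by (rule integral_abs_bound[THEN order_trans], rule integral_mono)
          (auto intro!: V.integrable_const_bound[of _ C] simp: C)
      then have "\<bar>LINT w|?V. heat_time_deriv s (x - w)\<bar> \<le> measure lborel \<Omega> * C"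
        by (simp add: measure_volume_on)
      then show ?thesis
        unfolding tr abs_mult abs_minus using c by (simp only: abs_of_pos mult_le_cancel_left_pos)
    qed
  qed
  then show ?thesis
    unfolding tr by (simp add: c_def)
qed

text \<open>
  The previous lemma says that \<open>gauss_loss \<Omega> r - P sqrt (r / \<pi>)\<close> is nonincreasing in \<open>r\<close>; it tends
  to \<open>0\<close> at \<open>r = 0\<close>.
\<close>

theorem gauss_loss_le_perimeter:
  fixes \<Omega> :: "(real ^ 'n) set"
  assumes "finite_volume_open \<Omega>" and P: "perimeter \<Omega> = ereal P" and r: "0 < r"
  shows "gauss_loss \<Omega> r \<le> P * sqrt (r / pi)"
proof -
  interpret finite_volume_open \<Omega> by fact
  define Q where "Q s = (LINT x|volume_on \<Omega>. LINT w|volume_on \<Omega>. heat_kernel s (x - w))" for s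
  define \<Phi> where "\<Phi> s = (measure lborel \<Omega> - Q s) - P * sqrt (s / pi)" for s
  have mono: "\<Phi> r \<le> \<Phi> e" if e: "0 < e" "e \<le> r" for e
  proof (rule DERIV_nonpos_imp_nonincreasing[OF e(2)])
    fix s assume "e \<le> s" "s \<le> r"
    then have s: "0 < s" using e by simp
    let ?d = "LINT x|volume_on \<Omega>. LINT w|volume_on \<Omega>. heat_time_deriv s (x - w)"
    have "(\<Phi> has_real_derivative (0 - ?d) - P * (inverse (sqrt (s / pi)) / 2 * (1 / pi))) (at s)"
      unfolding \<Phi>_def[abs_def] Q_def[abs_def] using s
      by (intro DERIV_diff DERIV_const gauss_double_integral_deriv DERIV_cmult DERIV_chain'[of "\<lambda>s. s / pi" _ _ _ sqrt]
          DERIV_cdivide DERIV_ident DERIV_real_sqrt) auto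
    moreover have "(0 - ?d) - P * (inverse (sqrt (s / pi)) / 2 * (1 / pi)) \<le> 0"
    proof -
      have "2 * sqrt (pi * s) * - ?d \<le> P"
        using gauss_deriv_le_perimeter[OF assms(1) s] P by simp
      then have "- ?d \<le> P / (2 * sqrt (pi * s))"
        using s by (simp add: field_simps)
      also have "\<dots> = P * (inverse (sqrt (s / pi)) / 2 * (1 / pi))"
        using s by (simp add: real_sqrt_mult real_sqrt_divide field_simps)
      finally show ?thesis by simp
    qed
    ultimately show "\<exists>y. (\<Phi> has_real_derivative y) (at s) \<and> y \<le> 0" by blast
  qed
  have "(\<Phi> \<longlongrightarrow> 0 - P * sqrt (0 / pi)) (at_right 0)"
  proof -
    have "((\<lambda>s. gauss_loss \<Omega> s - P * sqrt (s / pi)) \<longlongrightarrow> 0 - P * sqrt (0 / pi)) (at_right 0)"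
      by (intro tendsto_intros gauss_loss_tendsto_0) auto
    then show ?thesis
      by (rule Lim_transform_eventually, intro eventually_mono[OF eventually_at_right_less[of 0]])
        (simp add: \<Phi>_def Q_def gauss_loss_eq)
  qed
  then have "\<Phi> r \<le> 0 - P * sqrt (0 / pi)"
  proof (rule tendsto_lowerbound)
    show "\<forall>\<^sub>F e in at_right 0. \<Phi> r \<le> \<Phi> e"
      using eventually_at_right_field[of "\<lambda>e. \<Phi> r \<le> \<Phi> e" 0] mono r by (metis less_imp_le)
  qed simp
  then show ?thesis
    by (simp add: \<Phi>_def Q_def gauss_loss_eq[OF r])
qed

section \<open>Gaussian heat loss: lower bound by the perimeter\<close>

lemma has_derivative_along_line:
  fixes f :: "'a::real_normed_vector \<Rightarrow> real"
  assumes "(f has_derivative D) (at x)"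
  shows "((\<lambda>h. f (x + h *\<^sub>R e)) has_real_derivative D e) (at 0)"
proof -
  have "((\<lambda>h::real. x + h *\<^sub>R e) has_derivative (\<lambda>h. h *\<^sub>R e)) (at 0)"
    by (auto intro!: derivative_eq_intros)
  from has_derivative_compose[OF this, of f D] assms
  have "((\<lambda>h. f (x + h *\<^sub>R e)) has_derivative (\<lambda>h. D (h *\<^sub>R e))) (at 0)" by simp
  moreover have "(\<lambda>h. D (h *\<^sub>R e)) = (*) (D e)"
    by (rule ext) (simp add: linear_scale[OF has_derivative_linear[OF assms]])
  ultimately show ?thesis by (simp add: has_field_derivative_def)
qed

text \<open>
  The integral of \<open>x \<mapsto> \<psi> (x + h e)\<close> does not depend on \<open>h\<close>, so the integrals of the difference
  quotients vanish; they converge by dominated convergence. This is the integration by parts used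
  below.
\<close>

lemma integral_directional_derivative_eq_0:
  fixes \<psi> :: "'a::euclidean_space \<Rightarrow> real"
  assumes D: "\<And>x. (\<psi> has_derivative D x) (at x)"
    and DB: "\<And>x v. \<bar>D x v\<bar> \<le> B * norm v" and B: "0 \<le> B"
    and K: "\<And>x. \<bar>\<psi> x\<bar> \<le> K"
    and out: "\<And>x. R \<le> norm x \<Longrightarrow> \<psi> x = 0"
    and [measurable]: "(\<lambda>x. D x e) \<in> borel_measurable borel"
  shows "(LINT x|lborel. D x e) = 0"
proof -
  have "continuous_on UNIV \<psi>"
    using D by (intro continuous_at_imp_continuous_on ballI has_derivative_continuous) auto
  then have [measurable]: "\<psi> \<in> borel_measurable borel" by (rule borel_measurable_continuous_onI)
  have int_ball: "integrable lborel (\<lambda>x::'a. c * indicator (cball 0 r) x)" for c r :: real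
    using emeasure_bounded_finite[of "cball (0::'a) r"] by simp
  have int: "integrable lborel (\<lambda>x. \<psi> (x + a))" for a
  proof (rule Bochner_Integration.integrable_bound[OF int_ball[of K "R + norm a"]])
    show "AE x in lborel. norm (\<psi> (x + a)) \<le> norm (K * indicator (cball 0 (R + norm a)) x :: real)"
    proof (rule AE_I2)
      fix x
      have K0: "0 \<le> K" using K[of 0] by linarith
      show "norm (\<psi> (x + a)) \<le> norm (K * indicator (cball 0 (R + norm a)) x :: real)"
      proof (cases "norm x \<le> R + norm a")
        case True then show ?thesis using K[of "x + a"] K0 by simp
      next
        case False
        then have "R \<le> norm (x + a)" using norm_diff_ineq[of x a] by simp
        then show ?thesis by (simp add: out)
      qed
    qed
  qed measurable
  define q where "q h x = (\<psi> (x + h *\<^sub>R e) - \<psi> x) / h" for h :: real and x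
  have "((\<lambda>h. LINT x|lborel. q h x) \<longlongrightarrow> (LINT x|lborel. D x e)) (at 0 within ball 0 1)"
  proof (rule dominated_convergence_at_within[OF _ _ int_ball[of "B * norm e" "R + norm e"]])
    show "q h \<in> borel_measurable lborel" for h unfolding q_def by measurable
    show "(\<lambda>x. D x e) \<in> borel_measurable lborel" by measurable
    show "AE x in lborel. ((\<lambda>h. q h x) \<longlongrightarrow> D x e) (at 0 within ball 0 1)"
    proof (rule AE_I2)
      fix x
      have "((\<lambda>h. \<psi> (x + h *\<^sub>R e)) has_real_derivative D x e) (at 0)"
        by (rule has_derivative_along_line[OF D])
      then have "((\<lambda>h. q h x) \<longlongrightarrow> D x e) (at 0)"
        by (simp add: has_field_derivative_iff q_def)
      then show "((\<lambda>h. q h x) \<longlongrightarrow> D x e) (at 0 within ball 0 1)"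
        by (rule tendsto_within_subset) simp
    qed
    fix h :: real assume h: "h \<in> ball 0 1" "h \<noteq> 0"
    show "AE x in lborel. norm (q h x) \<le> B * norm e * indicator (cball 0 (R + norm e)) x"
    proof (rule AE_I2)
      fix x
      show "norm (q h x) \<le> B * norm e * indicator (cball 0 (R + norm e)) x"
      proof (cases "norm x \<le> R + norm e")
        case True
        have "norm (\<psi> (x + h *\<^sub>R e) - \<psi> x) \<le> B * norm (x + h *\<^sub>R e - x)"
        proof (rule differentiable_bound[of UNIV])
          show "(\<psi> has_derivative D x) (at x within UNIV)" for x using D by simp
          show "onorm (D x) \<le> B" for x using B DB by (intro onorm_bound) auto
        qed auto
        then show ?thesis using True h by (simp add: q_def divide_simps mult_ac)
      next
        case False
        have "norm (h *\<^sub>R e) \<le> norm e" using h by (simp add: mult_left_le_one_le)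
        then have "R \<le> norm (x + h *\<^sub>R e)" using norm_diff_ineq[of x "h *\<^sub>R e"] False by linarith
        moreover have "R \<le> norm x" using False norm_ge_zero[of e] by linarith
        ultimately show ?thesis using False by (simp add: q_def out)
      qed
    qed
  qed
  moreover have "(LINT x|lborel. q h x) = 0" for h
  proof -
    have "(LINT x|lborel. q h x) = ((LINT x|lborel. \<psi> (x + h *\<^sub>R e)) - (LINT x|lborel. \<psi> x)) / h"
      using int[of "h *\<^sub>R e"] int[of 0] by (simp add: q_def)
    then show ?thesis by (subst (asm) integral_lborel_shift) auto
  qed
  ultimately have "((\<lambda>h::real. 0) \<longlongrightarrow> (LINT x|lborel. D x e)) (at 0 within ball 0 1)" by simp
  moreover have "at (0::real) within ball 0 1 \<noteq> bot" by (simp add: at_within_open[of 0 "ball 0 1"])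
  ultimately show ?thesis using tendsto_unique tendsto_const by metis
qed

definition mollified :: "'a::euclidean_space set \<Rightarrow> real \<Rightarrow> 'a \<Rightarrow> real" where
  "mollified \<Omega> s x = (LINT w|volume_on \<Omega>. heat_kernel s (x - w))"

definition mollified_grad :: "'a::euclidean_space set \<Rightarrow> real \<Rightarrow> 'a \<Rightarrow> 'a" where
  "mollified_grad \<Omega> s x = - (LINT w|volume_on \<Omega>. heat_field s (x - w))"

context finite_volume_open
begin

lemma mollified_measurable [measurable]: "mollified \<Omega> s \<in> borel_measurable borel"
  unfolding mollified_def[abs_def] by measurable

lemma mollified_grad_measurable [measurable]: "mollified_grad \<Omega> s \<in> borel_measurable borel"
  unfolding mollified_grad_def[abs_def] by measurable

context
  fixes s :: real assumes s: "0 < s"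
begin

lemma integrable_heat_kernel: "integrable (volume_on \<Omega>) (\<lambda>w. heat_kernel s (x - w))"
  using heat_kernel_le[OF s, where 'a = 'a]
  by (intro V.integrable_const_bound[of _ "(4 * pi * s) powr (- real DIM('a) / 2)"]) auto

lemma integrable_heat_field: "integrable (volume_on \<Omega>) (\<lambda>w. heat_field s (x - w))"
  using heat_field_bound[OF s, where 'a = 'a]
  by (intro V.integrable_const_bound[of _ "(1 + 4 * s) * (4 * pi * s) powr (- real DIM('a) / 2) / (2 * s)"]) auto

lemma mollified_nonneg: "0 \<le> mollified \<Omega> s x"
  unfolding mollified_def by (rule integral_nonneg_AE) simp

lemma mollified_bound: "\<bar>mollified \<Omega> s x\<bar> \<le> measure lborel \<Omega> * (4 * pi * s) powr (- real DIM('a) / 2)"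
proof -
  let ?c = "(4 * pi * s) powr (- real DIM('a) / 2)"
  have "mollified \<Omega> s x \<le> (LINT w|volume_on \<Omega>. ?c)"
    unfolding mollified_def using heat_kernel_le[OF s, where 'a = 'a] integrable_heat_kernel
    by (intro integral_mono) auto
  then show ?thesis using mollified_nonneg[of x] by (simp add: measure_volume_on)
qed

lemma mollified_grad_bound:
  "norm (mollified_grad \<Omega> s x) \<le> measure lborel \<Omega> * ((1 + 4 * s) * (4 * pi * s) powr (- real DIM('a) / 2) / (2 * s))"
proof -
  define c where "c = (1 + 4 * s) * (4 * pi * s) powr (- real DIM('a) / 2) / (2 * s)"
  have c: "norm (heat_field s y) \<le> c" for y :: 'a
    unfolding c_def by (rule heat_field_bound[OF s])
  have "norm (mollified_grad \<Omega> s x) \<le> (LINT w|volume_on \<Omega>. c)"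
    unfolding mollified_grad_def norm_minus_cancel
    by (rule order_trans[OF integral_norm_bound integral_mono])
      (auto intro!: integrable_norm integrable_heat_field simp: c)
  then show ?thesis by (simp add: measure_volume_on c_def)
qed

lemma has_derivative_mollified:
  "(mollified \<Omega> s has_derivative (\<lambda>v. mollified_grad \<Omega> s x \<bullet> v)) (at x)"
proof -
  have "((\<lambda>x. LINT w|volume_on \<Omega>. heat_kernel s (x - w)) has_derivative (\<lambda>v. LINT w|volume_on \<Omega>. heat_grad s (x - w) v)) (at x)"
  proof (rule has_derivative_integral_bounded[OF finite_measure_volume_on zero_less_one])
    show "0 \<le> (1 + 4 * s) * (4 * pi * s) powr (- real DIM('a) / 2) / (2 * s)" using s by simp
    show "norm (heat_grad s (x - w) v) \<le> (1 + 4 * s) * (4 * pi * s) powr (- real DIM('a) / 2) / (2 * s) * norm v" for x w v :: 'a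
      unfolding real_norm_def by (rule heat_grad_bound[OF s])
    show "((\<lambda>x. heat_kernel s (x - w)) has_derivative heat_grad s (x - w)) (at x)" for x w :: 'a
    proof -
      have "((\<lambda>x. x - w) has_derivative (\<lambda>v. v)) (at x)"
        by (auto intro!: derivative_eq_intros)
      from has_derivative_compose[OF this has_derivative_heat_kernel] show ?thesis by simp
    qed
  qed (auto intro: integrable_heat_kernel)
  moreover have "(LINT w|volume_on \<Omega>. heat_grad s (x - w) v) = mollified_grad \<Omega> s x \<bullet> v" for v
    using integrable_heat_field by (simp add: heat_grad_eq mollified_grad_def)
  ultimately show ?thesis
    by (simp add: mollified_def[abs_def])
qed

lemma nn_integral_heat_kernel: "(\<integral>\<^sup>+x. ennreal (heat_kernel s (x - w)) \<partial>lborel) = 1" for w :: 'a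
proof -
  interpret H: prob_space "heat_measure s :: 'a measure" by (rule prob_space_heat_measure[OF s])
  have "(\<integral>\<^sup>+x. ennreal (heat_kernel s (x - w)) \<partial>lborel) = (\<integral>\<^sup>+x. ennreal (heat_kernel s (x + - w)) \<partial>lborel)" by simp
  also have "\<dots> = (\<integral>\<^sup>+x. ennreal (heat_kernel s (x :: 'a)) \<partial>lborel)"
    by (rule nn_integral_lborel_shift) measurable
  also have "\<dots> = emeasure (heat_measure s) (UNIV :: 'a set)"
    by (simp add: heat_measure_def emeasure_density)
  finally show ?thesis using H.emeasure_space_1 by simp
qed

text \<open>
  Points leaving and points entering \<open>\<Omega>\<close> under the translation contribute equally.
\<close>

lemma nn_integral_translate_diff:
  "(\<integral>\<^sup>+w. ennreal \<bar>indicator \<Omega> (w + y) - indicator \<Omega> w\<bar> \<partial>lborel) = ennreal (2 * (measure lborel \<Omega> - covariogram \<Omega> y))"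
proof -
  have "(\<integral>\<^sup>+w. ennreal \<bar>indicator \<Omega> (w + y) - indicator \<Omega> w\<bar> \<partial>lborel)
     = (\<integral>\<^sup>+w. indicator {x \<in> \<Omega>. x + y \<notin> \<Omega>} w + indicator {w. w + y \<in> {x \<in> \<Omega>. x + - y \<notin> \<Omega>}} w \<partial>lborel)"
    by (intro nn_integral_cong) (auto simp: indicator_def)
  also have "\<dots> = emeasure lborel {x \<in> \<Omega>. x + y \<notin> \<Omega>} + emeasure lborel {w. w + y \<in> {x \<in> \<Omega>. x + - y \<notin> \<Omega>}}"
    by (subst nn_integral_add) auto
  also have "emeasure lborel {w. w + y \<in> {x \<in> \<Omega>. x + - y \<notin> \<Omega>}} = emeasure lborel {x \<in> \<Omega>. x + - y \<notin> \<Omega>}"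
    by (rule emeasure_lborel_shift) measurable
  finally show ?thesis
    unfolding emeasure_escape covariogram_minus using covariogram_le[of y] by (simp flip: ennreal_plus)
qed

text \<open>
  Mollification does not increase the \<open>L\<^sup>1\<close> distance between a function and its translate.
\<close>

lemma nn_integral_mollified_diff_le:
  "(\<integral>\<^sup>+x. ennreal \<bar>mollified \<Omega> s (x + y) - mollified \<Omega> s x\<bar> \<partial>lborel) \<le> ennreal (2 * (measure lborel \<Omega> - covariogram \<Omega> y))"
proof -
  let ?c = "(4 * pi * s) powr (- real DIM('a) / 2)"
  let ?d = "\<lambda>w. \<bar>indicator \<Omega> (w + y) - indicator \<Omega> w\<bar> :: real"
  have int0: "integrable lborel (\<lambda>w. indicator \<Omega> w *\<^sub>R heat_kernel s (x - w))" for x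
  proof -
    have "volume_on \<Omega> = density lborel (\<lambda>x. ennreal (indicator \<Omega> x))"
      by (simp add: volume_on_def ennreal_indicator)
    then show ?thesis
      using integrable_heat_kernel[of x] by (simp add: integrable_density)
  qed
  have int1: "integrable lborel (\<lambda>w. indicator \<Omega> (w + y) *\<^sub>R heat_kernel s (x - w))" for x
  proof -
    have "integrable (distr lborel borel ((+) y)) (\<lambda>w. indicator \<Omega> w *\<^sub>R heat_kernel s (x + y - w))"
      unfolding lborel_distr_plus by (rule int0)
    then show ?thesis
      by (subst (asm) integrable_distr_eq) (auto simp: algebra_simps)
  qed
  have eq: "mollified \<Omega> s (x + y) - mollified \<Omega> s x
      = (LINT w|lborel. (indicator \<Omega> (w + y) - indicator \<Omega> w) * heat_kernel s (x - w))" for x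
  proof -
    have "mollified \<Omega> s (x + y) = (LINT w|lborel. indicator \<Omega> w *\<^sub>R heat_kernel s (x + y - w))"
      unfolding mollified_def by (subst integral_volume_on) (auto simp: set_lebesgue_integral_def)
    also have "\<dots> = (LINT w|lborel. indicator \<Omega> (w + y) *\<^sub>R heat_kernel s (x + y - (w + y)))"
      by (rule integral_lborel_shift[symmetric]) measurable
    finally have 1: "mollified \<Omega> s (x + y) = (LINT w|lborel. indicator \<Omega> (w + y) *\<^sub>R heat_kernel s (x - w))"
      by simp
    have 2: "mollified \<Omega> s x = (LINT w|lborel. indicator \<Omega> w *\<^sub>R heat_kernel s (x - w))"
      unfolding mollified_def by (subst integral_volume_on) (auto simp: set_lebesgue_integral_def)
    show ?thesis
      unfolding 1 2 using int0[of x] int1[of x]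
      by (subst Bochner_Integration.integral_diff[symmetric]) (auto simp: algebra_simps)
  qed
  have "(\<integral>\<^sup>+x. ennreal \<bar>mollified \<Omega> s (x + y) - mollified \<Omega> s x\<bar> \<partial>lborel)
     \<le> (\<integral>\<^sup>+x. (\<integral>\<^sup>+w. ennreal (?d w) * ennreal (heat_kernel s (x - w)) \<partial>lborel) \<partial>lborel)"
  proof (intro nn_integral_mono)
    fix x
    have "integrable lborel (\<lambda>w. (indicator \<Omega> (w + y) - indicator \<Omega> w) * heat_kernel s (x - w))"
      using Bochner_Integration.integrable_diff[OF int1[of x] int0[of x]] by (simp add: algebra_simps)
    from integral_norm_bound_ennreal[OF this]
    show "ennreal \<bar>mollified \<Omega> s (x + y) - mollified \<Omega> s x\<bar> \<le> (\<integral>\<^sup>+w. ennreal (?d w) * ennreal (heat_kernel s (x - w)) \<partial>lborel)"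
      unfolding eq by (simp add: abs_mult ennreal_mult)
  qed
  also have "\<dots> = (\<integral>\<^sup>+w. (\<integral>\<^sup>+x. ennreal (?d w) * ennreal (heat_kernel s (x - w)) \<partial>lborel) \<partial>lborel)"
    by (rule lborel_pair.Fubini') measurable
  also have "\<dots> = (\<integral>\<^sup>+w. ennreal (?d w) \<partial>lborel)"
    by (subst nn_integral_cmult) (auto simp: nn_integral_heat_kernel)
  also have "\<dots> = ennreal (2 * (measure lborel \<Omega> - covariogram \<Omega> y))"
    by (rule nn_integral_translate_diff)
  finally show ?thesis .
qed

lemma nn_integral_mollified_diff_le_gauss_loss:
  assumes r: "0 < r"
  shows "(\<integral>\<^sup>+z. (\<integral>\<^sup>+x. ennreal \<bar>mollified \<Omega> s (x + sqrt r *\<^sub>R z) - mollified \<Omega> s x\<bar> \<partial>lborel) \<partial>heat_measure 1)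
    \<le> ennreal (2 * gauss_loss \<Omega> r)"
proof -
  interpret H: prob_space "heat_measure r :: 'a measure" by (rule prob_space_heat_measure[OF r])
  have int: "integrable (heat_measure r) (\<lambda>y. 2 * (measure lborel \<Omega> - covariogram \<Omega> y))"
    by (intro H.integrable_const_bound[of _ "2 * measure lborel \<Omega>"]) (auto simp: covariogram_le)
  have "(\<integral>\<^sup>+z. (\<integral>\<^sup>+x. ennreal \<bar>mollified \<Omega> s (x + sqrt r *\<^sub>R z) - mollified \<Omega> s x\<bar> \<partial>lborel) \<partial>heat_measure 1)
     = (\<integral>\<^sup>+y. (\<integral>\<^sup>+x. ennreal \<bar>mollified \<Omega> s (x + y) - mollified \<Omega> s x\<bar> \<partial>lborel) \<partial>heat_measure r)"
    by (rule nn_integral_heat_measure_scale[OF r, symmetric]) measurable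
  also have "\<dots> \<le> (\<integral>\<^sup>+y. ennreal (2 * (measure lborel \<Omega> - covariogram \<Omega> y)) \<partial>heat_measure r)"
    by (intro nn_integral_mono nn_integral_mollified_diff_le)
  also have "\<dots> = ennreal (LINT y|heat_measure r. 2 * (measure lborel \<Omega> - covariogram \<Omega> y))"
    by (rule nn_integral_eq_integral[OF int]) (simp add: covariogram_le)
  also have "\<dots> = ennreal (2 * gauss_loss \<Omega> r)"
    unfolding gauss_loss_eq_covariogram[OF r] by (subst integral_mult_right_zero) simp
  finally show ?thesis .
qed

text \<open>
  Average the previous inequality over the Gaussian and rescale. As \<open>r\<close> tends to \<open>0\<close> the difference
  quotients of the smooth function \<open>mollified \<Omega> s\<close> converge to directional derivatives, and Fatou's
  lemma applies; the Gaussian average of \<open>|g \<bullet> z|\<close> over \<open>z\<close> is \<open>2 / sqrt \<pi>\<close> times the length of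
  \<open>g\<close>.
\<close>

lemma nn_integral_mollified_grad_le:
  assumes r: "\<And>k. 0 < r k" "r \<longlonglongrightarrow> 0"
  shows "(\<integral>\<^sup>+x. ennreal (2 / sqrt pi * norm (mollified_grad \<Omega> s x)) \<partial>lborel)
    \<le> liminf (\<lambda>k. ennreal (2 * gauss_loss \<Omega> (r k) / sqrt (r k)))"
proof -
  interpret H: prob_space "heat_measure 1 :: 'a measure" by (rule prob_space_heat_measure) simp
  interpret P: pair_sigma_finite "heat_measure 1 :: 'a measure" "lborel :: 'a measure" ..
  let ?u = "mollified \<Omega> s" and ?g = "mollified_grad \<Omega> s"
  let ?q = "\<lambda>k z x. ennreal (\<bar>?u (x + sqrt (r k) *\<^sub>R z) - ?u x\<bar> / sqrt (r k))"
  have lim: "(\<lambda>k. ?q k z x) \<longlonglongrightarrow> ennreal \<bar>?g x \<bullet> z\<bar>" for x z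
  proof -
    have "((\<lambda>h. ?u (x + h *\<^sub>R z)) has_real_derivative ?g x \<bullet> z) (at 0)"
      by (rule has_derivative_along_line[OF has_derivative_mollified])
    then have d: "((\<lambda>h. (?u (x + h *\<^sub>R z) - ?u x) / h) \<longlongrightarrow> ?g x \<bullet> z) (at 0)"
      by (simp add: has_field_derivative_iff)
    have "(\<lambda>k. sqrt (r k)) \<longlonglongrightarrow> sqrt 0" by (intro tendsto_intros r)
    then have "filterlim (\<lambda>k. sqrt (r k)) (at 0) sequentially"
      using r(1) by (intro filterlim_atI) (auto simp: less_imp_neq[symmetric])
    from filterlim_compose[OF d this]
    have "(\<lambda>k. \<bar>(?u (x + sqrt (r k) *\<^sub>R z) - ?u x) / sqrt (r k)\<bar>) \<longlonglongrightarrow> \<bar>?g x \<bullet> z\<bar>"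
      by (intro tendsto_intros)
    then have "(\<lambda>k. \<bar>?u (x + sqrt (r k) *\<^sub>R z) - ?u x\<bar> / sqrt (r k)) \<longlonglongrightarrow> \<bar>?g x \<bullet> z\<bar>"
      using r(1) by (simp add: abs_divide less_imp_le)
    then show ?thesis by (intro tendsto_ennrealI)
  qed
  have "(\<integral>\<^sup>+x. ennreal (2 / sqrt pi * norm (?g x)) \<partial>lborel) = (\<integral>\<^sup>+x. (\<integral>\<^sup>+z. ennreal \<bar>?g x \<bullet> z\<bar> \<partial>heat_measure 1) \<partial>lborel)"
  proof (intro nn_integral_cong)
    fix x
    show "ennreal (2 / sqrt pi * norm (?g x)) = (\<integral>\<^sup>+z. ennreal \<bar>?g x \<bullet> z\<bar> \<partial>heat_measure 1)"
      using abs_inner_heat_measure[of 1 "?g x"]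
      by (subst nn_integral_eq_integral) (auto simp: has_bochner_integral_iff real_sqrt_divide)
  qed
  also have "\<dots> = (\<integral>\<^sup>+z. (\<integral>\<^sup>+x. ennreal \<bar>?g x \<bullet> z\<bar> \<partial>lborel) \<partial>heat_measure 1)"
    by (rule P.Fubini') measurable
  also have "\<dots> = (\<integral>\<^sup>+z. (\<integral>\<^sup>+x. liminf (\<lambda>k. ?q k z x) \<partial>lborel) \<partial>heat_measure 1)"
    using lim_imp_Liminf[OF _ lim] by (intro nn_integral_cong) simp
  also have "\<dots> \<le> (\<integral>\<^sup>+z. liminf (\<lambda>k. \<integral>\<^sup>+x. ?q k z x \<partial>lborel) \<partial>heat_measure 1)"
    by (intro nn_integral_mono nn_integral_liminf) measurable
  also have "\<dots> \<le> liminf (\<lambda>k. \<integral>\<^sup>+z. (\<integral>\<^sup>+x. ?q k z x \<partial>lborel) \<partial>heat_measure 1)"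
    by (intro nn_integral_liminf) measurable
  also have "\<dots> \<le> liminf (\<lambda>k. ennreal (2 * gauss_loss \<Omega> (r k) / sqrt (r k)))"
  proof (intro Liminf_mono always_eventually allI)
    fix k
    have "(\<integral>\<^sup>+z. (\<integral>\<^sup>+x. ?q k z x \<partial>lborel) \<partial>heat_measure 1)
       = (\<integral>\<^sup>+z. (\<integral>\<^sup>+x. ennreal (1 / sqrt (r k)) * ennreal \<bar>?u (x + sqrt (r k) *\<^sub>R z) - ?u x\<bar> \<partial>lborel) \<partial>heat_measure 1)"
      using r(1)[of k] by (intro nn_integral_cong) (simp add: less_imp_le flip: ennreal_mult)
    also have "\<dots> = ennreal (1 / sqrt (r k)) * (\<integral>\<^sup>+z. (\<integral>\<^sup>+x. ennreal \<bar>?u (x + sqrt (r k) *\<^sub>R z) - ?u x\<bar> \<partial>lborel) \<partial>heat_measure 1)"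
      by (simp add: nn_integral_cmult)
    also have "\<dots> \<le> ennreal (1 / sqrt (r k)) * ennreal (2 * gauss_loss \<Omega> (r k))"
      using r(1) by (intro mult_left_mono nn_integral_mollified_diff_le_gauss_loss) auto
    also have "\<dots> = ennreal (2 * gauss_loss \<Omega> (r k) / sqrt (r k))"
      using r(1)[of k] by (simp add: less_imp_le flip: ennreal_mult')
    finally show "(\<integral>\<^sup>+z. (\<integral>\<^sup>+x. ?q k z x \<partial>lborel) \<partial>heat_measure 1) \<le> ennreal (2 * gauss_loss \<Omega> (r k) / sqrt (r k))" .
  qed
  finally show ?thesis .
qed

end

end

text \<open>
  Unpacks a test field into the bounds that the integrations need.
\<close>

lemma C1_compact_supportE:
  assumes "C1_compact_support \<phi>"
  obtains D B R where "\<And>x. (\<phi> has_derivative D x) (at x)" "\<And>v. continuous_on UNIV (\<lambda>x. D x v)"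
    "\<And>x v. norm (D x v) \<le> B * norm v" "0 \<le> B"
    "\<And>x. R \<le> norm x \<Longrightarrow> \<phi> x = 0" "\<And>x v. R \<le> norm x \<Longrightarrow> D x v = 0"
proof -
  obtain \<phi>' where \<phi>': "\<And>x. (\<phi> has_derivative blinfun_apply (\<phi>' x)) (at x)" "continuous_on UNIV \<phi>'"
    and c: "compact (closure {x. \<phi> x \<noteq> 0})"
    using assms unfolding C1_compact_support_def by auto
  obtain R0 where R0: "\<And>x. x \<in> closure {x. \<phi> x \<noteq> 0} \<Longrightarrow> norm x \<le> R0"
    using compact_imp_bounded[OF c] unfolding bounded_iff by auto
  define R where "R = R0 + 1"
  have out: "x \<in> - closure {x. \<phi> x \<noteq> 0}" if "R \<le> norm x" for x
  proof
    assume "x \<in> closure {x. \<phi> x \<noteq> 0}"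
    then have "norm x \<le> R0" by (rule R0)
    with that show False by (simp add: R_def)
  qed
  have z: "\<phi> x = 0" if "x \<in> - closure {x. \<phi> x \<noteq> 0}" for x
    using that closure_subset[of "{x. \<phi> x \<noteq> 0}"] by blast
  have z': "blinfun_apply (\<phi>' x) = (\<lambda>v. 0)" if "R \<le> norm x" for x
  proof (rule has_derivative_unique[OF \<phi>'(1)])
    have "((\<lambda>x. 0) has_derivative (\<lambda>v. 0)) (at x)" by (rule has_derivative_const)
    then show "(\<phi> has_derivative (\<lambda>v. 0)) (at x)"
    proof (rule has_derivative_transform_within_open)
      show "open (- closure {x. \<phi> x \<noteq> 0})" by (intro open_Compl closed_closure)
      show "x \<in> - closure {x. \<phi> x \<noteq> 0}" by (rule out[OF that])
      show "0 = \<phi> y" if "y \<in> - closure {x. \<phi> x \<noteq> 0}" for y using z[OF that] by simp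
    qed
  qed
  have "compact (\<phi>' ` cball 0 R)"
    using \<phi>'(2) by (intro compact_continuous_image continuous_on_subset[OF \<phi>'(2)]) auto
  then obtain B0 where B0: "\<forall>x\<in>cball 0 R. norm (\<phi>' x) \<le> B0"
    using compact_imp_bounded[of "\<phi>' ` cball 0 R"] unfolding bounded_iff by auto
  define B where "B = max 0 B0"
  have B: "norm (blinfun_apply (\<phi>' x) v) \<le> B * norm v" for x v
  proof (cases "norm x \<le> R")
    case True
    have "norm (blinfun_apply (\<phi>' x) v) \<le> norm (\<phi>' x) * norm v" by (rule norm_blinfun)
    also have "\<dots> \<le> B * norm v" using B0 True by (intro mult_right_mono) (force simp: B_def)+
    finally show ?thesis .
  next
    case False then show ?thesis using z'[of x] by (simp add: B_def)
  qed
  show ?thesis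
  proof (rule that[of "\<lambda>x. blinfun_apply (\<phi>' x)" B R])
    show "continuous_on UNIV (\<lambda>x. blinfun_apply (\<phi>' x) v)" for v
      by (intro continuous_intros \<phi>')
    show "0 \<le> B" by (simp add: B_def)
    show "\<phi> x = 0" if "R \<le> norm x" for x by (rule z[OF out[OF that]])
    show "blinfun_apply (\<phi>' x) v = 0" if "R \<le> norm x" for x v using z'[OF that] by simp
  qed (fact \<phi>'(1) B)+
qed

lemma integrable_lborel_bounded_support:
  fixes f :: "'a::euclidean_space \<Rightarrow> real"
  assumes [measurable]: "f \<in> borel_measurable borel" and "\<And>x. \<bar>f x\<bar> \<le> K" "\<And>x. R \<le> norm x \<Longrightarrow> f x = 0"
  shows "integrable lborel f"
proof (rule Bochner_Integration.integrable_bound)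
  show "integrable lborel (\<lambda>x::'a. K * indicator (cball 0 R) x)"
    using emeasure_bounded_finite[of "cball (0::'a) R"] by simp
  have "0 \<le> K" using assms(2)[of 0] by linarith
  then show "AE x in lborel. norm (f x) \<le> norm (K * indicator (cball 0 R) x)"
    using assms(2,3) by (auto simp: indicator_def)
qed measurable

text \<open>
  Integrate by parts in each coordinate and use that the test field has length at most one: the
  total variation of a smooth function is at least its pairing with a divergence.
\<close>

lemma mollified_divergence_le:
  fixes \<Omega> :: "(real ^ 'n) set"
  assumes "finite_volume_open \<Omega>" and s: "0 < s"
    and C1: "C1_compact_support \<phi>" and norm1: "\<And>x. norm (\<phi> x) \<le> 1"
  shows "ennreal (LINT x|lborel. mollified \<Omega> s x * divergence \<phi> x) \<le> (\<integral>\<^sup>+x. ennreal (norm (mollified_grad \<Omega> s x)) \<partial>lborel)"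
proof -
  interpret finite_volume_open \<Omega> by fact
  let ?u = "mollified \<Omega> s" and ?g = "mollified_grad \<Omega> s"
  obtain D B R where D: "\<And>x. (\<phi> has_derivative D x) (at x)" "\<And>v. continuous_on UNIV (\<lambda>x. D x v)"
    "\<And>x v. norm (D x v) \<le> B * norm v" "0 \<le> B"
    "\<And>x. R \<le> norm x \<Longrightarrow> \<phi> x = 0" "\<And>x v. R \<le> norm x \<Longrightarrow> D x v = 0"
    by (rule C1_compact_supportE[OF C1]) (rule that)
  have "continuous_on UNIV \<phi>"
    using D(1) by (intro continuous_at_imp_continuous_on ballI has_derivative_continuous) auto
  then have [measurable]: "\<phi> \<in> borel_measurable borel" by (rule borel_measurable_continuous_onI)
  have [measurable]: "(\<lambda>x. D x v) \<in> borel_measurable borel" for v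
    by (rule borel_measurable_continuous_onI) (rule D(2))
  have m1[measurable]: "(\<lambda>x. \<phi> x $ i) \<in> borel_measurable borel" for i
    by (rule borel_measurable_continuous_onI, intro continuous_intros) fact
  have m2[measurable]: "(\<lambda>x. D x v $ i) \<in> borel_measurable borel" for v i
    by (rule borel_measurable_continuous_onI, intro continuous_intros D(2))
  obtain U where U: "\<And>x. \<bar>?u x\<bar> \<le> U" using mollified_bound[OF s] by blast
  obtain G where G: "\<And>x. norm (?g x) \<le> G" using mollified_grad_bound[OF s] by blast
  have UG0: "0 \<le> U" "0 \<le> G" using U[of 0] G[of 0] norm_ge_zero[of "?g 0"] by linarith+
  let ?e = "\<lambda>i. axis i (1::real) :: real ^ 'n"
  have \<phi>i: "\<bar>\<phi> x $ i\<bar> \<le> 1" for x i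
    using component_le_norm_cart[of "\<phi> x" i] norm1[of x] by linarith
  have Di: "\<bar>D x v $ i\<bar> \<le> B * norm v" for x v i
    using component_le_norm_cart[of "D x v" i] D(3)[of x v] by linarith
  have gv: "\<bar>?g x \<bullet> v\<bar> \<le> G * norm v" for x v
    using Cauchy_Schwarz_ineq2[of "?g x" v] mult_right_mono[OF G[of x], of "norm v"] by simp
  have int1: "integrable lborel (\<lambda>x. ?u x * D x (?e i) $ i)" for i
  proof (rule integrable_lborel_bounded_support[of _ "U * B" R])
    show "\<bar>?u x * D x (?e i) $ i\<bar> \<le> U * B" for x
      unfolding abs_mult using Di[of x "?e i" i] U[of x] UG0 by (intro mult_mono) auto
  qed (simp_all add: D(6))
  have int2: "integrable lborel (\<lambda>x. (?g x \<bullet> ?e i) * \<phi> x $ i)" for i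
  proof (rule integrable_lborel_bounded_support[of _ "G * 1" R])
    show "\<bar>(?g x \<bullet> ?e i) * \<phi> x $ i\<bar> \<le> G * 1" for x
      unfolding abs_mult using gv[of x "?e i"] \<phi>i[of x i] UG0 by (intro mult_mono) auto
  qed (simp_all add: D(5))
  have parts: "(LINT x|lborel. ?u x * D x (?e i) $ i) = - (LINT x|lborel. (?g x \<bullet> ?e i) * \<phi> x $ i)" for i
  proof -
    have "(LINT x|lborel. ?u x * D x (?e i) $ i + (?g x \<bullet> ?e i) * \<phi> x $ i) = 0"
    proof (rule integral_directional_derivative_eq_0[where \<psi> = "\<lambda>x. ?u x * \<phi> x $ i" and e = "?e i"
          and D = "\<lambda>x v. ?u x * D x v $ i + (?g x \<bullet> v) * \<phi> x $ i" and B = "U * B + G" and K = U and R = R])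
      show "((\<lambda>x. ?u x * \<phi> x $ i) has_derivative (\<lambda>v. ?u x * D x v $ i + (?g x \<bullet> v) * \<phi> x $ i)) (at x)" for x
        by (intro has_derivative_mult has_derivative_mollified s bounded_linear.has_derivative[OF bounded_linear_vec_nth] D(1))
      show "\<bar>?u x * D x v $ i + (?g x \<bullet> v) * \<phi> x $ i\<bar> \<le> (U * B + G) * norm v" for x v
      proof -
        have "\<bar>?u x * D x v $ i\<bar> \<le> U * (B * norm v)"
          unfolding abs_mult using U UG0 Di by (intro mult_mono) auto
        moreover have "\<bar>(?g x \<bullet> v) * \<phi> x $ i\<bar> \<le> (G * norm v) * 1"
          unfolding abs_mult using gv UG0 \<phi>i by (intro mult_mono) auto
        ultimately show ?thesis by (simp add: algebra_simps)
      qed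
      show "\<bar>?u x * \<phi> x $ i\<bar> \<le> U" for x
        using mult_mono[OF U[of x] \<phi>i[of x i]] UG0 by (simp add: abs_mult)
      show "0 \<le> U * B + G" using UG0 D(4) by simp
    qed (simp_all add: D(5))
    then show ?thesis using int1[of i] int2[of i] by simp
  qed
  have "(LINT x|lborel. ?u x * divergence \<phi> x) = (LINT x|lborel. (\<Sum>i\<in>UNIV. ?u x * D x (?e i) $ i))"
    by (simp add: divergence_eq[OF D(1)] sum_distrib_left)
  also have "\<dots> = (\<Sum>i\<in>UNIV. LINT x|lborel. ?u x * D x (?e i) $ i)"
    using int1 by (rule Bochner_Integration.integral_sum)
  also have "\<dots> = (\<Sum>i\<in>UNIV. LINT x|lborel. - ((?g x \<bullet> ?e i) * \<phi> x $ i))"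
    unfolding parts by simp
  also have "\<dots> = (LINT x|lborel. (\<Sum>i\<in>UNIV. - ((?g x \<bullet> ?e i) * \<phi> x $ i)))"
    using int2 by (intro Bochner_Integration.integral_sum[symmetric]) simp
  finally have "ennreal (LINT x|lborel. ?u x * divergence \<phi> x)
      = ennreal (LINT x|lborel. (\<Sum>i\<in>UNIV. - ((?g x \<bullet> ?e i) * \<phi> x $ i)))" by simp
  also have "\<dots> \<le> (\<integral>\<^sup>+x. ennreal (\<Sum>i\<in>UNIV. - ((?g x \<bullet> ?e i) * \<phi> x $ i)) \<partial>lborel)"
    using int2 by (intro integral_le_nn_integral Bochner_Integration.integrable_sum Bochner_Integration.integrable_minus)
  also have "\<dots> \<le> (\<integral>\<^sup>+x. ennreal (norm (?g x)) \<partial>lborel)"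
  proof (intro nn_integral_mono ennreal_leI)
    fix x
    have "(\<Sum>i\<in>UNIV. - ((?g x \<bullet> ?e i) * \<phi> x $ i)) = - (?g x \<bullet> \<phi> x)"
      by (simp add: sum_negf sum_axis_inner)
    also have "\<dots> \<le> norm (?g x) * norm (\<phi> x)"
      using Cauchy_Schwarz_ineq2[of "?g x" "\<phi> x"] by simp
    also have "\<dots> \<le> norm (?g x) * 1" using norm1 by (intro mult_left_mono) auto
    finally show "(\<Sum>i\<in>UNIV. - ((?g x \<bullet> ?e i) * \<phi> x $ i)) \<le> norm (?g x)" by simp
  qed
  finally show ?thesis .
qed

context finite_volume_open
begin

text \<open>
  Mollification is self-adjoint, so it can be moved onto the continuous test function.
\<close>

lemma mollified_test_tendsto:
  assumes cont: "continuous_on UNIV \<psi>" and B: "\<And>x. \<bar>\<psi> x\<bar> \<le> B" and out: "\<And>x. R \<le> norm x \<Longrightarrow> \<psi> x = 0"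
  shows "((\<lambda>s. LINT x|lborel. mollified \<Omega> s x * \<psi> x) \<longlongrightarrow> (LINT w|volume_on \<Omega>. \<psi> w)) (at_right 0)"
proof -
  have [measurable]: "\<psi> \<in> borel_measurable borel" using cont by (rule borel_measurable_continuous_onI)
  have B0: "0 \<le> B" using B[of 0] by linarith
  interpret K: finite_volume_open "ball (0::'a) R"
  proof
    show "open (ball (0::'a) R)" by (rule open_ball)
    show "emeasure lborel (ball (0::'a) R) < \<infinity>" by (rule emeasure_bounded_finite) (rule bounded_ball)
  qed
  let ?V = "volume_on \<Omega>" and ?K = "volume_on (ball (0::'a) R)"
  have K: "(LINT x|lborel. f x * \<psi> x) = (LINT x|?K. f x * \<psi> x)" if [measurable]: "f \<in> borel_measurable borel" for f
    by (subst K.integral_volume_on)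
      (auto simp: set_lebesgue_integral_def indicator_def out not_less intro!: Bochner_Integration.integral_cong)
  have eq: "(LINT x|lborel. mollified \<Omega> s x * \<psi> x) = (LINT w|?V. LINT y|heat_measure s. \<psi> (y + w))" if s: "0 < s" for s
  proof -
    let ?c = "(4 * pi * s) powr (- real DIM('a) / 2)"
    have "(LINT x|lborel. mollified \<Omega> s x * \<psi> x) = (LINT x|?K. LINT w|?V. heat_kernel s (x - w) * \<psi> x)"
      by (subst K) (auto simp: mollified_def)
    also have "\<dots> = (LINT w|?V. LINT x|?K. heat_kernel s (x - w) * \<psi> x)"
    proof (rule integral_swap_bounded[OF K.finite_measure_volume_on finite_measure_volume_on])
      show "norm (heat_kernel s (x - w) * \<psi> x) \<le> ?c * B" for x w
        unfolding real_norm_def abs_mult using heat_kernel_le[OF s, of "x - w"] B[of x] by (intro mult_mono) auto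
    qed measurable
    also have "\<dots> = (LINT w|?V. LINT x|lborel. heat_kernel s (x - w) * \<psi> x)"
      by (intro Bochner_Integration.integral_cong refl K[symmetric]) measurable
    also have "\<dots> = (LINT w|?V. LINT y|heat_measure s. \<psi> (y + w))"
    proof (rule Bochner_Integration.integral_cong[OF refl])
      fix w
      have "(LINT x|lborel. heat_kernel s (x - w) * \<psi> x) = (LINT y|lborel. heat_kernel s (y + w - w) * \<psi> (y + w))"
        by (rule integral_lborel_shift[symmetric]) measurable
      then show "(LINT x|lborel. heat_kernel s (x - w) * \<psi> x) = (LINT y|heat_measure s. \<psi> (y + w))"
        by (subst integral_heat_measure) auto
    qed
    finally show ?thesis .
  qed
  have "((\<lambda>s. LINT w|?V. LINT y|heat_measure s. \<psi> (y + w)) \<longlongrightarrow> (LINT w|?V. \<psi> w)) (at_right 0)"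
  proof (rule bounded_convergence_at_within[OF finite_measure_volume_on, where B = B])
    show "AE w in ?V. ((\<lambda>s. LINT y|heat_measure s. \<psi> (y + w)) \<longlongrightarrow> \<psi> w) (at_right 0)"
    proof (rule AE_I2)
      fix w
      have "isCont (\<lambda>y. \<psi> (y + w)) 0"
        using cont by (intro isCont_o2[where f = "\<lambda>y. y + w" and g = \<psi>]) (auto simp: continuous_on_eq_continuous_at)
      from heat_measure_approximate_identity[OF _ this, of B] B
      show "((\<lambda>s. LINT y|heat_measure s. \<psi> (y + w)) \<longlongrightarrow> \<psi> w) (at_right 0)" by simp
    qed
    fix s :: real and w assume "s \<in> {0<..}"
    then have s: "0 < s" by simp
    interpret H: prob_space "heat_measure s :: 'a measure" by (rule prob_space_heat_measure[OF s])
    have "\<bar>LINT y|heat_measure s. \<psi> (y + w)\<bar> \<le> (LINT y|(heat_measure s :: 'a measure). B)"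
      by (rule integral_abs_bound[THEN order_trans], rule integral_mono)
        (auto intro!: H.integrable_const_bound[of _ B] simp: B)
    then show "norm (LINT y|heat_measure s. \<psi> (y + w)) \<le> B"
      using H.prob_space by simp
  next
    fix s :: real assume "s \<in> {0<..}"
    then have s: "0 < s" by simp
    interpret H: prob_space "heat_measure s :: 'a measure" by (rule prob_space_heat_measure[OF s])
    show "(\<lambda>w. LINT y|heat_measure s. \<psi> (y + w)) \<in> borel_measurable ?V" by measurable
  qed simp
  then show ?thesis
    by (rule Lim_transform_eventually, intro eventually_mono[OF eventually_at_right_less[of 0]]) (simp add: eq)
qed

end

text \<open>
  The upper bound holds for every \<open>r\<close>. For the lower bound pick a test field that almost attains
  the perimeter, then a mollification that almost preserves its pairing with \<open>\<Omega>\<close>, and only then let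
  \<open>r\<close> tend to \<open>0\<close>; the factor \<open>2\<close> is that of \<open>nn_integral_translate_diff\<close>.
\<close>

theorem gauss_loss_asymptotics:
  fixes \<Omega> :: "(real ^ 'n) set"
  assumes fin: "finite_volume_open \<Omega>" and P: "perimeter \<Omega> = ereal P"
  shows "((\<lambda>r. gauss_loss \<Omega> r / sqrt r) \<longlongrightarrow> P / sqrt pi) (at_right 0)"
proof (rule tendsto_at_right_sequentially[of 0 1])
  interpret finite_volume_open \<Omega> by fact
  fix r :: "nat \<Rightarrow> real" assume r: "\<And>k. 0 < r k" "r \<longlonglongrightarrow> 0"
  define a where "a k = gauss_loss \<Omega> (r k) / sqrt (r k)" for k
  have a0: "0 \<le> a k" for k
  proof -
    have "0 \<le> gauss_loss \<Omega> (r k)"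
      unfolding gauss_loss_def using r(1)[of k] by (intro integral_nonneg_AE) auto
    then show ?thesis using r(1)[of k] by (simp add: a_def)
  qed
  have upper: "a k \<le> P / sqrt pi" for k
    using gauss_loss_le_perimeter[OF fin P r(1)[of k]] r(1)[of k] by (simp add: a_def real_sqrt_divide divide_simps)
  have lower: "eventually (\<lambda>k. c / sqrt pi < a k) sequentially" if c: "c < P" for c
  proof (cases "c < 0")
    case True
    then have "c / sqrt pi < 0" by (simp add: divide_less_0_iff)
    then show ?thesis using a0 by (intro always_eventually allI) (rule less_le_trans)
  next
    case False
    then have c0: "0 \<le> c" by simp
    have "ereal c < perimeter \<Omega>" using c P by simp
    then obtain \<phi> where \<phi>: "C1_compact_support \<phi>" "\<And>x. norm (\<phi> x) \<le> 1"
      and L: "c < (LINT x:\<Omega>|lborel. divergence \<phi> x)"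
      unfolding perimeter_def by (auto simp: less_SUP_iff)
    obtain D B R where D: "\<And>x. (\<phi> has_derivative D x) (at x)" "\<And>v. continuous_on UNIV (\<lambda>x. D x v)"
      "\<And>x v. norm (D x v) \<le> B * norm v" "0 \<le> B"
      "\<And>x. R \<le> norm x \<Longrightarrow> \<phi> x = 0" "\<And>x v. R \<le> norm x \<Longrightarrow> D x v = 0"
      by (rule C1_compact_supportE[OF \<phi>(1)]) (rule that)
    have div: "divergence \<phi> x = (\<Sum>i\<in>UNIV. D x (axis i 1) $ i)" for x
      by (rule divergence_eq[OF D(1)])
    have cdiv: "continuous_on UNIV (divergence \<phi>)"
      unfolding div[abs_def] by (intro continuous_intros D(2))
    have bdiv: "\<bar>divergence \<phi> x\<bar> \<le> CARD('n) * B" for x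
    proof -
      have "\<bar>D x (axis i 1) $ i\<bar> \<le> B" for i
        using component_le_norm_cart[of "D x (axis i 1)" i] D(3)[of x "axis i 1"] by simp
      then have "\<bar>divergence \<phi> x\<bar> \<le> (\<Sum>i\<in>(UNIV::'n set). B)"
        unfolding div by (intro order_trans[OF sum_abs] sum_mono) auto
      then show ?thesis by simp
    qed
    have "((\<lambda>s. LINT x|lborel. mollified \<Omega> s x * divergence \<phi> x) \<longlongrightarrow> (LINT w|volume_on \<Omega>. divergence \<phi> w)) (at_right 0)"
      by (rule mollified_test_tendsto[OF cdiv bdiv, of R]) (simp add: div D(6))
    moreover have "c < (LINT w|volume_on \<Omega>. divergence \<phi> w)"
      using L cdiv by (subst integral_volume_on) (auto intro: borel_measurable_continuous_onI)
    ultimately have "\<forall>\<^sub>F s in at_right 0. c < (LINT x|lborel. mollified \<Omega> s x * divergence \<phi> x)"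
      by (rule order_tendstoD)
    then have "\<forall>\<^sub>F s in at_right 0. 0 < s \<and> c < (LINT x|lborel. mollified \<Omega> s x * divergence \<phi> x)"
      using eventually_at_right_less[of 0] by eventually_elim auto
    then obtain s where s: "0 < s" and cs: "c < (LINT x|lborel. mollified \<Omega> s x * divergence \<phi> x)"
      using eventually_happens'[OF trivial_limit_at_right_real] by blast
    have "ennreal (2 * (c / sqrt pi)) < ennreal (2 / sqrt pi * (LINT x|lborel. mollified \<Omega> s x * divergence \<phi> x))"
      using c0 cs by (intro ennreal_lessI) (auto simp: divide_simps)
    also have "\<dots> = ennreal (2 / sqrt pi) * ennreal (LINT x|lborel. mollified \<Omega> s x * divergence \<phi> x)"
      using c0 cs by (intro ennreal_mult) auto
    also have "\<dots> \<le> ennreal (2 / sqrt pi) * (\<integral>\<^sup>+x. ennreal (norm (mollified_grad \<Omega> s x)) \<partial>lborel)"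
      by (intro mult_left_mono mollified_divergence_le fin s \<phi>) auto
    also have "\<dots> = (\<integral>\<^sup>+x. ennreal (2 / sqrt pi) * ennreal (norm (mollified_grad \<Omega> s x)) \<partial>lborel)"
      by (rule nn_integral_cmult[symmetric]) measurable
    also have "\<dots> = (\<integral>\<^sup>+x. ennreal (2 / sqrt pi * norm (mollified_grad \<Omega> s x)) \<partial>lborel)"
      by (intro nn_integral_cong ennreal_mult[symmetric]) auto
    also have "\<dots> \<le> liminf (\<lambda>k. ennreal (2 * a k))"
      using nn_integral_mollified_grad_le[OF s r] by (simp add: a_def)
    finally have "\<forall>\<^sub>F k in sequentially. ennreal (2 * (c / sqrt pi)) < ennreal (2 * a k)"
      by (rule less_LiminfD)
    then show ?thesis
      by eventually_elim (use c0 in \<open>auto simp: ennreal_less_iff\<close>)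
  qed
  have "a \<longlonglongrightarrow> P / sqrt pi"
  proof (rule order_tendstoI)
    fix b assume "b < P / sqrt pi"
    then have "b * sqrt pi < P" by (simp add: field_simps)
    from lower[OF this] show "\<forall>\<^sub>F k in sequentially. b < a k" by simp
  next
    fix b assume "P / sqrt pi < b"
    then show "\<forall>\<^sub>F k in sequentially. a k < b"
      using upper by (intro always_eventually allI) (rule le_less_trans)
  qed
  then show "(\<lambda>k. gauss_loss \<Omega> (r k) / sqrt (r k)) \<longlonglongrightarrow> P / sqrt pi"
    by (simp add: a_def[abs_def])
qed simp

section \<open>Gamma integrals\<close>

lemma nn_integral_powr_tail:
  fixes a \<sigma> :: real
  assumes "0 < a" "0 < \<sigma>"
  shows "(\<integral>\<^sup>+r. ennreal (r powr (- 1 - \<sigma>)) * indicator {a..} r \<partial>lborel) = ennreal (a powr - \<sigma> / \<sigma>)"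
proof -
  have "(\<integral>\<^sup>+r. ennreal (r powr (- 1 - \<sigma>)) * indicator {a..} r \<partial>lborel) = ennreal (0 - (- (a powr - \<sigma> / \<sigma>)))"
  proof (rule nn_integral_FTC_atLeast[where F = "\<lambda>r. - (r powr - \<sigma> / \<sigma>)"])
    show "((\<lambda>r. - (r powr - \<sigma> / \<sigma>)) has_real_derivative r powr (- 1 - \<sigma>)) (at r)" if "a \<le> r" for r
      using assms that by (auto intro!: derivative_eq_intros simp: powr_diff powr_minus field_simps)
    have "((\<lambda>r::real. r powr - \<sigma>) \<longlongrightarrow> 0) at_top"
      using assms by (intro tendsto_neg_powr filterlim_ident) auto
    then have "((\<lambda>r. - (r powr - \<sigma> / \<sigma>)) \<longlongrightarrow> - (0 / \<sigma>)) at_top"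
      using assms by (intro tendsto_intros) auto
    then show "((\<lambda>r. - (r powr - \<sigma> / \<sigma>)) \<longlongrightarrow> 0) at_top" by simp
  qed auto
  then show ?thesis by simp
qed

lemma nn_integral_exp_tail: "(\<integral>\<^sup>+v. ennreal (exp (- v)) * indicator {a..} v \<partial>lborel) = ennreal (exp (- a))" for a :: real
proof -
  have "(\<integral>\<^sup>+v. ennreal (exp (- v)) * indicator {a..} v \<partial>lborel) = ennreal (0 - (- exp (- a)))"
  proof (rule nn_integral_FTC_atLeast[where F = "\<lambda>v. - exp (- v)"])
    have "((\<lambda>v::real. exp (- v)) \<longlongrightarrow> 0) at_top"
      by (intro filterlim_compose[OF exp_at_bot] filterlim_uminus_at_bot_at_top)
    then show "((\<lambda>v::real. - exp (- v)) \<longlongrightarrow> 0) at_top"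
      using tendsto_minus by fastforce
  qed (auto intro!: derivative_eq_intros)
  then show ?thesis by simp
qed

lemma nn_integral_exp_Ioc:
  fixes a :: real
  assumes "0 \<le> a"
  shows "(\<integral>\<^sup>+v. ennreal (exp (- v)) * indicator {0<..a} v \<partial>lborel) = ennreal (1 - exp (- a))"
proof -
  have "(\<integral>\<^sup>+v. ennreal (exp (- v)) * indicator {0<..a} v \<partial>lborel) = (\<integral>\<^sup>+v. ennreal (exp (- v)) * indicator {0..a} v \<partial>lborel)"
    by (intro nn_integral_cong_AE eventually_mono[OF AE_lborel_singleton[of 0]]) (auto simp: indicator_def)
  also have "\<dots> = ennreal (- exp (- a) - (- exp (- 0)))"
    using assms by (intro nn_integral_FTC_Icc[where F = "\<lambda>v. - exp (- v)"]) (auto intro!: derivative_eq_intros)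
  finally show ?thesis by simp
qed

lemma nn_integral_Gamma_scaled:
  fixes x u :: real
  assumes x: "0 < x" and u: "0 < u"
  shows "(\<integral>\<^sup>+r. ennreal (r powr (x - 1) * exp (- u * r)) * indicator {0<..} r \<partial>lborel) = ennreal (Gamma x * u powr - x)"
proof -
  have "ennreal (Gamma x) = (\<integral>\<^sup>+t. ennreal (indicator {0..} t * t powr (x - 1) / exp t) \<partial>lborel)"
    by (rule Gamma_conv_nn_integral_real[OF x])
  also have "\<dots> = ennreal \<bar>u\<bar> * (\<integral>\<^sup>+r. ennreal (indicator {0..} (0 + u * r) * (0 + u * r) powr (x - 1) / exp (0 + u * r)) \<partial>lborel)"
    using u by (intro nn_integral_real_affine) auto
  also have "(\<integral>\<^sup>+r. ennreal (indicator {0..} (0 + u * r) * (0 + u * r) powr (x - 1) / exp (0 + u * r)) \<partial>lborel)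
      = (\<integral>\<^sup>+r. ennreal (u powr (x - 1)) * (ennreal (r powr (x - 1) * exp (- u * r)) * indicator {0<..} r) \<partial>lborel)"
    using u by (intro nn_integral_cong)
      (auto simp: indicator_def powr_mult exp_minus divide_inverse zero_le_mult_iff ennreal_mult[symmetric] mult_ac not_less)
  also have "\<dots> = ennreal (u powr (x - 1)) * (\<integral>\<^sup>+r. ennreal (r powr (x - 1) * exp (- u * r)) * indicator {0<..} r \<partial>lborel)"
    by (rule nn_integral_cmult) measurable
  finally have "ennreal (Gamma x) = ennreal (u powr x) * (\<integral>\<^sup>+r. ennreal (r powr (x - 1) * exp (- u * r)) * indicator {0<..} r \<partial>lborel)"
    using u by (simp add: mult.assoc[symmetric] ennreal_mult[symmetric] powr_diff)
  then have "ennreal (u powr - x) * ennreal (Gamma x)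
      = (ennreal (u powr - x) * ennreal (u powr x)) * (\<integral>\<^sup>+r. ennreal (r powr (x - 1) * exp (- u * r)) * indicator {0<..} r \<partial>lborel)"
    by (simp add: mult.assoc)
  also have "ennreal (u powr - x) * ennreal (u powr x) = 1"
    using u by (simp add: ennreal_mult[symmetric] powr_add[symmetric])
  finally show ?thesis
    using Gamma_real_pos[OF x] by (simp add: ennreal_mult' mult.commute)
qed

text \<open>
  Write \<open>exp (- b / r)\<close> as the mass that the exponential distribution gives to \<open>{b / r..}\<close> and
  exchange the integrals: the condition \<open>b / r \<le> v\<close> becomes \<open>b / v \<le> r\<close>, the inner integral is a
  power, and the outer one a Gamma integral.
\<close>

lemma nn_integral_inverse_Gamma:
  fixes b \<kappa> :: real
  assumes b: "0 < b" and \<kappa>: "0 < \<kappa>"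
  shows "(\<integral>\<^sup>+r. ennreal (r powr (- 1 - \<kappa>) * exp (- b / r)) * indicator {0<..} r \<partial>lborel) = ennreal (Gamma \<kappa> * b powr - \<kappa>)"
proof -
  have "(\<integral>\<^sup>+r. ennreal (r powr (- 1 - \<kappa>) * exp (- b / r)) * indicator {0<..} r \<partial>lborel)
    = (\<integral>\<^sup>+r. (\<integral>\<^sup>+v. ennreal (r powr (- 1 - \<kappa>)) * indicator {0<..} r * (ennreal (exp (- v)) * indicator {b / r..} v) \<partial>lborel) \<partial>lborel)"
  proof (rule nn_integral_cong)
    fix r :: real
    have "(\<integral>\<^sup>+v. ennreal (r powr (- 1 - \<kappa>)) * indicator {0<..} r * (ennreal (exp (- v)) * indicator {b / r..} v) \<partial>lborel)
       = ennreal (r powr (- 1 - \<kappa>)) * indicator {0<..} r * ennreal (exp (- (b / r)))"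
      by (subst nn_integral_cmult) (auto simp: nn_integral_exp_tail)
    then show "ennreal (r powr (- 1 - \<kappa>) * exp (- b / r)) * indicator {0<..} r
      = (\<integral>\<^sup>+v. ennreal (r powr (- 1 - \<kappa>)) * indicator {0<..} r * (ennreal (exp (- v)) * indicator {b / r..} v) \<partial>lborel)"
      by (simp add: ennreal_mult mult_ac)
  qed
  also have "\<dots> = (\<integral>\<^sup>+v. (\<integral>\<^sup>+r. ennreal (r powr (- 1 - \<kappa>)) * indicator {0<..} r * (ennreal (exp (- v)) * indicator {b / r..} v) \<partial>lborel) \<partial>lborel)"
    by (rule lborel_pair.Fubini') (auto simp: indicator_def case_prod_unfold)
  also have "\<dots> = (\<integral>\<^sup>+v. ennreal (b powr - \<kappa> / \<kappa>) * (ennreal (v powr (\<kappa> + 1 - 1) * exp (- 1 * v)) * indicator {0<..} v) \<partial>lborel)"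
  proof (rule nn_integral_cong)
    fix v :: real
    show "(\<integral>\<^sup>+r. ennreal (r powr (- 1 - \<kappa>)) * indicator {0<..} r * (ennreal (exp (- v)) * indicator {b / r..} v) \<partial>lborel)
      = ennreal (b powr - \<kappa> / \<kappa>) * (ennreal (v powr (\<kappa> + 1 - 1) * exp (- 1 * v)) * indicator {0<..} v)"
    proof (cases "0 < v")
      case True
      have "(\<integral>\<^sup>+r. ennreal (r powr (- 1 - \<kappa>)) * indicator {0<..} r * (ennreal (exp (- v)) * indicator {b / r..} v) \<partial>lborel)
         = (\<integral>\<^sup>+r. ennreal (exp (- v)) * (ennreal (r powr (- 1 - \<kappa>)) * indicator {b / v..} r) \<partial>lborel)"
      proof (rule nn_integral_cong)
        fix r :: real
        have "(0 < r \<and> b / r \<le> v) \<longleftrightarrow> b / v \<le> r"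
        proof -
          have "0 < b / v" using b True by simp
          then show ?thesis
            using True by (cases "0 < r") (simp add: pos_divide_le_eq mult.commute, blast intro: less_le_trans)
        qed
        then show "ennreal (r powr (- 1 - \<kappa>)) * indicator {0<..} r * (ennreal (exp (- v)) * indicator {b / r..} v)
          = ennreal (exp (- v)) * (ennreal (r powr (- 1 - \<kappa>)) * indicator {b / v..} r)"
          by (auto simp: indicator_def mult_ac)
      qed
      also have "\<dots> = ennreal (exp (- v)) * ennreal ((b / v) powr - \<kappa> / \<kappa>)"
        using True b \<kappa> by (subst nn_integral_cmult) (auto simp: nn_integral_powr_tail)
      also have "\<dots> = ennreal (b powr - \<kappa> / \<kappa>) * (ennreal (v powr (\<kappa> + 1 - 1) * exp (- 1 * v)) * indicator {0<..} v)"
        using True b \<kappa> by (simp add: ennreal_mult[symmetric] powr_divide powr_minus field_simps)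
      finally show ?thesis .
    next
      case False
      have "(\<integral>\<^sup>+r. ennreal (r powr (- 1 - \<kappa>)) * indicator {0<..} r * (ennreal (exp (- v)) * indicator {b / r..} v) \<partial>lborel)
         = (\<integral>\<^sup>+r. 0 \<partial>(lborel :: real measure))"
      proof (rule nn_integral_cong)
        fix r :: real
        have "\<not> (0 < r \<and> b / r \<le> v)"
          using False b divide_pos_pos[of b r] by linarith
        then show "ennreal (r powr (- 1 - \<kappa>)) * indicator {0<..} r * (ennreal (exp (- v)) * indicator {b / r..} v) = 0"
          by (auto simp: indicator_def)
      qed
      then show ?thesis using False by simp
    qed
  qed
  also have "\<dots> = ennreal (b powr - \<kappa> / \<kappa>) * ennreal (Gamma (\<kappa> + 1) * 1 powr - (\<kappa> + 1))"
    using nn_integral_Gamma_scaled[of "\<kappa> + 1" 1] \<kappa> by (subst nn_integral_cmult) auto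
  also have "\<dots> = ennreal (Gamma \<kappa> * b powr - \<kappa>)"
    using \<kappa> Gamma_real_pos[OF \<kappa>] Gamma_plus1[of \<kappa>] nonpos_Ints_nonpos[of \<kappa>]
    by (subst ennreal_mult[symmetric]) (auto simp: field_simps)
  finally show ?thesis .
qed

text \<open>
  Every power between \<open>0\<close> and \<open>1\<close> is a mixture of the functions \<open>1 - exp (- r l)\<close>. The proof
  exchanges integrals as in the previous lemma, now with the mass of \<open>{0<..r l}\<close>.
\<close>

lemma nn_integral_power_mixture:
  fixes l \<sigma> :: real
  assumes l: "0 \<le> l" and \<sigma>: "0 < \<sigma>" "\<sigma> < 1"
  shows "(\<integral>\<^sup>+r. ennreal (r powr (- 1 - \<sigma>) * (1 - exp (- r * l))) * indicator {0<..} r \<partial>lborel)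
    = ennreal (Gamma (1 - \<sigma>) / \<sigma> * l powr \<sigma>)"
proof (cases "l = 0")
  case False
  then have l: "0 < l" using l by simp
  have "(\<integral>\<^sup>+r. ennreal (r powr (- 1 - \<sigma>) * (1 - exp (- r * l))) * indicator {0<..} r \<partial>lborel)
    = (\<integral>\<^sup>+r. (\<integral>\<^sup>+v. ennreal (r powr (- 1 - \<sigma>)) * indicator {0<..} r * (ennreal (exp (- v)) * indicator {0<..r * l} v) \<partial>lborel) \<partial>lborel)"
  proof (rule nn_integral_cong)
    fix r :: real
    show "ennreal (r powr (- 1 - \<sigma>) * (1 - exp (- r * l))) * indicator {0<..} r
      = (\<integral>\<^sup>+v. ennreal (r powr (- 1 - \<sigma>)) * indicator {0<..} r * (ennreal (exp (- v)) * indicator {0<..r * l} v) \<partial>lborel)"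
    proof (cases "0 < r")
      case True
      have "(\<integral>\<^sup>+v. ennreal (r powr (- 1 - \<sigma>)) * indicator {0<..} r * (ennreal (exp (- v)) * indicator {0<..r * l} v) \<partial>lborel)
         = ennreal (r powr (- 1 - \<sigma>)) * indicator {0<..} r * ennreal (1 - exp (- (r * l)))"
        using True l by (subst nn_integral_cmult) (auto simp: nn_integral_exp_Ioc)
      then show ?thesis
        using True l by (simp add: ennreal_mult mult_ac)
    qed simp
  qed
  also have "\<dots> = (\<integral>\<^sup>+v. (\<integral>\<^sup>+r. ennreal (r powr (- 1 - \<sigma>)) * indicator {0<..} r * (ennreal (exp (- v)) * indicator {0<..r * l} v) \<partial>lborel) \<partial>lborel)"
    by (rule lborel_pair.Fubini') (auto simp: indicator_def case_prod_unfold)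
  also have "\<dots> = (\<integral>\<^sup>+v. ennreal (l powr \<sigma> / \<sigma>) * (ennreal (v powr ((1 - \<sigma>) - 1) * exp (- 1 * v)) * indicator {0<..} v) \<partial>lborel)"
  proof (rule nn_integral_cong)
    fix v :: real
    show "(\<integral>\<^sup>+r. ennreal (r powr (- 1 - \<sigma>)) * indicator {0<..} r * (ennreal (exp (- v)) * indicator {0<..r * l} v) \<partial>lborel)
      = ennreal (l powr \<sigma> / \<sigma>) * (ennreal (v powr ((1 - \<sigma>) - 1) * exp (- 1 * v)) * indicator {0<..} v)"
    proof (cases "0 < v")
      case True
      have "(\<integral>\<^sup>+r. ennreal (r powr (- 1 - \<sigma>)) * indicator {0<..} r * (ennreal (exp (- v)) * indicator {0<..r * l} v) \<partial>lborel)
         = (\<integral>\<^sup>+r. ennreal (exp (- v)) * (ennreal (r powr (- 1 - \<sigma>)) * indicator {v / l..} r) \<partial>lborel)"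
      proof (rule nn_integral_cong)
        fix r :: real
        have "(0 < r \<and> v \<le> r * l) \<longleftrightarrow> v / l \<le> r"
        proof -
          have "0 < v / l" using l True by simp
          then show ?thesis
            using l by (cases "0 < r") (simp add: pos_divide_le_eq mult.commute, blast intro: less_le_trans)
        qed
        then show "ennreal (r powr (- 1 - \<sigma>)) * indicator {0<..} r * (ennreal (exp (- v)) * indicator {0<..r * l} v)
          = ennreal (exp (- v)) * (ennreal (r powr (- 1 - \<sigma>)) * indicator {v / l..} r)"
          using True by (auto simp: indicator_def mult_ac)
      qed
      also have "\<dots> = ennreal (exp (- v)) * ennreal ((v / l) powr - \<sigma> / \<sigma>)"
        using True l \<sigma> by (subst nn_integral_cmult) (auto simp: nn_integral_powr_tail)
      also have "\<dots> = ennreal (l powr \<sigma> / \<sigma>) * (ennreal (v powr ((1 - \<sigma>) - 1) * exp (- 1 * v)) * indicator {0<..} v)"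
        using True l \<sigma> by (simp add: ennreal_mult[symmetric] powr_divide powr_minus field_simps)
      finally show ?thesis .
    qed simp
  qed
  also have "\<dots> = ennreal (l powr \<sigma> / \<sigma>) * ennreal (Gamma (1 - \<sigma>) * 1 powr - (1 - \<sigma>))"
    using nn_integral_Gamma_scaled[of "1 - \<sigma>" 1] \<sigma> by (subst nn_integral_cmult) auto
  also have "\<dots> = ennreal (Gamma (1 - \<sigma>) / \<sigma> * l powr \<sigma>)"
    using \<sigma> Gamma_real_pos[of "1 - \<sigma>"] by (subst ennreal_mult[symmetric]) (auto simp: field_simps)
  finally show ?thesis .
qed simp

section \<open>Heat loss and fractional perimeters as spectral integrals\<close>

text \<open>
  Tonelli, twice: first to integrate \<open>|\<Omega>| - covariogram \<Omega>\<close> against \<open>\<nu>\<close>, then to insert the spectral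
  representation of the covariogram.
\<close>

lemma nonlocal_perimeter_spectral:
  fixes \<Omega> :: "(real ^ 'n) set"
  assumes fin: "finite_volume_open \<Omega>" and sets[measurable_cong]: "sets \<nu> = sets borel"
    and sf: "sigma_finite_measure \<nu>"
  shows "nonlocal_perimeter \<nu> \<Omega> = (\<integral>\<^sup>+\<xi>. (\<integral>\<^sup>+y. ennreal (1 - cos (\<xi> \<bullet> y)) \<partial>\<nu>) \<partial>spectral_measure \<Omega>)"
proof -
  interpret finite_volume_open \<Omega> by fact
  interpret N: sigma_finite_measure \<nu> by fact
  interpret LN: pair_sigma_finite lborel \<nu> ..
  interpret SN: pair_sigma_finite "spectral_measure \<Omega>" \<nu> ..
  have img: "(\<lambda>z. z - x) ` (- \<Omega>) = {y. x + y \<notin> \<Omega>}" for x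
  proof safe
    fix y assume "x + y \<notin> \<Omega>"
    then show "y \<in> (\<lambda>z. z - x) ` (- \<Omega>)" by (intro image_eqI[of _ _ "x + y"]) auto
  qed auto
  have "nonlocal_perimeter \<nu> \<Omega> = (\<integral>\<^sup>+x. (\<integral>\<^sup>+y. indicator {x \<in> \<Omega>. x + y \<notin> \<Omega>} x \<partial>\<nu>) \<partial>lborel)"
    unfolding nonlocal_perimeter_def img
  proof (intro nn_integral_cong)
    fix x
    have "(\<integral>\<^sup>+y. indicator {x \<in> \<Omega>. x + y \<notin> \<Omega>} x \<partial>\<nu>) = (\<integral>\<^sup>+y. indicator \<Omega> x * indicator {y. x + y \<notin> \<Omega>} y \<partial>\<nu>)"
      by (intro nn_integral_cong) (auto simp: indicator_def)
    also have "\<dots> = indicator \<Omega> x * emeasure \<nu> {y. x + y \<notin> \<Omega>}"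
      by (subst nn_integral_cmult) auto
    finally show "emeasure \<nu> {y. x + y \<notin> \<Omega>} * indicator \<Omega> x = (\<integral>\<^sup>+y. indicator {x \<in> \<Omega>. x + y \<notin> \<Omega>} x \<partial>\<nu>)"
      by (simp add: mult.commute)
  qed
  also have "\<dots> = (\<integral>\<^sup>+y. (\<integral>\<^sup>+x. indicator {x \<in> \<Omega>. x + y \<notin> \<Omega>} x \<partial>lborel) \<partial>\<nu>)"
  proof (rule LN.Fubini'[symmetric])
    have "(\<lambda>(x, y). indicator {x \<in> \<Omega>. x + y \<notin> \<Omega>} x :: ennreal)
        = (\<lambda>(x, y). indicator \<Omega> x * (1 - indicator \<Omega> (x + y)))"
      by (auto simp: fun_eq_iff indicator_def)
    also have "\<dots> \<in> borel_measurable (lborel \<Otimes>\<^sub>M \<nu>)" by measurable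
    finally show "(\<lambda>(x, y). indicator {x \<in> \<Omega>. x + y \<notin> \<Omega>} x :: ennreal) \<in> borel_measurable (lborel \<Otimes>\<^sub>M \<nu>)" .
  qed
  also have "\<dots> = (\<integral>\<^sup>+y. (\<integral>\<^sup>+\<xi>. ennreal (1 - cos (\<xi> \<bullet> y)) \<partial>spectral_measure \<Omega>) \<partial>\<nu>)"
  proof (rule nn_integral_cong)
    fix y
    have int: "integrable (spectral_measure \<Omega>) (\<lambda>\<xi>. cos (\<xi> \<bullet> y))"
      by (intro S.integrable_const_bound[of _ 1]) auto
    have "(\<integral>\<^sup>+x. indicator {x \<in> \<Omega>. x + y \<notin> \<Omega>} x \<partial>lborel) = ennreal (measure lborel \<Omega> - covariogram \<Omega> y)"
      by (subst nn_integral_indicator) (auto simp: emeasure_escape)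
    also have "measure lborel \<Omega> - covariogram \<Omega> y = (LINT \<xi>|spectral_measure \<Omega>. 1 - cos (\<xi> \<bullet> y))"
      using int by (simp add: covariogram_spectral measure_spectral_measure)
    also have "ennreal \<dots> = (\<integral>\<^sup>+\<xi>. ennreal (1 - cos (\<xi> \<bullet> y)) \<partial>spectral_measure \<Omega>)"
      using int by (intro nn_integral_eq_integral[symmetric]) auto
    finally show "(\<integral>\<^sup>+x. indicator {x \<in> \<Omega>. x + y \<notin> \<Omega>} x \<partial>lborel) = (\<integral>\<^sup>+\<xi>. ennreal (1 - cos (\<xi> \<bullet> y)) \<partial>spectral_measure \<Omega>)" .
  qed
  also have "\<dots> = (\<integral>\<^sup>+\<xi>. (\<integral>\<^sup>+y. ennreal (1 - cos (\<xi> \<bullet> y)) \<partial>\<nu>) \<partial>spectral_measure \<Omega>)"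
    by (rule SN.Fubini') measurable
  finally show ?thesis .
qed

lemma nn_integral_one_minus_cos:
  fixes \<xi> :: "'a::euclidean_space"
  assumes "prob_space M" and [measurable_cong]: "sets M = sets borel"
  shows "(\<integral>\<^sup>+y. ennreal (1 - cos (\<xi> \<bullet> y)) \<partial>M) = ennreal (1 - (LINT y|M. cos (\<xi> \<bullet> y)))"
proof -
  interpret prob_space M by fact
  have int: "integrable M (\<lambda>y. cos (\<xi> \<bullet> y))"
    by (intro integrable_const_bound[of _ 1]) auto
  have "(\<integral>\<^sup>+y. ennreal (1 - cos (\<xi> \<bullet> y)) \<partial>M) = ennreal (LINT y|M. 1 - cos (\<xi> \<bullet> y))"
    using int by (intro nn_integral_eq_integral) auto
  then show ?thesis using int by (simp add: prob_space)
qed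

lemma heat_loss_spectral:
  fixes \<Omega> :: "(real ^ 'n) set"
  assumes fin: "finite_volume_open \<Omega>" and p: "stable_semigroup \<alpha> p" and t: "0 \<le> t"
  shows "heat_loss p \<Omega> t = (\<integral>\<^sup>+\<xi>. ennreal (1 - exp (- t * norm \<xi> powr \<alpha>)) \<partial>spectral_measure \<Omega>)"
proof -
  have pt: "prob_space (p t)" and sets[measurable_cong]: "sets (p t) = sets borel"
    and char: "(CLINT x|p t. iexp (\<xi> \<bullet> x)) = complex_of_real (exp (- t * norm \<xi> powr \<alpha>))" for \<xi>
    using p t unfolding stable_semigroup_def by auto
  interpret prob_space "p t" by fact
  have "(LINT y|p t. cos (\<xi> \<bullet> y)) = exp (- t * norm \<xi> powr \<alpha>)" for \<xi>
  proof -
    have int: "integrable (p t) (\<lambda>y. iexp (\<xi> \<bullet> y))"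
      by (intro integrable_const_bound[of _ 1]) auto
    have "(LINT y|p t. cos (\<xi> \<bullet> y)) = (LINT y|p t. Re (iexp (\<xi> \<bullet> y)))"
      by (simp add: Re_exp)
    also have "\<dots> = exp (- t * norm \<xi> powr \<alpha>)"
      by (subst integral_Re[OF int]) (simp add: char)
    finally show ?thesis .
  qed
  then show ?thesis
    unfolding heat_loss_def
    by (subst nonlocal_perimeter_spectral[OF fin sets sigma_finite_measure_axioms])
      (simp add: nn_integral_one_minus_cos[OF pt sets])
qed

lemma heat_kernel_pair_measurable [measurable]:
  "(\<lambda>(r, y::'a::euclidean_space). heat_kernel r y) \<in> borel_measurable (borel \<Otimes>\<^sub>M borel)"
  unfolding heat_kernel_def by measurable

text \<open>
  Subordination: the density of the stable Levy measure is a mixture of heat kernels with weights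
  \<open>r powr (- 1 - s / 2)\<close>. The constant agrees because \<open>|\<Gamma>(- s / 2)| = \<Gamma>(1 - s / 2) / (s / 2)\<close>.
\<close>

lemma riesz_kernel_mixture:
  fixes y :: "'a::euclidean_space"
  assumes s: "0 < s" "s < 2" and y: "y \<noteq> 0"
  shows "ennreal (stable_const DIM('a) s * norm y powr (- real DIM('a) - s)) =
    ennreal (s / 2 / Gamma (1 - s / 2)) *
      (\<integral>\<^sup>+r. ennreal (r powr (- 1 - s / 2)) * indicator {0<..} r * ennreal (heat_kernel r y) \<partial>lborel)"
proof -
  define d where "d = real DIM('a)"
  define \<kappa> where "\<kappa> = (d + s) / 2"
  have d: "0 < d" by (simp add: d_def)
  have \<kappa>: "0 < \<kappa>" using d s by (simp add: \<kappa>_def)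
  have "(\<integral>\<^sup>+r. ennreal (r powr (- 1 - s / 2)) * indicator {0<..} r * ennreal (heat_kernel r y) \<partial>lborel)
    = (\<integral>\<^sup>+r. ennreal ((4 * pi) powr (- d / 2)) * (ennreal (r powr (- 1 - \<kappa>) * exp (- ((norm y)\<^sup>2 / 4) / r)) * indicator {0<..} r) \<partial>lborel)"
  proof (rule nn_integral_cong)
    fix r :: real
    show "ennreal (r powr (- 1 - s / 2)) * indicator {0<..} r * ennreal (heat_kernel r y)
      = ennreal ((4 * pi) powr (- d / 2)) * (ennreal (r powr (- 1 - \<kappa>) * exp (- ((norm y)\<^sup>2 / 4) / r)) * indicator {0<..} r)"
    proof (cases "0 < r")
      case True
      have "r powr (- 1 - s / 2) * heat_kernel r y
        = (4 * pi) powr (- d / 2) * (r powr (- 1 - \<kappa>) * exp (- ((norm y)\<^sup>2 / 4) / r))"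
      proof -
        have "r powr (- 1 - s / 2) * r powr (- d / 2) = r powr (- 1 - \<kappa>)"
        proof -
          have "- 1 - s / 2 + - d / 2 = - 1 - \<kappa>" by (simp add: \<kappa>_def field_simps)
          then show ?thesis by (simp only: powr_add[symmetric])
        qed
        then show ?thesis
          using True by (simp add: heat_kernel_def d_def[symmetric] powr_mult mult_ac)
      qed
      then show ?thesis using True by (simp add: ennreal_mult[symmetric])
    qed simp
  qed
  also have "\<dots> = ennreal ((4 * pi) powr (- d / 2)) * ennreal (Gamma \<kappa> * ((norm y)\<^sup>2 / 4) powr - \<kappa>)"
    using y \<kappa> by (subst nn_integral_cmult, simp, subst nn_integral_inverse_Gamma) auto
  also have "\<dots> = ennreal ((4 * pi) powr (- d / 2) * (Gamma \<kappa> * ((norm y)\<^sup>2 / 4) powr - \<kappa>))"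
    using Gamma_real_pos[OF \<kappa>] by (subst ennreal_mult) auto
  finally have I: "(\<integral>\<^sup>+r. ennreal (r powr (- 1 - s / 2)) * indicator {0<..} r * ennreal (heat_kernel r y) \<partial>lborel)
    = ennreal ((4 * pi) powr (- d / 2) * (Gamma \<kappa> * ((norm y)\<^sup>2 / 4) powr - \<kappa>))" .
  have G: "0 < Gamma (1 - s / 2)" using s by (intro Gamma_real_pos) auto
  have absG: "\<bar>Gamma (- s / 2)\<bar> = Gamma (1 - s / 2) / (s / 2)"
  proof -
    have "- s / 2 \<notin> \<int>\<^sub>\<le>\<^sub>0"
    proof
      assume "- s / 2 \<in> \<int>\<^sub>\<le>\<^sub>0"
      then obtain n :: nat where n: "- s / 2 = - real n" by (auto elim!: nonpos_Ints_cases')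
      then have "0 < real n" "real n < 1" using s by auto
      then show False by simp
    qed
    then have "Gamma (- s / 2 + 1) = (- s / 2) * Gamma (- s / 2)" by (rule Gamma_plus1)
    then have "Gamma (- s / 2) = - (Gamma (1 - s / 2) / (s / 2))" using s by (simp add: field_simps)
    then show ?thesis using G s by simp
  qed
  have e1: "((norm y)\<^sup>2 / 4) powr - \<kappa> = norm y powr (- d - s) * 4 powr \<kappa>"
  proof -
    have "((norm y)\<^sup>2) powr - \<kappa> = (norm y powr 2) powr - \<kappa>" using y by simp
    moreover have "2 * - \<kappa> = - d - s" by (simp add: \<kappa>_def field_simps)
    ultimately have "((norm y)\<^sup>2) powr - \<kappa> = norm y powr (- d - s)" by (simp only: powr_powr)
    moreover have "((norm y)\<^sup>2 / 4) powr - \<kappa> = ((norm y)\<^sup>2) powr - \<kappa> * 4 powr \<kappa>"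
      by (simp add: powr_divide powr_minus_divide)
    ultimately show ?thesis by simp
  qed
  have e2: "(4 * pi) powr (- d / 2) * 4 powr \<kappa> = 2 powr s / pi powr (d / 2)"
  proof -
    have "- d / 2 + \<kappa> = s / 2" by (simp add: \<kappa>_def field_simps)
    then have "4 powr (- d / 2) * 4 powr \<kappa> = (4::real) powr (s / 2)" by (simp only: powr_add[symmetric])
    also have "(4::real) powr (s / 2) = (2 powr 2) powr (s / 2)" by simp
    also have "\<dots> = 2 powr s" unfolding powr_powr by simp
    finally have "4 powr (- d / 2) * 4 powr \<kappa> = (2::real) powr s" .
    moreover have "(4 * pi) powr (- d / 2) = 4 powr (- d / 2) * (1 / pi powr (d / 2))"
      by (simp add: powr_mult powr_minus_divide)
    ultimately show ?thesis by simp
  qed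
  have "(4 * pi) powr (- d / 2) * (Gamma \<kappa> * (norm y powr (- d - s) * 4 powr \<kappa>))
      = ((4 * pi) powr (- d / 2) * 4 powr \<kappa>) * Gamma \<kappa> * norm y powr (- d - s)"
    by (simp only: mult_ac)
  then have e3: "(4 * pi) powr (- d / 2) * (Gamma \<kappa> * ((norm y)\<^sup>2 / 4) powr - \<kappa>)
      = 2 powr s / pi powr (d / 2) * Gamma \<kappa> * norm y powr (- d - s)"
    by (simp only: e1 e2)
  have "s / 2 / Gamma (1 - s / 2) * ((4 * pi) powr (- d / 2) * (Gamma \<kappa> * ((norm y)\<^sup>2 / 4) powr - \<kappa>))
      = stable_const DIM('a) s * norm y powr (- d - s)"
    unfolding e3 stable_const_def absG d_def[symmetric] \<kappa>_def[symmetric] using s G by (simp add: field_simps)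
  then show ?thesis
    unfolding I d_def using s G Gamma_real_pos[OF \<kappa>] by (subst ennreal_mult[symmetric]) auto
qed

text \<open>
  The constant \<open>stable_const\<close> is chosen so that the symbol of the Levy measure is exactly
  \<open>|\<xi>| powr s\<close>. With the subordination formula the integral over \<open>y\<close> is a Gaussian characteristic
  function, and the remaining integral over \<open>r\<close> is \<open>nn_integral_power_mixture\<close>.
\<close>

lemma nn_integral_levy_symbol:
  fixes \<xi> :: "real ^ 'n"
  assumes s: "0 < s" "s < 2"
  shows "(\<integral>\<^sup>+y. ennreal (1 - cos (\<xi> \<bullet> y)) \<partial>stable_levy_measure s) = ennreal (norm \<xi> powr s)"
proof -
  let ?k = "ennreal (s / 2 / Gamma (1 - s / 2))"
  have "(\<integral>\<^sup>+y. ennreal (1 - cos (\<xi> \<bullet> y)) \<partial>stable_levy_measure s)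
    = (\<integral>\<^sup>+y. ennreal (stable_const CARD('n) s * norm y powr (- real CARD('n) - s)) * ennreal (1 - cos (\<xi> \<bullet> y)) \<partial>lborel)"
    unfolding stable_levy_measure_def by (rule nn_integral_density) measurable
  also have "\<dots> = (\<integral>\<^sup>+y. ?k * (\<integral>\<^sup>+r. ennreal (r powr (- 1 - s / 2)) * indicator {0<..} r * ennreal (heat_kernel r y) * ennreal (1 - cos (\<xi> \<bullet> y)) \<partial>lborel) \<partial>lborel)"
  proof (rule nn_integral_cong)
    fix y :: "real ^ 'n"
    show "ennreal (stable_const CARD('n) s * norm y powr (- real CARD('n) - s)) * ennreal (1 - cos (\<xi> \<bullet> y))
      = ?k * (\<integral>\<^sup>+r. ennreal (r powr (- 1 - s / 2)) * indicator {0<..} r * ennreal (heat_kernel r y) * ennreal (1 - cos (\<xi> \<bullet> y)) \<partial>lborel)"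
    proof (cases "y = 0")
      case False
      show ?thesis
        using riesz_kernel_mixture[OF s False] by (subst nn_integral_multc) (simp_all add: mult.assoc)
    qed simp
  qed
  also have "\<dots> = ?k * (\<integral>\<^sup>+y. (\<integral>\<^sup>+r. ennreal (r powr (- 1 - s / 2)) * indicator {0<..} r * ennreal (heat_kernel r y) * ennreal (1 - cos (\<xi> \<bullet> y)) \<partial>lborel) \<partial>lborel)"
    by (rule nn_integral_cmult) measurable
  also have "(\<integral>\<^sup>+y. (\<integral>\<^sup>+r. ennreal (r powr (- 1 - s / 2)) * indicator {0<..} r * ennreal (heat_kernel r y) * ennreal (1 - cos (\<xi> \<bullet> y)) \<partial>lborel) \<partial>lborel)
     = (\<integral>\<^sup>+r. (\<integral>\<^sup>+y. ennreal (r powr (- 1 - s / 2)) * indicator {0<..} r * ennreal (heat_kernel r y) * ennreal (1 - cos (\<xi> \<bullet> y)) \<partial>lborel) \<partial>lborel)"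
    by (rule lborel_pair.Fubini') measurable
  also have "\<dots> = (\<integral>\<^sup>+r. ennreal (r powr (- 1 - s / 2) * (1 - exp (- r * (norm \<xi>)\<^sup>2))) * indicator {0<..} r \<partial>lborel)"
  proof (rule nn_integral_cong)
    fix r :: real
    show "(\<integral>\<^sup>+y. ennreal (r powr (- 1 - s / 2)) * indicator {0<..} r * ennreal (heat_kernel r y) * ennreal (1 - cos (\<xi> \<bullet> y)) \<partial>lborel)
      = ennreal (r powr (- 1 - s / 2) * (1 - exp (- r * (norm \<xi>)\<^sup>2))) * indicator {0<..} r"
    proof (cases "0 < r")
      case True
      have "(\<integral>\<^sup>+y. ennreal (r powr (- 1 - s / 2)) * indicator {0<..} r * ennreal (heat_kernel r y) * ennreal (1 - cos (\<xi> \<bullet> y)) \<partial>lborel)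
        = ennreal (r powr (- 1 - s / 2)) * (\<integral>\<^sup>+y. ennreal (1 - cos (\<xi> \<bullet> y)) \<partial>heat_measure r)"
        using True by (simp add: nn_integral_heat_measure nn_integral_cmult mult.assoc)
      also have "\<dots> = ennreal (r powr (- 1 - s / 2)) * ennreal (1 - exp (- r * (norm \<xi>)\<^sup>2))"
        using True by (subst nn_integral_one_minus_cos) (auto simp: prob_space_heat_measure integral_cos_heat_measure)
      finally show ?thesis using True by (simp add: ennreal_mult)
    qed simp
  qed
  also have "\<dots> = ennreal (Gamma (1 - s / 2) / (s / 2) * ((norm \<xi>)\<^sup>2) powr (s / 2))"
    using s by (intro nn_integral_power_mixture) auto
  also have "?k * \<dots> = ennreal (norm \<xi> powr s)"
  proof -
    have G: "0 < Gamma (1 - s / 2)" using s by (intro Gamma_real_pos) auto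
    have "((norm \<xi>)\<^sup>2) powr (s / 2) = norm \<xi> powr s"
      by (cases "\<xi> = 0") (simp_all add: powr_powr flip: powr_numeral)
    moreover have "ennreal (s / 2 / g) * ennreal (g / (s / 2) * x) = ennreal x" if "0 < g" "0 \<le> x" for g x
      using that s by (subst ennreal_mult[symmetric]) auto
    ultimately show ?thesis using G by simp
  qed
  finally show ?thesis .
qed

lemma levy_perimeter_spectral:
  fixes \<Omega> :: "(real ^ 'n) set"
  assumes fin: "finite_volume_open \<Omega>" and s: "0 < s" "s < 2"
  shows "nonlocal_perimeter (stable_levy_measure s) \<Omega> = (\<integral>\<^sup>+\<xi>. ennreal (norm \<xi> powr s) \<partial>spectral_measure \<Omega>)"
proof -
  have "sigma_finite_measure (stable_levy_measure s :: (real ^ 'n) measure)"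
    unfolding stable_levy_measure_def by (subst sigma_finite_measure.sigma_finite_iff_density_finite[OF sigma_finite_lborel]) auto
  moreover have "sets (stable_levy_measure s :: (real ^ 'n) measure) = sets borel"
    by (simp add: stable_levy_measure_def)
  ultimately show ?thesis
    by (subst nonlocal_perimeter_spectral[OF fin]) (simp_all add: nn_integral_levy_symbol[OF s])
qed

section \<open>Taylor remainders of the exponential\<close>

text \<open>
  The integrand that is left after subtracting the fractional perimeters, with the sign that makes
  it nonnegative for \<open>v \<ge> 0\<close>. By the next lemma it is, up to sign, the remainder of \<open>exp (- v)\<close>
  after its Taylor polynomial of degree \<open>N - 1\<close>.
\<close>

definition exp_remainder :: "nat \<Rightarrow> real \<Rightarrow> real" where
  "exp_remainder N v = (- 1) ^ (N - 1) * (1 - exp (- v) - (\<Sum>n = 1..N - 1. (- 1) ^ (n - 1) / fact n * v ^ n))"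

lemma exp_remainder_eq:
  assumes "1 \<le> N"
  shows "exp_remainder N v = (- 1) ^ N * (exp (- v) - (\<Sum>m<N. (- v) ^ m / fact m))"
proof -
  have "(\<Sum>m<N. (- v) ^ m / fact m) = 1 - (\<Sum>n = 1..N - 1. (- 1) ^ (n - 1) / fact n * v ^ n)"
    using assms
  proof (induction N rule: dec_induct)
    case base
    then show ?case by simp
  next
    case (step k)
    then obtain j where j: "k = Suc j" by (cases k) auto
    have "(- v) ^ k = - ((- 1) ^ (k - 1) * v ^ k)"
      unfolding j by (simp add: power_minus[of v])
    then show ?case using step.IH unfolding j by simp
  qed
  then have S: "(\<Sum>n = 1..N - 1. (- 1) ^ (n - 1) / fact n * v ^ n) = 1 - (\<Sum>m<N. (- v) ^ m / fact m)"
    by simp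
  show ?thesis
    unfolding exp_remainder_def S using assms by (cases N) (simp_all add: algebra_simps del: sum.lessThan_Suc)
qed

lemma exp_remainder_small:
  assumes N: "1 \<le> N" and v: "0 \<le> v" "v \<le> 1"
  shows "\<bar>exp_remainder N v - v ^ N / fact N\<bar> \<le> 3 * v ^ (N + 1)"
proof -
  obtain t where t: "\<bar>t\<bar> \<le> \<bar>- v\<bar>" "exp (- v) = (\<Sum>m<Suc N. (- v) ^ m / fact m) + exp t / fact (Suc N) * (- v) ^ (Suc N)"
    using Maclaurin_exp_le[of "- v" "Suc N"] by auto
  have sq: "(- 1) ^ N * (- v) ^ N = v ^ N"
    by (simp add: power_mult_distrib[symmetric])
  have "exp_remainder N v = (- 1) ^ N * ((- v) ^ N / fact N + exp t / fact (Suc N) * (- v) ^ (Suc N))"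
    using t(2) by (simp add: exp_remainder_eq[OF N])
  then have "exp_remainder N v - v ^ N / fact N = (- 1) ^ N * (exp t / fact (Suc N) * (- v) ^ (Suc N))"
    using sq by (simp add: algebra_simps)
  then have "\<bar>exp_remainder N v - v ^ N / fact N\<bar> = exp t / fact (Suc N) * v ^ (Suc N)"
    using v by (simp add: abs_mult power_abs)
  also have "\<dots> \<le> 3 / 1 * v ^ (Suc N)"
  proof (intro mult_right_mono frac_le)
    have "exp t \<le> exp 1" using t(1) v by simp
    then show "exp t \<le> 3" using exp_le by linarith
    show "(1::real) \<le> fact (Suc N)" by (rule fact_ge_1)
  qed (use v in auto)
  finally show ?thesis by simp
qed

text \<open>
  For large arguments the remainder is dominated by the highest power that was subtracted.
\<close>

lemma exp_remainder_large:
  assumes N: "1 \<le> N" and v: "1 \<le> v"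
  shows "\<bar>exp_remainder N v\<bar> \<le> (real N + 1) * v ^ (N - 1)"
proof -
  have "\<bar>exp_remainder N v\<bar> = \<bar>exp (- v) - (\<Sum>m<N. (- v) ^ m / fact m)\<bar>"
    by (simp add: exp_remainder_eq[OF N] abs_mult power_abs)
  also have "\<dots> \<le> \<bar>exp (- v)\<bar> + (\<Sum>m<N. \<bar>(- v) ^ m / fact m\<bar>)"
    by (rule order_trans[OF abs_triangle_ineq4]) (intro add_mono sum_abs order_refl)
  also have "\<dots> \<le> v ^ (N - 1) + (\<Sum>m<N. v ^ (N - 1))"
  proof (intro add_mono sum_mono)
    show "\<bar>exp (- v)\<bar> \<le> v ^ (N - 1)"
      using v by (intro order_trans[OF _ one_le_power[OF v]]) auto
    fix m assume "m \<in> {..<N}"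
    then have "v ^ m \<le> v ^ (N - 1)" using v by (intro power_increasing) auto
    moreover have "\<bar>(- v) ^ m / fact m\<bar> \<le> v ^ m"
      using v by (simp add: abs_mult power_abs divide_le_eq mult_le_cancel_left1 fact_ge_1)
    ultimately show "\<bar>(- v) ^ m / fact m\<bar> \<le> v ^ (N - 1)" by simp
  qed
  finally show ?thesis by (simp add: algebra_simps)
qed

text \<open>
  The case of exponent \<open>1 / 2\<close> of \<open>nn_integral_power_mixture\<close> with the mixture restricted to
  \<open>{T..1}\<close>. What is lost below \<open>T\<close> is at most of order \<open>l sqrt T\<close>, since \<open>1 - exp (- r l) \<le> r l\<close>,
  and above \<open>1\<close> it is at most \<open>2\<close>.
\<close>

lemma sqrt_mixture_truncated:
  fixes l T :: real
  assumes l: "0 \<le> l" and T: "0 < T" "T \<le> 1"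
  defines "W \<equiv> LINT r:{T..1}|lborel. r powr (- 3 / 2) * (1 - exp (- r * l))"
  shows "0 \<le> W" "W \<le> 2 / sqrt T" "\<bar>2 * sqrt pi * sqrt l - W\<bar> \<le> 3 * sqrt pi * l * sqrt T + 2"
proof -
  define f where "f r = ennreal (r powr (- 3 / 2) * (1 - exp (- r * l)))" for r
  have [measurable]: "f \<in> borel_measurable borel" unfolding f_def by measurable
  have cont: "continuous_on {T..1} (\<lambda>r. r powr (- 3 / 2) * (1 - exp (- r * l)))"
    using T by (intro continuous_intros) auto
  have nn: "0 \<le> r powr (- 3 / 2) * (1 - exp (- r * l))" if "0 \<le> r" for r
    using that l by simp
  show W0: "0 \<le> W"
    unfolding W_def set_lebesgue_integral_def using T nn by (intro integral_nonneg_AE) (auto simp: indicator_def)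
  have W: "ennreal W = (\<integral>\<^sup>+r. f r * indicator {T..1} r \<partial>lborel)"
  proof -
    have "set_integrable lborel {T..1} (\<lambda>r. r powr (- 3 / 2) * (1 - exp (- r * l)))"
      by (rule borel_integrable_atLeastAtMost'[OF cont])
    then have "(\<integral>\<^sup>+r. ennreal (indicator {T..1} r *\<^sub>R (r powr (- 3 / 2) * (1 - exp (- r * l)))) \<partial>lborel) = ennreal W"
      unfolding W_def set_lebesgue_integral_def set_integrable_def
      using T nn by (intro nn_integral_eq_integral) (auto simp: indicator_def)
    then show ?thesis
      by (simp add: f_def ennreal_mult'[symmetric] ennreal_indicator[symmetric] mult.commute)
  qed
  have full: "(\<integral>\<^sup>+r. f r * indicator {0<..} r \<partial>lborel) = ennreal (2 * sqrt pi * sqrt l)"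
    using nn_integral_power_mixture[OF l, of "1/2"] l by (simp add: f_def Gamma_one_half_real powr_half_sqrt)
  have tail: "(\<integral>\<^sup>+r. f r * indicator {a..} r \<partial>lborel) \<le> ennreal (2 / sqrt a)" if a: "0 < a" for a
  proof -
    have "(\<integral>\<^sup>+r. f r * indicator {a..} r \<partial>lborel) \<le> (\<integral>\<^sup>+r. ennreal (r powr (- 1 - 1 / 2)) * indicator {a..} r \<partial>lborel)"
      unfolding f_def using a l by (intro nn_integral_mono) (auto simp: indicator_def intro!: ennreal_leI mult_left_le)
    also have "\<dots> = ennreal (2 / sqrt a)"
      using a by (subst nn_integral_powr_tail) (auto simp: powr_minus_divide powr_half_sqrt)
    finally show ?thesis .
  qed
  have "ennreal W \<le> (\<integral>\<^sup>+r. f r * indicator {T..} r \<partial>lborel)"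
    unfolding W by (intro nn_integral_mono) (auto simp: indicator_def)
  also have "\<dots> \<le> ennreal (2 / sqrt T)" by (rule tail[OF T(1)])
  finally show "W \<le> 2 / sqrt T" using T by (simp add: ennreal_le_iff)
  \<comment> \<open>Below \<open>T\<close> the factor \<open>3 exp (- r / T)\<close> is at least \<open>1\<close>; inserting it turns the bound into a Gamma integral.\<close>
  have head: "(\<integral>\<^sup>+r. f r * indicator {0<..<T} r \<partial>lborel) \<le> ennreal (3 * sqrt pi * l * sqrt T)"
  proof -
    have "(\<integral>\<^sup>+r. f r * indicator {0<..<T} r \<partial>lborel)
      \<le> (\<integral>\<^sup>+r. ennreal (3 * l) * (ennreal (r powr (1 / 2 - 1) * exp (- (1 / T) * r)) * indicator {0<..} r) \<partial>lborel)"
    proof (intro nn_integral_mono)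
      fix r :: real
      show "f r * indicator {0<..<T} r \<le> ennreal (3 * l) * (ennreal (r powr (1 / 2 - 1) * exp (- (1 / T) * r)) * indicator {0<..} r)"
      proof (cases "0 < r \<and> r < T")
        case True
        have "1 - exp (- r * l) \<le> r * l" using exp_ge_add_one_self[of "- r * l"] by simp
        then have "r powr (- 3 / 2) * (1 - exp (- r * l)) \<le> r powr (- 3 / 2) * (r * l)"
          by (intro mult_left_mono) auto
        also have "\<dots> = l * r powr (1 / 2 - 1)"
        proof -
          have "r powr (- 3 / 2) * r powr 1 = r powr (- 3 / 2 + 1)" by (simp only: powr_add)
          then show ?thesis using True by simp
        qed
        also have "\<dots> \<le> l * r powr (1 / 2 - 1) * (3 * exp (- (1 / T) * r))"
        proof -
          have "exp 1 * exp (- (1 / T) * r) \<ge> 1"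
            using True T by (simp add: exp_add[symmetric] divide_simps)
          moreover have "exp 1 * exp (- (1 / T) * r) \<le> 3 * exp (- (1 / T) * r)"
            by (intro mult_right_mono exp_le) auto
          ultimately have "3 * exp (- (1 / T) * r) \<ge> 1" by (rule order_trans)
          then show ?thesis
            using l mult_left_mono[of 1 "3 * exp (- (1 / T) * r)" "l * r powr (1 / 2 - 1)"] by simp
        qed
        finally have "r powr (- 3 / 2) * (1 - exp (- r * l)) \<le> 3 * l * (r powr (1 / 2 - 1) * exp (- (1 / T) * r))"
          by (simp only: mult_ac)
        then have "f r \<le> ennreal (3 * l * (r powr (1 / 2 - 1) * exp (- (1 / T) * r)))"
          unfolding f_def by (rule ennreal_leI)
        also have "\<dots> = ennreal (3 * l) * ennreal (r powr (1 / 2 - 1) * exp (- (1 / T) * r))"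
          using l by (intro ennreal_mult) auto
        finally show ?thesis using True by simp
      qed (auto simp: indicator_def)
    qed
    also have "\<dots> = ennreal (3 * l) * ennreal (Gamma (1 / 2) * (1 / T) powr - (1 / 2))"
      using T by (subst nn_integral_cmult, simp, subst nn_integral_Gamma_scaled) auto
    also have "\<dots> = ennreal (3 * sqrt pi * l * sqrt T)"
    proof -
      have "(1 / T) powr - (1 / 2) = sqrt T"
        using T by (simp add: powr_divide powr_minus_divide powr_half_sqrt)
      then show ?thesis
        using T l by (subst ennreal_mult[symmetric]) (auto simp: Gamma_one_half_real mult_ac)
    qed
    finally show ?thesis .
  qed
  have up: "W \<le> 2 * sqrt pi * sqrt l"
  proof -
    have "ennreal W \<le> (\<integral>\<^sup>+r. f r * indicator {0<..} r \<partial>lborel)"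
      unfolding W using T by (intro nn_integral_mono) (auto simp: indicator_def)
    then show ?thesis using l unfolding full by (simp add: ennreal_le_iff)
  qed
  have "ennreal (2 * sqrt pi * sqrt l) \<le> (\<integral>\<^sup>+r. f r * indicator {0<..<T} r + (f r * indicator {T..1} r + f r * indicator {1..} r) \<partial>lborel)"
    unfolding full[symmetric] by (intro nn_integral_mono) (auto simp: indicator_def)
  also have "\<dots> = (\<integral>\<^sup>+r. f r * indicator {0<..<T} r \<partial>lborel) + (ennreal W + (\<integral>\<^sup>+r. f r * indicator {1..} r \<partial>lborel))"
    unfolding W by (subst nn_integral_add, simp, simp, subst nn_integral_add) auto
  also have "\<dots> \<le> ennreal (3 * sqrt pi * l * sqrt T) + (ennreal W + ennreal (2 / sqrt 1))"
    by (intro add_mono head tail order_refl) auto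
  also have "\<dots> = ennreal (3 * sqrt pi * l * sqrt T + (W + 2))"
  proof -
    have "0 \<le> 3 * sqrt pi * l * sqrt T" using l T by simp
    then show ?thesis using W0 by simp
  qed
  finally have "2 * sqrt pi * sqrt l \<le> 3 * sqrt pi * l * sqrt T + (W + 2)"
    using l T W0 by (subst (asm) ennreal_le_iff) auto
  then show "\<bar>2 * sqrt pi * sqrt l - W\<bar> \<le> 3 * sqrt pi * l * sqrt T + 2"
    using up l T by simp
qed

text \<open>
  Behaves like a power with exponent larger than \<open>1 / 2\<close> at the origin and smaller than \<open>1 / 2\<close> at
  infinity. Both errors of the approximation below have this size, and the margin on each side of
  \<open>1 / 2\<close> makes its integrals scale like \<open>sqrt T\<close> with no logarithm.
\<close>

definition growth_majorant :: "real \<Rightarrow> real \<Rightarrow> real" where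
  "growth_majorant \<alpha> w = min (w powr ((1 + \<alpha>) / 2)) (w powr ((1 - \<alpha>) / 2))"

lemma growth_majorant_nonneg: "0 \<le> growth_majorant \<alpha> w"
  by (simp add: growth_majorant_def)

lemma growth_majorant_measurable [measurable]: "growth_majorant \<alpha> \<in> borel_measurable borel"
  unfolding growth_majorant_def[abs_def] by measurable

lemma growth_majorant_le_1: "0 < \<alpha> \<Longrightarrow> 0 \<le> w \<Longrightarrow> w \<le> 1 \<Longrightarrow> growth_majorant \<alpha> w = w powr ((1 + \<alpha>) / 2)"
  unfolding growth_majorant_def by (intro min_absorb1 powr_mono') auto

lemma growth_majorant_ge_1: "0 < \<alpha> \<Longrightarrow> 1 \<le> w \<Longrightarrow> growth_majorant \<alpha> w = w powr ((1 - \<alpha>) / 2)"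
  unfolding growth_majorant_def by (intro min_absorb2 powr_mono) auto

text \<open>
  With \<open>w = T l\<close> the argument of the remainder is \<open>v = w powr (\<alpha> / 2)\<close>, and \<open>v ^ N = sqrt w\<close>
  because \<open>\<alpha> N = 1\<close>. For \<open>w \<le> 1\<close> the remainder is \<open>sqrt w / N!\<close> up to \<open>v ^ (N + 1)\<close>, and
  \<open>sqrt w = sqrt T sqrt l\<close> is the truncated mixture up to the errors of \<open>sqrt_mixture_truncated\<close>.
  For \<open>w \<ge> 1\<close> both terms are separately of order \<open>v ^ (N - 1)\<close>. The factor \<open>N + 7\<close> is a crude
  common bound for the constants of both cases.
\<close>

lemma exp_remainder_approx:
  fixes \<alpha> l T :: real
  assumes \<alpha>: "0 < \<alpha>" "\<alpha> < 1" and N: "1 / \<alpha> = real N" and l: "0 \<le> l" and T: "0 < T" "T \<le> 1"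
  defines "W \<equiv> LINT r:{T..1}|lborel. r powr (- 3 / 2) * (1 - exp (- r * l))"
  shows "\<bar>exp_remainder N ((T * l) powr (\<alpha> / 2)) - sqrt T / (fact N * (2 * sqrt pi)) * W\<bar>
    \<le> sqrt T + (real N + 7) * growth_majorant \<alpha> (T * l)"
proof -
  define w where "w = T * l"
  define v where "v = w powr (\<alpha> / 2)"
  define c where "c = fact N * (2 * sqrt pi)"
  have w: "0 \<le> w" using T l by (simp add: w_def)
  have N1: "1 \<le> N"
  proof (rule ccontr)
    assume "\<not> 1 \<le> N" then have "N = 0" by simp
    then show False using N \<alpha> by simp
  qed
  have \<alpha>N: "\<alpha> * real N = 1" using N \<alpha> by (simp add: field_simps)
  have fact1: "(1::real) \<le> fact N" by (rule fact_ge_1)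
  have sqpi: "1 \<le> sqrt pi" using pi_gt3 by simp
  have c: "2 \<le> c" "2 * sqrt pi \<le> c"
  proof -
    have "1 * (2 * sqrt pi) \<le> fact N * (2 * sqrt pi)" using fact1 sqpi by (intro mult_right_mono) auto
    then show "2 * sqrt pi \<le> c" by (simp add: c_def)
    then show "2 \<le> c" using sqpi by linarith
  qed
  note trunc = sqrt_mixture_truncated[OF l T, folded W_def]
  show ?thesis
  proof (cases "w \<le> 1")
    case True
    have m: "growth_majorant \<alpha> w = w powr ((1 + \<alpha>) / 2)" using \<alpha> w True by (intro growth_majorant_le_1) auto
    have v01: "0 \<le> v" "v \<le> 1" using w True \<alpha> by (auto simp: v_def intro!: powr_le1)
    have vN: "v ^ N = sqrt w"
    proof -
      have "v ^ N = w powr (\<alpha> / 2 * real N)"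
        using N1 by (cases "w = 0") (auto simp: v_def powr_power mult.commute power_0_left)
      also have "\<alpha> / 2 * real N = 1 / 2" using \<alpha>N by simp
      finally show ?thesis using w by (simp add: powr_half_sqrt)
    qed
    have vN1: "v ^ (N + 1) = w powr ((1 + \<alpha>) / 2)"
    proof -
      have "v ^ (N + 1) = sqrt w * w powr (\<alpha> / 2)" by (simp add: vN) (simp add: v_def)
      also have "\<dots> = w powr (1 / 2 + \<alpha> / 2)" using w by (simp add: powr_add powr_half_sqrt)
      finally show ?thesis by (simp add: add_divide_distrib)
    qed
    have 1: "\<bar>exp_remainder N v - sqrt w / fact N\<bar> \<le> 3 * w powr ((1 + \<alpha>) / 2)"
      using exp_remainder_small[OF N1 v01] unfolding vN vN1 .
    have 2: "\<bar>sqrt w / fact N - sqrt T / c * W\<bar> \<le> 3 / 2 * w + sqrt T"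
    proof -
      have "sqrt w / fact N - sqrt T / c * W = sqrt T / c * (2 * sqrt pi * sqrt l - W)"
        using T by (simp add: c_def w_def real_sqrt_mult field_simps)
      then have "\<bar>sqrt w / fact N - sqrt T / c * W\<bar> = sqrt T / c * \<bar>2 * sqrt pi * sqrt l - W\<bar>"
        using T c by (simp add: abs_mult)
      also have "\<dots> \<le> sqrt T / c * (3 * sqrt pi * l * sqrt T + 2)"
        using T c trunc(3) by (intro mult_left_mono) auto
      also have "\<dots> = 3 / 2 * ((2 * sqrt pi / c) * w) + (2 / c) * sqrt T"
        using T c by (simp add: w_def field_simps)
      also have "\<dots> \<le> 3 / 2 * (1 * w) + 1 * sqrt T"
        using c w T by (intro add_mono mult_left_mono mult_right_mono) (auto simp: divide_le_eq)
      finally show ?thesis by simp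
    qed
    have 3: "w \<le> w powr ((1 + \<alpha>) / 2)"
    proof -
      have "w powr 1 \<le> w powr ((1 + \<alpha>) / 2)" using w True \<alpha> by (intro powr_mono') auto
      then show ?thesis using w by simp
    qed
    have "\<bar>exp_remainder N v - sqrt T / c * W\<bar> \<le> 3 * w powr ((1 + \<alpha>) / 2) + (3 / 2 * w + sqrt T)"
      using 1 2 by linarith
    moreover have "0 \<le> real N * w powr ((1 + \<alpha>) / 2)" "0 \<le> w powr ((1 + \<alpha>) / 2)" by simp_all
    ultimately have "\<bar>exp_remainder N v - sqrt T / c * W\<bar> \<le> sqrt T + (real N + 7) * w powr ((1 + \<alpha>) / 2)"
      using 3 unfolding distrib_right by linarith
    then show ?thesis
      unfolding w_def[symmetric] v_def[symmetric] c_def[symmetric] m .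
  next
    case False
    then have w1: "1 \<le> w" by simp
    have m: "growth_majorant \<alpha> w = w powr ((1 - \<alpha>) / 2)" using \<alpha> w1 by (intro growth_majorant_ge_1) auto
    have v1: "1 \<le> v" using w1 \<alpha> by (simp add: v_def ge_one_powr_ge_zero)
    have vN1: "v ^ (N - 1) = w powr ((1 - \<alpha>) / 2)"
    proof -
      have "v ^ (N - 1) = w powr (\<alpha> / 2 * real (N - 1))"
        using w1 by (simp add: v_def powr_power mult.commute)
      also have "\<alpha> / 2 * real (N - 1) = (1 - \<alpha>) / 2" using \<alpha>N N1 by (simp add: of_nat_diff algebra_simps)
      finally show ?thesis .
    qed
    have 1: "\<bar>exp_remainder N v\<bar> \<le> (real N + 1) * w powr ((1 - \<alpha>) / 2)"
      using exp_remainder_large[OF N1 v1] unfolding vN1 .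
    have 2: "\<bar>sqrt T / c * W\<bar> \<le> 1"
    proof -
      have "\<bar>sqrt T / c * W\<bar> = sqrt T / c * W" using T c trunc(1) by simp
      also have "\<dots> \<le> sqrt T / c * (2 / sqrt T)" using T c trunc(2) by (intro mult_left_mono) auto
      also have "\<dots> \<le> 1" using T c by simp
      finally show ?thesis .
    qed
    have 3: "1 \<le> w powr ((1 - \<alpha>) / 2)" using w1 \<alpha> by (simp add: ge_one_powr_ge_zero)
    have "\<bar>exp_remainder N v - sqrt T / c * W\<bar> \<le> (real N + 1) * w powr ((1 - \<alpha>) / 2) + 1"
      using 1 2 by linarith
    moreover have "0 \<le> sqrt T" using T by simp
    ultimately have "\<bar>exp_remainder N v - sqrt T / c * W\<bar> \<le> sqrt T + (real N + 7) * w powr ((1 - \<alpha>) / 2)"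
      using 3 unfolding distrib_right by linarith
    then show ?thesis
      unfolding w_def[symmetric] v_def[symmetric] c_def[symmetric] m .
  qed
qed

text \<open>
  Dominating the majorant by a mixture of \<open>1 - exp (- r w)\<close> makes its integral accessible through
  the bound on the integrals of \<open>1 - exp (- r l)\<close>.
\<close>

lemma growth_majorant_mixture:
  fixes \<alpha> w :: real
  assumes \<alpha>: "0 < \<alpha>" "\<alpha> < 1" and w: "0 \<le> w"
  shows "ennreal ((1 - exp (- 1)) / 4 * growth_majorant \<alpha> w)
    \<le> (\<integral>\<^sup>+r. ennreal (min (r powr (- 1 - (1 + \<alpha>) / 2)) (r powr (- 1 - (1 - \<alpha>) / 2)) * (1 - exp (- r * w))) * indicator {0<..} r \<partial>lborel)"
proof (cases "w = 0")
  case False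
  then have w: "0 < w" using w by simp
  let ?k = "\<lambda>r. min (r powr (- 1 - (1 + \<alpha>) / 2)) (r powr (- 1 - (1 - \<alpha>) / 2)) :: real"
  \<comment> \<open>On \<open>{1 / w..2 / w}\<close> the kernel is at least its value at the right end, and \<open>1 - exp (- r w)\<close> is at least \<open>1 - exp (- 1)\<close>.\<close>
  have k2: "?k (2 / w) \<ge> w / 4 * growth_majorant \<alpha> w"
  proof -
    have "w / 4 * w powr \<beta> \<le> (2 / w) powr (- 1 - \<beta>)" if \<beta>: "0 < \<beta>" "\<beta> < 1" for \<beta>
    proof -
      have "(2 / w) powr (- 1 - \<beta>) = (w / 2) powr (1 + \<beta>)"
        using w by (simp add: powr_divide powr_diff powr_minus powr_add field_simps)
      also have "\<dots> = w powr (1 + \<beta>) / 2 powr (1 + \<beta>)" using w by (simp add: powr_divide)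
      also have "\<dots> \<ge> w powr (1 + \<beta>) / 2 powr 2"
        using w \<beta> by (intro divide_left_mono powr_mono mult_pos_pos) auto
      finally show ?thesis using w by (simp add: powr_add)
    qed
    then have "w / 4 * w powr ((1 + \<alpha>) / 2) \<le> (2 / w) powr (- 1 - (1 + \<alpha>) / 2)"
      "w / 4 * w powr ((1 - \<alpha>) / 2) \<le> (2 / w) powr (- 1 - (1 - \<alpha>) / 2)"
      using \<alpha> by simp_all
    moreover have "w / 4 * growth_majorant \<alpha> w \<le> w / 4 * w powr ((1 + \<alpha>) / 2)"
      "w / 4 * growth_majorant \<alpha> w \<le> w / 4 * w powr ((1 - \<alpha>) / 2)"
      using w by (auto simp: growth_majorant_def intro!: mult_left_mono)
    ultimately show ?thesis by linarith
  qed
  have "(1 - exp (- 1)) / 4 * growth_majorant \<alpha> w \<le> ?k (2 / w) * (1 - exp (- 1)) * (1 / w)"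
  proof -
    have "(w / 4 * m) * (q / w) = q / 4 * m" "K * (q / w) = K * q * (1 / w)" for m q K :: real
      using w by simp_all
    then show ?thesis
      using mult_right_mono[OF k2, of "(1 - exp (- 1)) / w"] w by (simp add: mult.commute)
  qed
  then have "ennreal ((1 - exp (- 1)) / 4 * growth_majorant \<alpha> w) \<le> ennreal (?k (2 / w) * (1 - exp (- 1)) * (1 / w))"
    by (rule ennreal_leI)
  also have "\<dots> = (\<integral>\<^sup>+r. ennreal (?k (2 / w) * (1 - exp (- 1))) * indicator {1 / w..2 / w} r \<partial>lborel)"
  proof -
    have "2 / w - 1 / w = 1 / w" "1 / w \<le> 2 / w" using w by (simp_all add: field_simps)
    then have "emeasure lborel {1 / w..2 / w} = ennreal (1 / w)" by simp
    then have e: "(\<integral>\<^sup>+r. ennreal K * indicator {1 / w..2 / w} r \<partial>lborel) = ennreal (K * (1 / w))" if "0 \<le> K" for K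
      using that w by (subst nn_integral_cmult_indicator, simp) (simp only: ennreal_mult zero_le_divide_1_iff less_imp_le)
    show ?thesis by (rule e[symmetric]) auto
  qed
  also have "\<dots> \<le> (\<integral>\<^sup>+r. ennreal (?k r * (1 - exp (- r * w))) * indicator {0<..} r \<partial>lborel)"
  proof (rule nn_integral_mono)
    fix r :: real
    show "ennreal (?k (2 / w) * (1 - exp (- 1))) * indicator {1 / w..2 / w} r \<le> ennreal (?k r * (1 - exp (- r * w))) * indicator {0<..} r"
    proof (cases "r \<in> {1 / w..2 / w}")
      case True
      then have r: "0 < r" "1 \<le> r * w" using w by (auto simp: divide_le_eq intro: less_le_trans[of 0 "1 / w"])
      have "?k (2 / w) \<le> ?k r"
        using True r \<alpha> by (intro min.mono powr_mono2') auto
      then have "?k (2 / w) * (1 - exp (- 1)) \<le> ?k r * (1 - exp (- r * w))"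
        using r by (intro mult_mono) auto
      then show ?thesis using True r by (simp add: ennreal_leI)
    qed simp
  qed
  finally show ?thesis .
qed (simp add: growth_majorant_def)

text \<open>
  On \<open>{0<..1}\<close> the integrand is at most a power with exponent larger than \<open>- 1\<close>; it is compared
  with a Gamma integral, using \<open>1 \<le> 3 exp (- r)\<close> there. On \<open>{1..}\<close> it is at most a power with
  exponent smaller than \<open>- 1\<close>.
\<close>

lemma growth_kernel_finite:
  fixes \<alpha> :: real
  assumes \<alpha>: "0 < \<alpha>" "\<alpha> < 1"
  shows "(\<integral>\<^sup>+r. ennreal (min (r powr (- 1 - (1 + \<alpha>) / 2)) (r powr (- 1 - (1 - \<alpha>) / 2)) * sqrt r) * indicator {0<..} r \<partial>lborel) < \<infinity>"
proof -
  let ?k = "\<lambda>r. min (r powr (- 1 - (1 + \<alpha>) / 2)) (r powr (- 1 - (1 - \<alpha>) / 2)) :: real"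
  have pw: "r powr (- 1 - \<beta>) * sqrt r = r powr (- 1 - (\<beta> - 1 / 2))" if "0 < r" for r \<beta> :: real
    using that by (simp add: powr_half_sqrt[symmetric] powr_add[symmetric])
  have "(\<integral>\<^sup>+r. ennreal (?k r * sqrt r) * indicator {0<..} r \<partial>lborel)
    \<le> (\<integral>\<^sup>+r. ennreal 3 * (ennreal (r powr (\<alpha> / 2 - 1) * exp (- 1 * r)) * indicator {0<..} r)
        + ennreal (r powr (- 1 - \<alpha> / 2)) * indicator {1..} r \<partial>lborel)"
  proof (rule nn_integral_mono)
    fix r :: real
    show "ennreal (?k r * sqrt r) * indicator {0<..} r \<le> ennreal 3 * (ennreal (r powr (\<alpha> / 2 - 1) * exp (- 1 * r)) * indicator {0<..} r)
        + ennreal (r powr (- 1 - \<alpha> / 2)) * indicator {1..} r"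
    proof (cases "0 < r")
      case r: True
      show ?thesis
      proof (cases "1 \<le> r")
        case True
        have "?k r * sqrt r \<le> r powr (- 1 - (1 + \<alpha>) / 2) * sqrt r"
          using r by (intro mult_right_mono) auto
        also have "\<dots> = r powr (- 1 - \<alpha> / 2)" using r by (subst pw) (auto simp: field_simps)
        finally have "ennreal (?k r * sqrt r) \<le> ennreal (r powr (- 1 - \<alpha> / 2))" by (rule ennreal_leI)
        then show ?thesis using True r by (simp add: add_increasing)
      next
        case False
        have "?k r * sqrt r \<le> r powr (- 1 - (1 - \<alpha>) / 2) * sqrt r"
          using r by (intro mult_right_mono) auto
        also have "\<dots> = r powr (\<alpha> / 2 - 1)" using r by (subst pw) (auto simp: field_simps)
        also have "\<dots> \<le> 3 * (r powr (\<alpha> / 2 - 1) * exp (- 1 * r))"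
        proof -
          have "1 \<le> exp 1 * exp (- 1 * r)" using False by (simp add: exp_add[symmetric])
          moreover have "exp 1 * exp (- 1 * r) \<le> 3 * exp (- 1 * r)"
            by (intro mult_right_mono exp_le) auto
          ultimately have "1 \<le> 3 * exp (- 1 * r)" by (rule order_trans)
          from mult_left_mono[OF this, of "r powr (\<alpha> / 2 - 1)"] show ?thesis by simp
        qed
        finally have "ennreal (?k r * sqrt r) \<le> ennreal (3 * (r powr (\<alpha> / 2 - 1) * exp (- 1 * r)))" by (rule ennreal_leI)
        also have "\<dots> = ennreal 3 * ennreal (r powr (\<alpha> / 2 - 1) * exp (- 1 * r))" by (intro ennreal_mult) auto
        finally show ?thesis using False r by simp
      qed
    qed simp
  qed
  also have "\<dots> = ennreal 3 * ennreal (Gamma (\<alpha> / 2) * 1 powr - (\<alpha> / 2)) + ennreal (1 powr - (\<alpha> / 2) / (\<alpha> / 2))"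
    using \<alpha> nn_integral_Gamma_scaled[of "\<alpha> / 2" 1] nn_integral_powr_tail[of 1 "\<alpha> / 2"]
    by (subst nn_integral_add, simp, simp, subst nn_integral_cmult) auto
  also have "\<dots> < \<infinity>" by (simp add: ennreal_mult_less_top)
  finally show ?thesis .
qed

text \<open>
  Integrate the mixture bound; the hypothesis contributes \<open>C sqrt (r T)\<close> for each \<open>r\<close>, and \<open>sqrt r\<close>
  is integrable against the mixing kernel.
\<close>

lemma growth_majorant_integral:
  fixes \<alpha> C :: real and l :: "'z \<Rightarrow> real"
  assumes M: "finite_measure M" and \<alpha>: "0 < \<alpha>" "\<alpha> < 1"
    and [measurable]: "l \<in> borel_measurable M" and l: "\<And>z. 0 \<le> l z"
    and C: "\<And>r. 0 < r \<Longrightarrow> (LINT z|M. 1 - exp (- r * l z)) \<le> C * sqrt r"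
  obtains K where "0 \<le> K" "\<And>T. 0 < T \<Longrightarrow> (\<integral>\<^sup>+z. ennreal (growth_majorant \<alpha> (T * l z)) \<partial>M) \<le> ennreal (K * sqrt T)"
proof -
  interpret finite_measure M by fact
  interpret P: pair_sigma_finite M "lborel :: real measure" ..
  let ?k = "\<lambda>r. min (r powr (- 1 - (1 + \<alpha>) / 2)) (r powr (- 1 - (1 - \<alpha>) / 2)) :: real"
  define I where "I = enn2real (\<integral>\<^sup>+r. ennreal (?k r * sqrt r) * indicator {0<..} r \<partial>lborel)"
  have I: "(\<integral>\<^sup>+r. ennreal (?k r * sqrt r) * indicator {0<..} r \<partial>lborel) = ennreal I"
    unfolding I_def using growth_kernel_finite[OF \<alpha>] by simp
  have I0: "0 \<le> I" by (simp add: I_def)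
  define q where "q = 4 / (1 - exp (- 1 :: real))"
  have q: "0 < q" by (simp add: q_def)
  have C0: "0 \<le> C"
  proof -
    have "0 \<le> (LINT z|M. 1 - exp (- 1 * l z))" using l by (intro integral_nonneg_AE) auto
    then show ?thesis using C[of 1] by simp
  qed
  show ?thesis
  proof (rule that[of "q * (C * I)"])
    show "0 \<le> q * (C * I)" using q C0 I0 by simp
    fix T :: real assume T: "0 < T"
    have G: "(\<integral>\<^sup>+z. ennreal (1 - exp (- r * (T * l z))) \<partial>M) \<le> ennreal (C * sqrt (r * T))" if r: "0 < r" for r
    proof -
      have int: "integrable M (\<lambda>z. 1 - exp (- r * (T * l z)))"
        using r T l by (intro integrable_const_bound[of _ 1]) auto
      have "(\<integral>\<^sup>+z. ennreal (1 - exp (- r * (T * l z))) \<partial>M) = ennreal (LINT z|M. 1 - exp (- (r * T) * l z))"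
        using int r T l by (subst nn_integral_eq_integral) (auto simp: mult_ac)
      also have "\<dots> \<le> ennreal (C * sqrt (r * T))" using r T by (intro ennreal_leI C) auto
      finally show ?thesis .
    qed
    have pt: "ennreal (growth_majorant \<alpha> (T * l z))
       \<le> ennreal q * (\<integral>\<^sup>+r. ennreal (?k r * (1 - exp (- r * (T * l z)))) * indicator {0<..} r \<partial>lborel)" for z
    proof -
      have "ennreal (growth_majorant \<alpha> (T * l z)) = ennreal q * ennreal ((1 - exp (- 1)) / 4 * growth_majorant \<alpha> (T * l z))"
        using q growth_majorant_nonneg by (subst ennreal_mult[symmetric]) (auto simp: q_def)
      also have "\<dots> \<le> ennreal q * (\<integral>\<^sup>+r. ennreal (?k r * (1 - exp (- r * (T * l z)))) * indicator {0<..} r \<partial>lborel)"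
        using T l[of z] by (intro mult_left_mono growth_majorant_mixture \<alpha>) auto
      finally show ?thesis .
    qed
    have "(\<integral>\<^sup>+z. ennreal (growth_majorant \<alpha> (T * l z)) \<partial>M)
      \<le> (\<integral>\<^sup>+z. ennreal q * (\<integral>\<^sup>+r. ennreal (?k r * (1 - exp (- r * (T * l z)))) * indicator {0<..} r \<partial>lborel) \<partial>M)"
      by (intro nn_integral_mono pt)
    also have "\<dots> = ennreal q * (\<integral>\<^sup>+z. (\<integral>\<^sup>+r. ennreal (?k r * (1 - exp (- r * (T * l z)))) * indicator {0<..} r \<partial>lborel) \<partial>M)"
      by (rule nn_integral_cmult) measurable
    also have "(\<integral>\<^sup>+z. (\<integral>\<^sup>+r. ennreal (?k r * (1 - exp (- r * (T * l z)))) * indicator {0<..} r \<partial>lborel) \<partial>M)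
      = (\<integral>\<^sup>+r. (\<integral>\<^sup>+z. ennreal (?k r * (1 - exp (- r * (T * l z)))) * indicator {0<..} r \<partial>M) \<partial>lborel)"
      by (rule P.Fubini'[symmetric]) measurable
    also have "\<dots> \<le> (\<integral>\<^sup>+r. ennreal (C * sqrt T) * (ennreal (?k r * sqrt r) * indicator {0<..} r) \<partial>lborel)"
    proof (rule nn_integral_mono)
      fix r :: real
      show "(\<integral>\<^sup>+z. ennreal (?k r * (1 - exp (- r * (T * l z)))) * indicator {0<..} r \<partial>M)
         \<le> ennreal (C * sqrt T) * (ennreal (?k r * sqrt r) * indicator {0<..} r)"
      proof (cases "0 < r")
        case True
        define k where "k = ?k r"
        have k: "0 \<le> k" by (simp add: k_def)
        have "(\<integral>\<^sup>+z. ennreal (k * (1 - exp (- r * (T * l z)))) * indicator {0<..} r \<partial>M)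
          = ennreal k * (\<integral>\<^sup>+z. ennreal (1 - exp (- r * (T * l z))) \<partial>M)"
          using True k T l by (subst nn_integral_cmult[symmetric]) (auto simp: ennreal_mult)
        also have "\<dots> \<le> ennreal k * ennreal (C * sqrt (r * T))"
          by (intro mult_left_mono G True) auto
        also have "\<dots> = ennreal (C * sqrt T * (k * sqrt r))"
          using True T C0 k by (subst ennreal_mult[symmetric]) (auto simp: real_sqrt_mult mult_ac)
        also have "\<dots> = ennreal (C * sqrt T) * ennreal (k * sqrt r)"
          using True T C0 k by (intro ennreal_mult) auto
        finally show ?thesis using True by (simp add: k_def)
      qed simp
    qed
    also have "\<dots> = ennreal (C * sqrt T) * ennreal I"
      by (subst nn_integral_cmult) (simp_all add: I)
    also have "ennreal q * (ennreal (C * sqrt T) * ennreal I) = ennreal (q * (C * I) * sqrt T)"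
      using q C0 I0 T by (simp add: ennreal_mult[symmetric] mult_ac)
    finally show "(\<integral>\<^sup>+z. ennreal (growth_majorant \<alpha> (T * l z)) \<partial>M) \<le> ennreal (q * (C * I) * sqrt T)"
      by (simp add: mult_left_mono)
  qed
qed

section \<open>Logarithmic averages\<close>

text \<open>
  Integrate \<open>exp_remainder_approx\<close>; the majorant contributes an error of order \<open>sqrt T\<close> only.
\<close>

lemma exp_remainder_integral_approx:
  fixes \<alpha> C :: real and l :: "'z \<Rightarrow> real"
  assumes M: "finite_measure M" and \<alpha>: "0 < \<alpha>" "\<alpha> < 1" and N: "1 / \<alpha> = real N"
    and l_meas[measurable]: "l \<in> borel_measurable M" and l: "\<And>z. 0 \<le> l z"
    and C: "\<And>r. 0 < r \<Longrightarrow> (LINT z|M. 1 - exp (- r * l z)) \<le> C * sqrt r"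
  obtains K where "\<And>T. 0 < T \<Longrightarrow> T \<le> 1 \<Longrightarrow>
    \<bar>(LINT z|M. exp_remainder N ((T * l z) powr (\<alpha> / 2))) - sqrt T / (fact N * (2 * sqrt pi)) *
       (LINT r:{T..1}|lborel. r powr (- 3 / 2) * (LINT z|M. 1 - exp (- r * l z)))\<bar> \<le> K * sqrt T"
proof -
  interpret finite_measure M by fact
  obtain K0 where K0: "0 \<le> K0" "\<And>T. 0 < T \<Longrightarrow> (\<integral>\<^sup>+z. ennreal (growth_majorant \<alpha> (T * l z)) \<partial>M) \<le> ennreal (K0 * sqrt T)"
    by (rule growth_majorant_integral[OF M \<alpha> l_meas l C], assumption) (rule that)
  show ?thesis
  proof (rule that[of "measure M (space M) + (real N + 7) * K0"])
    fix T :: real assume T: "0 < T" "T \<le> 1"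
    define W where "W z = (LINT r:{T..1}|lborel. r powr (- 3 / 2) * (1 - exp (- r * l z)))" for z
    define c where "c = sqrt T / (fact N * (2 * sqrt pi))"
    let ?E = "\<lambda>z. exp_remainder N ((T * l z) powr (\<alpha> / 2))"
    let ?m = "\<lambda>z. growth_majorant \<alpha> (T * l z)"
    let ?R = "density lborel (\<lambda>r::real. ennreal (indicator {T..1} r))"
    have R: "finite_measure ?R"
      using T by (intro finite_measureI) (auto simp: emeasure_density ennreal_indicator)
    have m_int: "integrable M ?m" and m_le: "(LINT z|M. ?m z) \<le> K0 * sqrt T"
    proof -
      have "(\<integral>\<^sup>+z. ennreal (?m z) \<partial>M) < \<infinity>"
        using K0(2)[OF T(1)] by (rule le_less_trans) simp
      then show i: "integrable M ?m"
        by (intro integrableI_bounded) (auto simp: growth_majorant_nonneg)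
      have "ennreal (LINT z|M. ?m z) = (\<integral>\<^sup>+z. ennreal (?m z) \<partial>M)"
        by (rule nn_integral_eq_integral[symmetric, OF i]) (simp add: growth_majorant_nonneg)
      also have "\<dots> \<le> ennreal (K0 * sqrt T)" by (rule K0(2)[OF T(1)])
      finally show "(LINT z|M. ?m z) \<le> K0 * sqrt T"
        using K0(1) T by (subst (asm) ennreal_le_iff) auto
    qed
    have W_meas [measurable]: "W \<in> borel_measurable M"
      unfolding W_def[abs_def] set_lebesgue_integral_def by measurable
    have W_bound: "0 \<le> W z" "W z \<le> 2 / sqrt T" for z
      unfolding W_def using sqrt_mixture_truncated[OF l T] by auto
    have W_int: "integrable M W"
      by (rule integrable_const_bound[of _ "2 / sqrt T"]) (auto simp: W_bound)
    have E_meas [measurable]: "?E \<in> borel_measurable M"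
      unfolding exp_remainder_def by measurable
    have D_le: "\<bar>?E z - c * W z\<bar> \<le> sqrt T + (real N + 7) * ?m z" for z
      unfolding c_def W_def by (rule exp_remainder_approx[OF \<alpha> N l T])
    have D_int: "integrable M (\<lambda>z. ?E z - c * W z)"
      by (rule Bochner_Integration.integrable_bound[of M "\<lambda>z. sqrt T + (real N + 7) * ?m z"])
        (use m_int D_le T in \<open>auto intro!: AE_I2 intro: order_trans abs_ge_self\<close>)
    have E_int: "integrable M ?E"
      using Bochner_Integration.integrable_add[OF D_int integrable_mult_right[OF W_int, of c]] by simp
    have W_eq: "(LINT z|M. W z) = (LINT r:{T..1}|lborel. r powr (- 3 / 2) * (LINT z|M. 1 - exp (- r * l z)))"
    proof -
      \<comment> \<open>The indicator is repeated inside the integrand because the interchange of integrals asks for a bound at every \<open>r\<close>.\<close>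
      let ?f = "\<lambda>r z. indicator {T..1} r * (r powr (- 3 / 2) * (1 - exp (- r * l z)))"
      have R_int: "(LINT r|?R. g r) = (LINT r:{T..1}|lborel. g r)" if [measurable]: "g \<in> borel_measurable borel" for g :: "real \<Rightarrow> real"
        by (simp add: integral_density set_lebesgue_integral_def)
      have "(LINT z|M. W z) = (LINT z|M. LINT r|?R. ?f r z)"
        by (subst R_int) (auto simp: W_def set_lebesgue_integral_def indicator_def intro!: Bochner_Integration.integral_cong)
      also have "\<dots> = (LINT r|?R. LINT z|M. ?f r z)"
      proof (rule integral_swap_bounded[OF M R, of _ "T powr (- 3 / 2)"])
        show "norm (?f r z) \<le> T powr (- 3 / 2)" for r z
        proof (cases "r \<in> {T..1}")
          case True
          have "r powr (- 3 / 2) * (1 - exp (- r * l z)) \<le> T powr (- 3 / 2) * 1"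
            using True T l[of z] by (intro mult_mono powr_mono2') auto
          then show ?thesis using True T l[of z] by simp
        qed simp
      qed measurable
      also have "\<dots> = (LINT r:{T..1}|lborel. r powr (- 3 / 2) * (LINT z|M. 1 - exp (- r * l z)))"
        by (subst R_int) (auto simp: set_lebesgue_integral_def indicator_def intro!: Bochner_Integration.integral_cong)
      finally show ?thesis .
    qed
    have "(LINT z|M. ?E z) - c * (LINT r:{T..1}|lborel. r powr (- 3 / 2) * (LINT z|M. 1 - exp (- r * l z))) = (LINT z|M. ?E z - c * W z)"
      unfolding W_eq[symmetric] using E_int W_int by simp
    also have "\<bar>\<dots>\<bar> \<le> (LINT z|M. sqrt T + (real N + 7) * ?m z)"
      by (rule order_trans[OF integral_abs_bound integral_mono]) (use D_int m_int D_le in auto)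
    also have "\<dots> = measure M (space M) * sqrt T + (real N + 7) * (LINT z|M. ?m z)"
      using m_int by simp
    also have "\<dots> \<le> measure M (space M) * sqrt T + (real N + 7) * (K0 * sqrt T)"
      using m_le by (intro add_left_mono mult_left_mono) auto
    finally show "\<bar>(LINT z|M. ?E z) - sqrt T / (fact N * (2 * sqrt pi)) *
       (LINT r:{T..1}|lborel. r powr (- 3 / 2) * (LINT z|M. 1 - exp (- r * l z)))\<bar> \<le> (measure M (space M) + (real N + 7) * K0) * sqrt T"
      by (simp add: c_def algebra_simps)
  qed
qed

text \<open>
  The integrand is \<open>G r / sqrt r\<close> times \<open>1 / r\<close>, and \<open>1 / r\<close> has integral \<open>ln (1 / T)\<close>. Away from
  the origin the integrand is bounded and contributes a constant, which the logarithm absorbs.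
\<close>

lemma log_average_tendsto:
  fixes G :: "real \<Rightarrow> real"
  assumes [measurable]: "G \<in> borel_measurable borel"
    and bound: "\<And>r. 0 < r \<Longrightarrow> \<bar>G r\<bar> \<le> C * sqrt r"
    and lim: "((\<lambda>r. G r / sqrt r) \<longlongrightarrow> \<kappa>) (at_right 0)"
  shows "((\<lambda>T. (LINT r:{T..1}|lborel. r powr (- 3 / 2) * G r) / ln (1 / T)) \<longlongrightarrow> \<kappa>) (at_right 0)"
proof (rule tendstoI)
  fix e :: real assume e: "0 < e"
  have "\<forall>\<^sub>F r in at_right 0. dist (G r / sqrt r) \<kappa> < e / 2"
    using lim e by (intro tendstoD) auto
  then obtain d where d: "0 < d" "\<And>r. 0 < r \<Longrightarrow> r < d \<Longrightarrow> \<bar>G r / sqrt r - \<kappa>\<bar> < e / 2"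
    unfolding eventually_at_right_field dist_real_def by auto
  \<comment> \<open>Bounds \<open>|G r / sqrt r - \<kappa>| / r\<close> for \<open>r \<ge> d\<close>.\<close>
  define B where "B = (C + \<bar>\<kappa>\<bar>) / d"
  have C0: "0 \<le> C" using bound[of 1] by simp
  have B0: "0 \<le> B" using C0 d by (simp add: B_def)
  have gb: "\<bar>G r / sqrt r\<bar> \<le> C" if "0 < r" for r
    using bound[OF that] that by (simp add: divide_le_eq)
  have key: "\<bar>(LINT r:{T..1}|lborel. r powr (- 3 / 2) * G r) - \<kappa> * ln (1 / T)\<bar> \<le> e / 2 * ln (1 / T) + B"
    if T: "0 < T" "T < 1" for T
  proof -
    have inv_int: "set_integrable lborel {T..1} (\<lambda>r. 1 / r)"
      using T by (intro borel_integrable_atLeastAtMost' continuous_intros) auto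
    have inv: "(LINT r:{T..1}|lborel. 1 / r) = ln (1 / T)"
    proof -
      have "(LINT r:{T..1}|lborel. 1 / r) = ln 1 - ln T"
        unfolding set_lebesgue_integral_def
      proof (rule integral_FTC_atLeastAtMost)
        show "continuous_on {T..1} (\<lambda>r. 1 / r)" using T by (intro continuous_intros) auto
        show "(ln has_vector_derivative 1 / r) (at r within {T..1})" if "T \<le> r" "r \<le> 1" for r
          using that T by (auto intro!: derivative_eq_intros simp: has_real_derivative_iff_has_vector_derivative[symmetric])
      qed (use T in simp)
      then show ?thesis using T by (simp add: ln_div)
    qed
    have eq: "r powr (- 3 / 2) * G r = G r / sqrt r * (1 / r)" if "r \<in> {T..1}" for r
    proof -
      have r: "0 < r" using that T by auto
      have "r powr (- 3 / 2) = r powr (- 1 + - (1 / 2))" by simp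
      also have "\<dots> = r powr (- 1) * r powr (- (1 / 2))" by (rule powr_add)
      also have "\<dots> = 1 / r * (1 / sqrt r)"
        using r by (simp add: powr_minus_divide powr_half_sqrt)
      finally show ?thesis by simp
    qed
    have g_int: "set_integrable lborel {T..1} (\<lambda>r. G r / sqrt r * (1 / r))"
    proof (rule set_integrable_bound[OF set_integrable_mult_right[OF inv_int, of C]])
      show "set_borel_measurable lborel {T..1} (\<lambda>r. G r / sqrt r * (1 / r))"
        unfolding set_borel_measurable_def by measurable
      show "AE r in lborel. r \<in> {T..1} \<longrightarrow> norm (G r / sqrt r * (1 / r)) \<le> norm (C * (1 / r))"
      proof (intro AE_I2 impI)
        fix r assume "r \<in> {T..1}"
        then have r: "0 < r" using T by auto
        show "norm (G r / sqrt r * (1 / r)) \<le> norm (C * (1 / r))"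
          unfolding norm_mult using gb[OF r] C0 by (intro mult_right_mono) auto
      qed
    qed
    have a: "(LINT r:{T..1}|lborel. r powr (- 3 / 2) * G r) = (LINT r:{T..1}|lborel. G r / sqrt r * (1 / r))"
      by (rule set_lebesgue_integral_cong) (use eq in auto)
    have b: "\<kappa> * ln (1 / T) = (LINT r:{T..1}|lborel. \<kappa> * (1 / r))"
      unfolding inv[symmetric] by (rule set_integral_mult_right[symmetric])
    have "(LINT r:{T..1}|lborel. r powr (- 3 / 2) * G r) - \<kappa> * ln (1 / T)
       = (LINT r:{T..1}|lborel. G r / sqrt r * (1 / r)) - (LINT r:{T..1}|lborel. \<kappa> * (1 / r))"
      by (simp only: a b)
    also have "\<dots> = (LINT r:{T..1}|lborel. G r / sqrt r * (1 / r) - \<kappa> * (1 / r))"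
      by (rule set_integral_diff(2)[symmetric, OF g_int set_integrable_mult_right[OF inv_int]])
    also have "\<bar>\<dots>\<bar> \<le> (LINT r:{T..1}|lborel. e / 2 * (1 / r) + B)"
    proof -
      have 1: "set_integrable lborel {T..1} (\<lambda>r. G r / sqrt r * (1 / r) - \<kappa> * (1 / r))"
        by (rule set_integral_diff(1)[OF g_int set_integrable_mult_right[OF inv_int]])
      have 2: "set_integrable lborel {T..1} (\<lambda>r. e / 2 * (1 / r) + B)"
        using T by (intro borel_integrable_atLeastAtMost' continuous_intros) auto
      have pt: "\<bar>G r / sqrt r * (1 / r) - \<kappa> * (1 / r)\<bar> \<le> e / 2 * (1 / r) + B" if "r \<in> {T..1}" for r
      proof -
        have r: "0 < r" using that T by auto
        have "\<bar>G r / sqrt r * (1 / r) - \<kappa> * (1 / r)\<bar> = \<bar>G r / sqrt r - \<kappa>\<bar> * (1 / r)"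
          unfolding left_diff_distrib[symmetric] abs_mult using r by simp
        also have "\<dots> \<le> e / 2 * (1 / r) + B"
        proof (cases "r < d")
          case True
          then have "\<bar>G r / sqrt r - \<kappa>\<bar> * (1 / r) \<le> e / 2 * (1 / r)"
            using d(2)[OF r] r by (intro mult_right_mono) auto
          then show ?thesis using B0 by simp
        next
          case False
          have "\<bar>G r / sqrt r - \<kappa>\<bar> * (1 / r) \<le> (C + \<bar>\<kappa>\<bar>) * (1 / d)"
          proof (rule mult_mono)
            show "\<bar>G r / sqrt r - \<kappa>\<bar> \<le> C + \<bar>\<kappa>\<bar>" using gb[OF r] by linarith
          qed (use False d(1) r C0 in \<open>auto simp: frac_le\<close>)
          then show ?thesis using e r by (simp add: B_def add_increasing)
        qed
        finally show ?thesis .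
      qed
      show ?thesis
        unfolding set_lebesgue_integral_def
        by (rule order_trans[OF integral_abs_bound integral_mono])
          (use 1 2 pt in \<open>auto simp: set_integrable_def indicator_def\<close>)
    qed
    also have "\<dots> = e / 2 * ln (1 / T) + B * (1 - T)"
    proof -
      have c_int: "set_integrable lborel {T..1} (\<lambda>r. B)"
        by (intro borel_integrable_atLeastAtMost' continuous_intros)
      have "(LINT r:{T..1}|lborel. e / 2 * (1 / r) + B) = (LINT r:{T..1}|lborel. e / 2 * (1 / r)) + (LINT r:{T..1}|lborel. B)"
        by (rule set_integral_add(2)[OF set_integrable_mult_right[OF inv_int] c_int])
      also have "(LINT r:{T..1}|lborel. e / 2 * (1 / r)) = e / 2 * ln (1 / T)"
        unfolding inv[symmetric] by (rule set_integral_mult_right)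
      also have "(LINT r:{T..1}|lborel. B) = B * (1 - T)"
        using T by (simp add: set_lebesgue_integral_def)
      finally show ?thesis .
    qed
    also have "\<dots> \<le> e / 2 * ln (1 / T) + B"
      using T B0 by (simp add: mult_left_le)
    finally show ?thesis .
  qed
  have ln_top: "LIM T at_right (0::real). ln (1 / T) :> at_top"
    unfolding inverse_eq_divide[symmetric] by (rule filterlim_compose[OF ln_at_top filterlim_inverse_at_top_right])
  have "\<forall>\<^sub>F T in at_right 0. 2 * B / e + 1 \<le> ln (1 / T)"
    using ln_top by (simp add: filterlim_at_top)
  moreover have "\<forall>\<^sub>F T in at_right (0::real). T < 1"
    by (rule order_tendstoD(2)[OF tendsto_ident_at]) simp
  ultimately show "\<forall>\<^sub>F T in at_right 0. dist ((LINT r:{T..1}|lborel. r powr (- 3 / 2) * G r) / ln (1 / T)) \<kappa> < e"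
    using eventually_at_right_less[of 0]
  proof eventually_elim
    case (elim T)
    let ?L = "ln (1 / T)" and ?A = "LINT r:{T..1}|lborel. r powr (- 3 / 2) * G r"
    have "0 \<le> 2 * B / e" using B0 e by simp
    then have L: "0 < ?L" using elim(1) by linarith
    have "2 * B / e < ?L" using elim(1) by linarith
    then have "B < e / 2 * ?L" using e by (simp add: divide_less_eq mult.commute)
    then have "\<bar>?A - \<kappa> * ?L\<bar> < e * ?L"
      using key[OF elim(3,2)] by simp
    then have "\<bar>?A - \<kappa> * ?L\<bar> / ?L < e" using L by (simp add: divide_less_eq)
    moreover have "?A / ?L - \<kappa> = (?A - \<kappa> * ?L) / ?L" using L by (simp add: diff_divide_distrib)
    ultimately show ?case using L by (simp add: dist_real_def abs_divide)
  qed
qed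

text \<open>
  An Abelian theorem. Take \<open>T = t ^ (2 N)\<close>, so that \<open>sqrt T = t ^ N\<close> and
  \<open>ln (1 / T) = 2 N ln (1 / t)\<close>. The approximation turns the integral into a logarithmic average of
  the hypothesis \<open>lim\<close>, with error of order \<open>t ^ N\<close>; the constant is
  \<open>2 N / (N! 2 sqrt \<pi>) = 1 / ((N - 1)! sqrt \<pi>)\<close>.
\<close>

theorem exp_remainder_integral_asymptotics:
  fixes \<alpha> C :: real and l :: "'z \<Rightarrow> real"
  assumes M: "finite_measure M" and \<alpha>: "0 < \<alpha>" "\<alpha> < 1" and N: "1 / \<alpha> = real N"
    and l_meas[measurable]: "l \<in> borel_measurable M" and l: "\<And>z. 0 \<le> l z"
    and C: "\<And>r. 0 < r \<Longrightarrow> (LINT z|M. 1 - exp (- r * l z)) \<le> C * sqrt r"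
    and lim: "((\<lambda>r. (LINT z|M. 1 - exp (- r * l z)) / sqrt r) \<longlongrightarrow> \<kappa>) (at_right 0)"
  shows "((\<lambda>t. (LINT z|M. exp_remainder N (t * l z powr (\<alpha> / 2))) / (t ^ N * ln (1 / t)))
    \<longlongrightarrow> \<kappa> / (fact (N - 1) * sqrt pi)) (at_right 0)"
proof -
  interpret finite_measure M by fact
  define G where "G r = (LINT z|M. 1 - exp (- r * l z))" for r
  define A where "A T = (LINT r:{T..1}|lborel. r powr (- 3 / 2) * G r)" for T
  define J where "J t = (LINT z|M. exp_remainder N (t * l z powr (\<alpha> / 2)))" for t
  define c where "c = 1 / (fact N * (2 * sqrt pi))"
  obtain K where K: "\<And>T. 0 < T \<Longrightarrow> T \<le> 1 \<Longrightarrow>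
    \<bar>(LINT z|M. exp_remainder N ((T * l z) powr (\<alpha> / 2))) - sqrt T / (fact N * (2 * sqrt pi)) *
       (LINT r:{T..1}|lborel. r powr (- 3 / 2) * (LINT z|M. 1 - exp (- r * l z)))\<bar> \<le> K * sqrt T"
    by (rule exp_remainder_integral_approx[OF M \<alpha> N l_meas l C], assumption) (rule that)
  have \<alpha>N: "\<alpha> * real N = 1" using N \<alpha> by (simp add: field_simps)
  have N1: "1 \<le> N" using \<alpha>N by (cases N) auto
  \<comment> \<open>The substitution \<open>T = t ^ (2 * N)\<close>.\<close>
  have near: "\<bar>J t - t ^ N * (c * A (t ^ (2 * N)))\<bar> \<le> K * t ^ N" if t: "0 < t" "t < 1" for t
  proof -
    have T: "0 < t ^ (2 * N)" "t ^ (2 * N) \<le> 1" using t by (auto intro: power_le_one)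
    have sq: "sqrt (t ^ (2 * N)) = t ^ N"
    proof -
      have "t ^ (2 * N) = (t ^ N)\<^sup>2" by (simp add: power_mult[symmetric] mult.commute)
      then show ?thesis using t by simp
    qed
    have "(t ^ (2 * N) * l z) powr (\<alpha> / 2) = t * l z powr (\<alpha> / 2)" for z
    proof -
      have "(t ^ (2 * N)) powr (\<alpha> / 2) = t powr (real (2 * N) * (\<alpha> / 2))"
        using t by (simp only: powr_realpow[symmetric] powr_powr)
      also have "real (2 * N) * (\<alpha> / 2) = 1" using \<alpha>N by (simp add: mult.commute)
      finally show ?thesis using t l[of z] by (simp add: powr_mult)
    qed
    then show ?thesis
      using K[OF T] unfolding sq by (simp add: J_def A_def G_def c_def)
  qed
  have G_bound: "\<bar>G r\<bar> \<le> C * sqrt r" if "0 < r" for r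
  proof -
    have "0 \<le> G r" unfolding G_def using that l by (intro integral_nonneg_AE) auto
    then show ?thesis using C[OF that] by (simp add: G_def)
  qed
  have "((\<lambda>T. A T / ln (1 / T)) \<longlongrightarrow> \<kappa>) (at_right 0)"
    unfolding A_def
  proof (rule log_average_tendsto[OF _ G_bound])
    show "G \<in> borel_measurable borel" unfolding G_def[abs_def] by measurable
    show "((\<lambda>r. G r / sqrt r) \<longlongrightarrow> \<kappa>) (at_right 0)" using lim by (simp add: G_def)
  qed
  moreover have "filterlim (\<lambda>t::real. t ^ (2 * N)) (at_right 0) (at_right 0)"
  proof (rule tendsto_imp_filterlim_at_right)
    have "((\<lambda>t::real. t ^ (2 * N)) \<longlongrightarrow> 0 ^ (2 * N)) (at_right 0)" by (intro tendsto_intros)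
    then show "((\<lambda>t::real. t ^ (2 * N)) \<longlongrightarrow> 0) (at_right 0)" using N1 by (simp add: power_0_left)
    show "\<forall>\<^sub>F t::real in at_right 0. 0 < t ^ (2 * N)"
      using eventually_at_right_less[of "0::real"] by eventually_elim simp
  qed
  ultimately have "((\<lambda>t. A (t ^ (2 * N)) / ln (1 / t ^ (2 * N))) \<longlongrightarrow> \<kappa>) (at_right 0)"
    by (rule filterlim_compose)
  then have "((\<lambda>t. c * (2 * real N) * (A (t ^ (2 * N)) / ln (1 / t ^ (2 * N)))) \<longlongrightarrow> c * (2 * real N) * \<kappa>) (at_right 0)"
    by (intro tendsto_intros)
  then have main: "((\<lambda>t. c * A (t ^ (2 * N)) / ln (1 / t)) \<longlongrightarrow> c * (2 * real N) * \<kappa>) (at_right 0)"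
  proof (rule Lim_transform_eventually)
    show "\<forall>\<^sub>F t in at_right 0. c * (2 * real N) * (A (t ^ (2 * N)) / ln (1 / t ^ (2 * N))) = c * A (t ^ (2 * N)) / ln (1 / t)"
      using eventually_at_right_less[of 0]
    proof eventually_elim
      case (elim t)
      have "ln (1 / t ^ (2 * N)) = 2 * real N * ln (1 / t)"
        using elim by (simp add: ln_div ln_realpow)
      then show ?case using N1 by simp
    qed
  qed
  have ln_top: "LIM t at_right (0::real). ln (1 / t) :> at_top"
    unfolding inverse_eq_divide[symmetric] by (rule filterlim_compose[OF ln_at_top filterlim_inverse_at_top_right])
  have err: "((\<lambda>t. J t / (t ^ N * ln (1 / t)) - c * A (t ^ (2 * N)) / ln (1 / t)) \<longlongrightarrow> 0) (at_right 0)"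
  proof (rule Lim_null_comparison)
    show "((\<lambda>t. K / ln (1 / t)) \<longlongrightarrow> 0) (at_right 0)"
      by (intro tendsto_divide_0[OF tendsto_const] filterlim_at_top_imp_at_infinity ln_top)
    have "\<forall>\<^sub>F t in at_right (0::real). t < 1"
      by (rule order_tendstoD(2)[OF tendsto_ident_at]) simp
    then show "\<forall>\<^sub>F t in at_right 0. norm (J t / (t ^ N * ln (1 / t)) - c * A (t ^ (2 * N)) / ln (1 / t)) \<le> K / ln (1 / t)"
      using eventually_at_right_less[of 0]
    proof eventually_elim
      case (elim t)
      have L: "0 < ln (1 / t)" using elim by simp
      have tN: "0 < t ^ N" using elim by simp
      have "J t / (t ^ N * ln (1 / t)) - c * A (t ^ (2 * N)) / ln (1 / t)
         = (J t - t ^ N * (c * A (t ^ (2 * N)))) / (t ^ N * ln (1 / t))"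
        using L tN elim by (simp add: diff_divide_distrib)
      also have "norm \<dots> \<le> K * t ^ N / (t ^ N * ln (1 / t))"
        unfolding real_norm_def abs_divide using near[OF elim(2,1)] L tN
        by (simp only: abs_of_pos mult_pos_pos) (intro divide_right_mono, auto intro: less_imp_le)
      also have "\<dots> = K / ln (1 / t)" using tN by simp
      finally show ?case .
    qed
  qed
  have "c * (2 * real N) * \<kappa> = \<kappa> / (fact (N - 1) * sqrt pi)"
  proof -
    have "(fact N :: real) = real N * fact (N - 1)" using N1 by (intro fact_reduce) simp
    then show ?thesis using N1 by (simp add: c_def field_simps)
  qed
  then show ?thesis
    using tendsto_add[OF err main] by (simp add: J_def)
qed

section \<open>The small-time expansion of the heat loss\<close>

theorem theorem4:
  fixes \<alpha> :: real and N :: nat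
    and p :: "real \<Rightarrow> (real ^ 'n) measure" and \<Omega> :: "(real ^ 'n) set"
  assumes "0 < \<alpha>" and "\<alpha> < 1" and "1 / \<alpha> = real N"
    and "open \<Omega>" and "emeasure lborel \<Omega> < \<infinity>" and "perimeter \<Omega> < \<infinity>"
    and "stable_semigroup \<alpha> p"
  shows "((\<lambda>t. inverse (t powr (1 / \<alpha>) * ln (1 / t)) *
            (enn2real (heat_loss p \<Omega> t) -
             (\<Sum>n = 1..N - 1. (-1) ^ (n - 1) / fact n * t ^ n *
                enn2real (nonlocal_perimeter (stable_levy_measure (real n * \<alpha>)) \<Omega>))))
          \<longlongrightarrow> (-1) ^ (N - 1) / (fact (N - 1) * pi) * real_of_ereal (perimeter \<Omega>)) (at_right 0)"
proof -
  note \<alpha> = assms(1,2) and N = assms(3) and semigroup = assms(7)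
  have fin: "finite_volume_open \<Omega>" using assms(4,5) by (rule finite_volume_open.intro)
  interpret finite_volume_open \<Omega> by (rule fin)
  have "0 \<le> perimeter \<Omega>"
  proof -
    have "C1_compact_support (\<lambda>x::real ^ 'n. 0 :: real ^ 'n)"
      by (rule C1_compact_supportI[where D = "\<lambda>x v. 0"]) auto
    from perimeter_test_ge[OF this, of \<Omega>] show ?thesis
      by (simp add: divergence_def set_lebesgue_integral_def zero_ereal_def)
  qed
  then obtain P where P: "perimeter \<Omega> = ereal P"
    using assms(6) by (cases "perimeter \<Omega>") auto
  let ?S = "spectral_measure \<Omega>"
  let ?l = "\<lambda>\<xi>::real ^ 'n. (norm \<xi>)\<^sup>2"
  have upper: "(LINT \<xi>|?S. 1 - exp (- r * ?l \<xi>)) \<le> P / sqrt pi * sqrt r" if "0 < r" for r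
    using gauss_loss_le_perimeter[OF fin P that] by (simp add: gauss_loss_def real_sqrt_divide)
  have lim: "((\<lambda>r. (LINT \<xi>|?S. 1 - exp (- r * ?l \<xi>)) / sqrt r) \<longlongrightarrow> P / sqrt pi) (at_right 0)"
    using gauss_loss_asymptotics[OF fin P] by (simp add: gauss_loss_def)
  have l_meas: "?l \<in> borel_measurable ?S" by measurable
  have asymp: "((\<lambda>t. (LINT \<xi>|?S. exp_remainder N (t * ?l \<xi> powr (\<alpha> / 2))) / (t ^ N * ln (1 / t)))
     \<longlongrightarrow> P / sqrt pi / (fact (N - 1) * sqrt pi)) (at_right 0)"
    by (rule exp_remainder_integral_asymptotics[OF finite_measure_spectral_measure \<alpha> N l_meas _ upper lim]) auto
  have \<alpha>N: "\<alpha> * real N = 1" using N \<alpha> by (simp add: field_simps)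
  have pw: "?l \<xi> powr (\<alpha> / 2) = norm \<xi> powr \<alpha>" for \<xi> :: "real ^ 'n"
    by (cases "\<xi> = 0") (simp_all add: powr_powr flip: powr_numeral)
  have moment: "integrable ?S (\<lambda>\<xi>. norm \<xi> powr (real n * \<alpha>))"
      "enn2real (nonlocal_perimeter (stable_levy_measure (real n * \<alpha>)) \<Omega>) = (LINT \<xi>|?S. norm \<xi> powr (real n * \<alpha>))"
    if n: "n \<in> {1..N - 1}" for n
  proof -
    have n\<alpha>: "0 < real n * \<alpha>" "real n * \<alpha> \<le> 1 - \<alpha>"
    proof -
      have "real n \<le> real N - 1" using n by auto
      then have "real n * \<alpha> \<le> (real N - 1) * \<alpha>" using \<alpha> by (intro mult_right_mono) auto
      then show "real n * \<alpha> \<le> 1 - \<alpha>" using \<alpha>N by (simp add: algebra_simps)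
    qed (use n \<alpha> in auto)
    \<comment> \<open>Since \<open>n \<alpha> \<le> 1 - \<alpha>\<close>, the moments of order \<open>n \<alpha>\<close> are controlled by the majorant at \<open>T = 1\<close>.\<close>
    have g_int: "integrable ?S (\<lambda>\<xi>. growth_majorant \<alpha> (1 * ?l \<xi>))"
    proof -
      obtain K where "\<And>T. 0 < T \<Longrightarrow> (\<integral>\<^sup>+\<xi>. ennreal (growth_majorant \<alpha> (T * ?l \<xi>)) \<partial>?S) \<le> ennreal (K * sqrt T)"
        by (rule growth_majorant_integral[OF finite_measure_spectral_measure \<alpha> l_meas _ upper]) auto
      from this[of 1] show ?thesis
        by (intro integrableI_bounded) (auto simp: growth_majorant_nonneg intro: le_less_trans)
    qed
    have le: "norm \<xi> powr (real n * \<alpha>) \<le> 1 + growth_majorant \<alpha> (1 * ?l \<xi>)" for \<xi> :: "real ^ 'n"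
    proof (cases "norm \<xi> \<le> 1")
      case True
      have "norm \<xi> powr (real n * \<alpha>) \<le> 1" using True n\<alpha> by (intro powr_le1) auto
      then show ?thesis using growth_majorant_nonneg[of \<alpha> "1 * ?l \<xi>"] by linarith
    next
      case False
      have "norm \<xi> powr (real n * \<alpha>) \<le> norm \<xi> powr (1 - \<alpha>)" using False n\<alpha> by (intro powr_mono) auto
      also have "\<dots> = growth_majorant \<alpha> (1 * ?l \<xi>)"
      proof -
        have "?l \<xi> powr ((1 - \<alpha>) / 2) = norm \<xi> powr (1 - \<alpha>)"
        proof -
          have "?l \<xi> powr ((1 - \<alpha>) / 2) = (norm \<xi> powr 2) powr ((1 - \<alpha>) / 2)" using False by simp
          also have "\<dots> = norm \<xi> powr (2 * ((1 - \<alpha>) / 2))" by (rule powr_powr)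
          also have "2 * ((1 - \<alpha>) / 2) = 1 - \<alpha>" by simp
          finally show ?thesis .
        qed
        then show ?thesis using False \<alpha> by (subst growth_majorant_ge_1) (auto simp: one_le_power)
      qed
      finally show ?thesis by simp
    qed
    show int: "integrable ?S (\<lambda>\<xi>. norm \<xi> powr (real n * \<alpha>))"
    proof (rule Bochner_Integration.integrable_bound)
      show "integrable ?S (\<lambda>\<xi>. 1 + growth_majorant \<alpha> (1 * ?l \<xi>))"
        by (intro Bochner_Integration.integrable_add g_int) simp
      show "AE \<xi> in ?S. norm (norm \<xi> powr (real n * \<alpha>)) \<le> norm (1 + growth_majorant \<alpha> (1 * ?l \<xi>))"
        using le by (intro AE_I2) (auto intro: order_trans abs_ge_self)
    qed measurable
    have "nonlocal_perimeter (stable_levy_measure (real n * \<alpha>)) \<Omega> = (\<integral>\<^sup>+\<xi>. ennreal (norm \<xi> powr (real n * \<alpha>)) \<partial>?S)"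
      using n\<alpha> \<alpha> by (intro levy_perimeter_spectral[OF fin]) auto
    also have "\<dots> = ennreal (LINT \<xi>|?S. norm \<xi> powr (real n * \<alpha>))"
      by (intro nn_integral_eq_integral int) simp
    finally show "enn2real (nonlocal_perimeter (stable_levy_measure (real n * \<alpha>)) \<Omega>) = (LINT \<xi>|?S. norm \<xi> powr (real n * \<alpha>))"
      by (simp add: integral_nonneg_AE)
  qed
  have expansion: "enn2real (heat_loss p \<Omega> t) - (\<Sum>n = 1..N - 1. (-1) ^ (n - 1) / fact n * t ^ n *
        enn2real (nonlocal_perimeter (stable_levy_measure (real n * \<alpha>)) \<Omega>))
      = (-1) ^ (N - 1) * (LINT \<xi>|?S. exp_remainder N (t * ?l \<xi> powr (\<alpha> / 2)))" if t: "0 < t" for t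
  proof -
    let ?h = "\<lambda>\<xi>::real ^ 'n. 1 - exp (- t * norm \<xi> powr \<alpha>)"
    have h_int: "integrable ?S ?h"
      using t by (intro S.integrable_const_bound[of _ 1]) auto
    have "heat_loss p \<Omega> t = ennreal (LINT \<xi>|?S. ?h \<xi>)"
    proof -
      have "heat_loss p \<Omega> t = (\<integral>\<^sup>+\<xi>. ennreal (?h \<xi>) \<partial>?S)"
        using t by (intro heat_loss_spectral[OF fin semigroup]) simp
      also have "\<dots> = ennreal (LINT \<xi>|?S. ?h \<xi>)"
        by (rule nn_integral_eq_integral[OF h_int]) (use t in simp)
      finally show ?thesis .
    qed
    then have h: "enn2real (heat_loss p \<Omega> t) = (LINT \<xi>|?S. ?h \<xi>)"
      using t by (simp add: integral_nonneg_AE)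
    have "(\<Sum>n = 1..N - 1. (-1) ^ (n - 1) / fact n * t ^ n *
        enn2real (nonlocal_perimeter (stable_levy_measure (real n * \<alpha>)) \<Omega>))
      = (\<Sum>n = 1..N - 1. LINT \<xi>|?S. (-1) ^ (n - 1) / fact n * t ^ n * norm \<xi> powr (real n * \<alpha>))"
      by (intro sum.cong refl) (simp only: moment integral_mult_right_zero)
    also have "\<dots> = (LINT \<xi>|?S. (\<Sum>n = 1..N - 1. (-1) ^ (n - 1) / fact n * t ^ n * norm \<xi> powr (real n * \<alpha>)))"
      by (intro Bochner_Integration.integral_sum[symmetric] integrable_mult_right moment)
    finally have "enn2real (heat_loss p \<Omega> t) - (\<Sum>n = 1..N - 1. (-1) ^ (n - 1) / fact n * t ^ n *
        enn2real (nonlocal_perimeter (stable_levy_measure (real n * \<alpha>)) \<Omega>))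
      = (LINT \<xi>|?S. ?h \<xi> - (\<Sum>n = 1..N - 1. (-1) ^ (n - 1) / fact n * t ^ n * norm \<xi> powr (real n * \<alpha>)))"
      unfolding h
      by (simp only: Bochner_Integration.integral_diff[OF h_int Bochner_Integration.integrable_sum[OF integrable_mult_right[OF moment(1)]]])
    also have "\<dots> = (LINT \<xi>|?S. (-1) ^ (N - 1) * exp_remainder N (t * ?l \<xi> powr (\<alpha> / 2)))"
    proof (rule Bochner_Integration.integral_cong[OF refl])
      fix \<xi> :: "real ^ 'n"
      have "t ^ n * norm \<xi> powr (real n * \<alpha>) = (t * norm \<xi> powr \<alpha>) ^ n" if "n \<in> {1..N - 1}" for n
        using that by (cases "\<xi> = 0") (auto simp: power_mult_distrib powr_power power_0_left)
      then have "(\<Sum>n = 1..N - 1. (-1) ^ (n - 1) / fact n * t ^ n * norm \<xi> powr (real n * \<alpha>))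
         = (\<Sum>n = 1..N - 1. (-1) ^ (n - 1) / fact n * (t * norm \<xi> powr \<alpha>) ^ n)"
        by (intro sum.cong refl) (simp only: mult.assoc)
      moreover have "(-1) ^ (N - 1) * ((-1) ^ (N - 1) * x) = x" for x :: real
        by (simp add: mult.assoc[symmetric] power_mult_distrib[symmetric])
      ultimately show "?h \<xi> - (\<Sum>n = 1..N - 1. (-1) ^ (n - 1) / fact n * t ^ n * norm \<xi> powr (real n * \<alpha>))
         = (-1) ^ (N - 1) * exp_remainder N (t * ?l \<xi> powr (\<alpha> / 2))"
        by (simp only: exp_remainder_def pw mult_minus_left)
    qed
    also have "\<dots> = (-1) ^ (N - 1) * (LINT \<xi>|?S. exp_remainder N (t * ?l \<xi> powr (\<alpha> / 2)))"
      by (rule integral_mult_right_zero)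
    finally show ?thesis .
  qed
  have "((\<lambda>t. (-1) ^ (N - 1) * ((LINT \<xi>|?S. exp_remainder N (t * ?l \<xi> powr (\<alpha> / 2))) / (t ^ N * ln (1 / t))))
      \<longlongrightarrow> (-1) ^ (N - 1) * (P / sqrt pi / (fact (N - 1) * sqrt pi))) (at_right 0)"
    by (intro tendsto_mult tendsto_const asymp)
  also have "(-1) ^ (N - 1) * (P / sqrt pi / (fact (N - 1) * sqrt pi))
      = (-1) ^ (N - 1) / (fact (N - 1) * pi) * real_of_ereal (perimeter \<Omega>)"
    by (simp add: P)
  finally show ?thesis
  proof (rule Lim_transform_eventually)
    show "\<forall>\<^sub>F t in at_right 0. (-1) ^ (N - 1) * ((LINT \<xi>|?S. exp_remainder N (t * ?l \<xi> powr (\<alpha> / 2))) / (t ^ N * ln (1 / t)))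
      = inverse (t powr (1 / \<alpha>) * ln (1 / t)) * (enn2real (heat_loss p \<Omega> t) -
             (\<Sum>n = 1..N - 1. (-1) ^ (n - 1) / fact n * t ^ n *
                enn2real (nonlocal_perimeter (stable_levy_measure (real n * \<alpha>)) \<Omega>)))"
      using eventually_at_right_less[of 0]
    proof eventually_elim
      case (elim t)
      then have "t powr (1 / \<alpha>) = t ^ N" unfolding N by (rule powr_realpow)
      moreover have "s * (j / d) = inverse d * (s * j)" for s j d :: real
        by (simp add: divide_inverse)
      ultimately show ?case by (simp only: expansion[OF elim])
    qed
  qed
qed

end
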